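(* For every combi $K$ on the zonogon $Z_n$, its spectrum $V_K$ (the set of its vertices, regarded as subsets of $[n]$) is an inclusion-wise maximal w-collection in $2^{[n]}$.
   Context: Weak separation: for $A,B\subseteq[n]$, $A\lessdot B$ means every element of $A-B$ is smaller than every element of $B-A$; $A,B$ strongly separated if $A=B$, $A\lessdot B$ or $B\lessdot A$; $A\rhd B$ means $A-B\ne\emptyset$ and $B-A=B'\cup B''$, $B',B''$ nonempty, $B'$ entirely below $A-B$ and $A-B$ entirely below $B''$; $A,B$ weakly separated if strongly separated, or $A\rhd B$ with $|A|\ge|B|$, or $B\rhd A$ with $|B|\ge|A|$. A w-collection is a family of pairwise weakly separated sets. Fix vectors $\xi_1,\dots,\xi_n$ in the upper half-plane, in clockwise order around the origin, of norm $1$, $\mathbb Z$-independent; $Z_n=\{\sum\lambda_i\xi_i:0\le\lambda_i\le1\}$; $X\subseteq[n]$ is identified with $\sum_{i\in X}\xi_i$. Write $Xi=X\cup\{i\}$, $Y-j=Y\setminus\{j\}$, $\varepsilon_{ij}=\xi_j-\xi_i$ ($i<j$). A combi on $Z_n$ is a finite collection $K$ of convex polygons (tiles) with union $Z_n$, any two disjoint or meeting in a common vertex or common side, each boundary edge of $Z_n$ in exactly one tile, such that all vertices are points of subsets of $[n]$, every edge is a V-edge of type $i$ (segment from $X$ to $Xi$) or an H-edge of type $ij$, $i<j$ (segment from $A$ to $(A\setminus\{i\})\cup\{j\}$), and each tile is one of: a $\Delta$-tile, the triangle with vertices $Xi,Xj,Xij$ ($i<j$); a $\nabla$-tile, the triangle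 with vertices $X,Xi,Xj$ ($i<j$); or a lens, a convex polygon bounded by two paths of H-edges with common endpoints, the upper one with vertices $Xi_0,Xi_1,\dots,Xi_q$ ($q\ge2$, $i_0<\dots<i_q$) and the lower one with vertices $Y-j_0,\dots,Y-j_{q'}$ ($q'\ge2$, $j_0>\dots>j_{q'}$), where $Xi_0=Y-j_0$ and $Xi_q=Y-j_{q'}$. *)

theory Defs
  imports "HOL-Analysis.Analysis"
begin

section \<open>Weak separation\<close>

definition set_lessdot :: "nat set \<Rightarrow> nat set \<Rightarrow> bool" where
  "set_lessdot A B \<longleftrightarrow> (\<forall>a\<in>A - B. \<forall>b\<in>B - A. a < b)"

definition strongly_separated :: "nat set \<Rightarrow> nat set \<Rightarrow> bool" where
  "strongly_separated A B \<longleftrightarrow> A = B \<or> set_lessdot A B \<or> set_lessdot B A"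

definition surrounded_by :: "nat set \<Rightarrow> nat set \<Rightarrow> bool" where
  "surrounded_by A B \<longleftrightarrow> A - B \<noteq> {} \<and>
     (\<exists>B' B''. B - A = B' \<union> B'' \<and> B' \<noteq> {} \<and> B'' \<noteq> {} \<and>
        (\<forall>b\<in>B'. \<forall>a\<in>A - B. b < a) \<and> (\<forall>a\<in>A - B. \<forall>b\<in>B''. a < b))"

definition weakly_separated :: "nat set \<Rightarrow> nat set \<Rightarrow> bool" where
  "weakly_separated A B \<longleftrightarrow> strongly_separated A B \<or>
     (surrounded_by A B \<and> card A \<ge> card B) \<or> (surrounded_by B A \<and> card B \<ge> card A)"

definition w_collection :: "nat \<Rightarrow> nat set set \<Rightarrow> bool" where
  "w_collection n C \<longleftrightarrow> C \<subseteq> Pow {1..n} \<and> pairwise weakly_separated C"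

definition maximal_w_collection :: "nat \<Rightarrow> nat set set \<Rightarrow> bool" where
  "maximal_w_collection n C \<longleftrightarrow>
     w_collection n C \<and> (\<forall>D. w_collection n D \<and> C \<subseteq> D \<longrightarrow> D = C)"

section \<open>The zonogon\<close>

text \<open>The plane is the complex plane. On the open upper half-plane \<open>Arg\<close> takes values
  strictly between \<open>0\<close> and \<open>pi\<close>, so clockwise order is decreasing argument.\<close>

definition zonogon_generators :: "nat \<Rightarrow> (nat \<Rightarrow> complex) \<Rightarrow> bool" where
  "zonogon_generators n \<xi> \<longleftrightarrow>
     (\<forall>i\<in>{1..n}. Im (\<xi> i) > 0 \<and> norm (\<xi> i) = 1) \<and>
     (\<forall>i\<in>{1..n}. \<forall>j\<in>{1..n}. i < j \<longrightarrow> Arg (\<xi> j) < Arg (\<xi> i)) \<and>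
     (\<forall>c :: nat \<Rightarrow> int. (\<Sum>i\<in>{1..n}. of_int (c i) * \<xi> i) = 0 \<longrightarrow> (\<forall>i\<in>{1..n}. c i = 0))"

definition zonogon :: "nat \<Rightarrow> (nat \<Rightarrow> complex) \<Rightarrow> complex set" where
  "zonogon n \<xi> =
     {(\<Sum>i\<in>{1..n}. l i *\<^sub>R \<xi> i) | l :: nat \<Rightarrow> real. \<forall>i\<in>{1..n}. 0 \<le> l i \<and> l i \<le> 1}"

definition pt :: "(nat \<Rightarrow> complex) \<Rightarrow> nat set \<Rightarrow> complex" where
  "pt \<xi> X = (\<Sum>i\<in>X. \<xi> i)"

section \<open>Edges and tiles\<close>

text \<open>Tiles are point sets in the plane; their vertices and sides are the library's
  extreme points and edges (one-dimensional faces). In writing \<open>Xi\<close> (\<open>Y - j\<close>)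
  it is understood that \<open>i \<notin> X\<close> (\<open>j \<in> Y\<close>).\<close>

definition V_edge :: "nat \<Rightarrow> (nat \<Rightarrow> complex) \<Rightarrow> nat \<Rightarrow> complex set \<Rightarrow> bool" where
  "V_edge n \<xi> i e \<longleftrightarrow> i \<in> {1..n} \<and>
     (\<exists>X\<subseteq>{1..n}. i \<notin> X \<and> e = closed_segment (pt \<xi> X) (pt \<xi> (insert i X)))"

definition H_edge :: "nat \<Rightarrow> (nat \<Rightarrow> complex) \<Rightarrow> nat \<Rightarrow> nat \<Rightarrow> complex set \<Rightarrow> bool" where
  "H_edge n \<xi> i j e \<longleftrightarrow> i \<in> {1..n} \<and> j \<in> {1..n} \<and> i < j \<and>
     (\<exists>A\<subseteq>{1..n}. i \<in> A \<and> j \<notin> A \<and>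
        e = closed_segment (pt \<xi> A) (pt \<xi> (insert j (A - {i}))))"

definition Delta_tile :: "nat \<Rightarrow> (nat \<Rightarrow> complex) \<Rightarrow> complex set \<Rightarrow> bool" where
  "Delta_tile n \<xi> P \<longleftrightarrow>
     (\<exists>X i j. X \<subseteq> {1..n} \<and> i \<in> {1..n} - X \<and> j \<in> {1..n} - X \<and> i < j \<and>
        P = convex hull {pt \<xi> (insert i X), pt \<xi> (insert j X), pt \<xi> (insert i (insert j X))})"

definition Nabla_tile :: "nat \<Rightarrow> (nat \<Rightarrow> complex) \<Rightarrow> complex set \<Rightarrow> bool" where
  "Nabla_tile n \<xi> P \<longleftrightarrow>
     (\<exists>X i j. X \<subseteq> {1..n} \<and> i \<in> {1..n} - X \<and> j \<in> {1..n} - X \<and> i < j \<and>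
        P = convex hull {pt \<xi> X, pt \<xi> (insert i X), pt \<xi> (insert j X)})"

definition polyline :: "complex list \<Rightarrow> complex set" where
  "polyline ps = (\<Union>k<length ps - 1. closed_segment (ps ! k) (ps ! Suc k))"

text \<open>Below, \<open>us\<close> is the list \<open>i\<^sub>0 < \<dots> < i\<^sub>q\<close> and \<open>vs\<close> the list \<open>j\<^sub>0 > \<dots> > j\<^sub>q\<^sub>'\<close>;
  the length bounds say \<open>q, q' \<ge> 2\<close>.\<close>

definition lens :: "nat \<Rightarrow> (nat \<Rightarrow> complex) \<Rightarrow> complex set \<Rightarrow> bool" where
  "lens n \<xi> P \<longleftrightarrow>
     (\<exists>X Y us vs. X \<subseteq> {1..n} \<and> Y \<subseteq> {1..n} \<and>
        set us \<subseteq> {1..n} - X \<and> set vs \<subseteq> Y \<and>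
        sorted_wrt (<) us \<and> sorted_wrt (>) vs \<and> length us \<ge> 3 \<and> length vs \<ge> 3 \<and>
        insert (hd us) X = Y - {hd vs} \<and> insert (last us) X = Y - {last vs} \<and>
        (let upper = map (\<lambda>i. pt \<xi> (insert i X)) us;
             lower = map (\<lambda>j. pt \<xi> (Y - {j})) vs
         in P = convex hull (set upper \<union> set lower) \<and>
            frontier P = polyline upper \<union> polyline lower))"

section \<open>Combies\<close>

definition combi :: "nat \<Rightarrow> (nat \<Rightarrow> complex) \<Rightarrow> complex set set \<Rightarrow> bool" where
  "combi n \<xi> K \<longleftrightarrow>
     finite K \<and> \<Union>K = zonogon n \<xi> \<and>
     (\<forall>P\<in>K. Delta_tile n \<xi> P \<or> Nabla_tile n \<xi> P \<or> lens n \<xi> P) \<and>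
     (\<forall>P\<in>K. \<forall>v. v extreme_point_of P \<longrightarrow> (\<exists>X\<subseteq>{1..n}. v = pt \<xi> X)) \<and>
     (\<forall>P\<in>K. \<forall>e. e edge_of P \<longrightarrow> (\<exists>i. V_edge n \<xi> i e) \<or> (\<exists>i j. H_edge n \<xi> i j e)) \<and>
     (\<forall>P\<in>K. \<forall>Q\<in>K. P \<noteq> Q \<longrightarrow>
        P \<inter> Q = {} \<or>
        (\<exists>v. P \<inter> Q = {v} \<and> v extreme_point_of P \<and> v extreme_point_of Q) \<or>
        (P \<inter> Q edge_of P \<and> P \<inter> Q edge_of Q)) \<and>
     (\<forall>e. e edge_of zonogon n \<xi> \<longrightarrow> (\<exists>!P. P \<in> K \<and> e \<subseteq> P))"

text \<open>Integral independence makes \<open>X \<mapsto> pt \<xi> X\<close> injective on the subsets of \<open>{1..n}\<close>,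
  so each vertex of the combi corresponds to exactly one member of the spectrum.\<close>

definition spectrum :: "nat \<Rightarrow> (nat \<Rightarrow> complex) \<Rightarrow> complex set set \<Rightarrow> nat set set" where
  "spectrum n \<xi> K = {X. X \<subseteq> {1..n} \<and> (\<exists>P\<in>K. pt \<xi> X extreme_point_of P)}"

end

theory Submission
  imports Defs
begin

text \<open>
  Cut every lens into two fans of triangles and orient all triangles counterclockwise. The
  result is a 2-chain, supported on four types of positive triangles of subsets of \<open>[n]\<close>,
  whose boundary is the boundary cycle of the zonogon; from here on only this formal identity
  is used. Deleting the largest or the smallest element maps such chains to such chains (the
  triangles collapse or change type), so by induction two sets of the chain can only fail to be
  weakly separated if \<open>A - B\<close> contains both extreme elements, surrounds \<open>B - A\<close>, and
  \<open>|A| = |B| + 1\<close>. Conversely, adding a new largest element to the sets of size at most \<open>|B|\<close>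
  yields a chain on one more element; deleting the smallest element afterwards is a
  rotation which turns the bad pair \<open>(A, B)\<close> into the bad pair \<open>(B \<union> {n + 1}, A - {1})\<close>. Two rotations
  leave only \<open>n = 3\<close>, \<open>A = {1, 3}\<close>, \<open>B = {2}\<close>, which is excluded directly. Maximality follows by
  counting: deleting \<open>n\<close> loses at least \<open>n\<close> sets of a chain (one pair \<open>X\<close>, \<open>Xn\<close> on every level),
  and at most \<open>n\<close> sets of a weakly separated collection.
\<close>

text \<open>Deletion alone cannot finish the induction, because an overfull pair becomes weakly
  separated as soon as either extreme element is deleted. Rotation gets around this: it keeps the
  number of elements, and the rotated pair must be overfull again, hence contain the new extreme
  elements in prescribed places. No drawing of a rotated chain is at hand, so the geometry is given
  up for the boundary identity. The identity survives every map of the vertices; only the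
  orientation of the image triangles has to be checked. Planarity and multiplicity one are never
  assumed of a chain. A link argument replaces them: tested on functions supported at one set
  \<open>A\<close>, the identity says that the link of an inner set is closed, so a ranking of the
  neighbours of \<open>A\<close> cannot fall in every triangle at \<open>A\<close>. Hence deletion
  loses no set; with one more test function, the same argument settles three elements. Unit length
  of the generators matters for lenses: the upper vertices lie on the unit circle about
  \<open>X\<close>, the lower ones on the unit circle about \<open>Y\<close>.\<close>

section \<open>Positive triangle chains\<close>

text \<open>Corners are listed counterclockwise, up to rotation. A lens is cut into triangles of the
  types \<open>upper\<close> and \<open>lower\<close>.\<close>

inductive tri :: "nat set \<Rightarrow> nat set \<times> nat set \<times> nat set \<Rightarrow> bool" for G where
  nabla: "X \<subseteq> G \<Longrightarrow> i \<in> G - X \<Longrightarrow> j \<in> G - X \<Longrightarrow> i < j \<Longrightarrow> tri G (X, insert j X, insert i X)"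
| delta: "X \<subseteq> G \<Longrightarrow> i \<in> G - X \<Longrightarrow> j \<in> G - X \<Longrightarrow> i < j \<Longrightarrow>
    tri G (insert i X, insert j X, insert i (insert j X))"
| upper: "X \<subseteq> G \<Longrightarrow> i \<in> G - X \<Longrightarrow> j \<in> G - X \<Longrightarrow> k \<in> G - X \<Longrightarrow> i < j \<Longrightarrow> j < k \<Longrightarrow>
    tri G (insert i X, insert k X, insert j X)"
| lower: "X \<subseteq> G \<Longrightarrow> i \<in> G - X \<Longrightarrow> j \<in> G - X \<Longrightarrow> k \<in> G - X \<Longrightarrow> i < j \<Longrightarrow> j < k \<Longrightarrow>
    tri G (insert i (insert j X), insert i (insert k X), insert j (insert k X))"
| rot: "tri G (A, B, C) \<Longrightarrow> tri G (B, C, A)"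

fun coboundary :: "('a \<Rightarrow> 'a \<Rightarrow> int) \<Rightarrow> 'a \<times> 'a \<times> 'a \<Rightarrow> int" where
  "coboundary f (A, B, C) = f A B + f B C + f C A"

fun corners :: "'a \<times> 'a \<times> 'a \<Rightarrow> 'a set" where
  "corners (A, B, C) = {A, B, C}"

fun map_tri :: "('a \<Rightarrow> 'b) \<Rightarrow> 'a \<times> 'a \<times> 'a \<Rightarrow> 'b \<times> 'b \<times> 'b" where
  "map_tri g (A, B, C) = (g A, g B, g C)"

fun degenerate :: "'a \<times> 'a \<times> 'a \<Rightarrow> bool" where
  "degenerate (A, B, C) \<longleftrightarrow> A = B \<or> B = C \<or> C = A"

definition antisymmetric :: "('a \<Rightarrow> 'a \<Rightarrow> int) \<Rightarrow> bool" where
  "antisymmetric f \<longleftrightarrow> (\<forall>A B. f A B = - f B A)"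

text \<open>The boundary path is run counterclockwise: upwards on the right, where large elements
  enter first, and downwards on the left. Antisymmetry turns the downward direction into the minus
  sign.\<close>

definition bdry :: "nat \<Rightarrow> nat \<Rightarrow> (nat set \<Rightarrow> nat set \<Rightarrow> int) \<Rightarrow> int" where
  "bdry a b f = (\<Sum>k\<in>{a..<b}. f {Suc k..<b} {k..<b} - f {a..<k} {a..<Suc k})"

text \<open>A formal boundary is encoded by its values on all antisymmetric functions of ordered
  pairs. No group of 1-chains has to be built, and special functions serve directly as
  tests.\<close>

definition chain :: "nat \<Rightarrow> nat \<Rightarrow> (nat set \<times> nat set \<times> nat set) multiset \<Rightarrow> bool" where
  "chain a b c \<longleftrightarrow> (\<forall>T\<in>#c. tri {a..<b} T) \<and>
     (\<forall>f. antisymmetric f \<longrightarrow> (\<Sum>T\<in>#c. coboundary f T) = bdry a b f)"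

definition boundary_sets :: "nat \<Rightarrow> nat \<Rightarrow> nat set set" where
  "boundary_sets a b = (\<lambda>k. {a..<k}) ` {a..b} \<union> (\<lambda>k. {k..<b}) ` {a..b}"

text \<open>The boundary sets are added by hand: over fewer than two elements there are no
  triangles, and repeated contraction leads there.\<close>

definition chain_sets :: "nat \<Rightarrow> nat \<Rightarrow> (nat set \<times> nat set \<times> nat set) multiset \<Rightarrow> nat set set" where
  "chain_sets a b c = boundary_sets a b \<union> (\<Union>T\<in>set_mset c. corners T)"

lemma antisymmetricD: "antisymmetric f \<Longrightarrow> f A B = - f B A"
  unfolding antisymmetric_def by blast

lemma antisymmetric_diag: "antisymmetric f \<Longrightarrow> f A A = 0"
  using antisymmetricD[of f A A] by simp

lemma coboundary_comp: "coboundary (\<lambda>A B. f (g A) (g B)) T = coboundary f (map_tri g T)"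
  by (cases T) simp

lemma coboundary_degenerate:
  assumes "antisymmetric f" "degenerate T"
  shows "coboundary f T = 0"
proof (cases T)
  case (fields A B C)
  then show ?thesis
    using assms(2) antisymmetric_diag[OF assms(1)] antisymmetricD[OF assms(1), of A B]
      antisymmetricD[OF assms(1), of A C] antisymmetricD[OF assms(1), of B C] by auto
qed

lemma tri_corners_subset: "tri G T \<Longrightarrow> A \<in> corners T \<Longrightarrow> A \<subseteq> G"
  by (induction rule: tri.induct) auto

lemma chain_sets_subset:
  assumes "chain a b c" "A \<in> chain_sets a b c"
  shows "A \<subseteq> {a..<b}"
proof -
  have "A \<in> boundary_sets a b \<or> (\<exists>T\<in>#c. A \<in> corners T)"
    using assms(2) unfolding chain_sets_def by auto
  then show ?thesis
  proof
    assume "A \<in> boundary_sets a b"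
    then show ?thesis unfolding boundary_sets_def by auto
  next
    assume "\<exists>T\<in>#c. A \<in> corners T"
    then show ?thesis using assms(1) tri_corners_subset unfolding chain_def by blast
  qed
qed

subsection \<open>Contraction of an extreme element\<close>

text \<open>An extreme \<open>x\<close> is never the middle index of an upper or lower triangle.
  Deleting the middle index would produce a nabla or delta triangle with the wrong orientation;
  deleting an outer index keeps it right.\<close>

lemma tri_delete:
  assumes "tri G T" "(\<forall>y\<in>G. y \<le> x) \<or> (\<forall>y\<in>G. x \<le> y)"
  shows "degenerate (map_tri (\<lambda>A. A - {x}) T) \<or> tri (G - {x}) (map_tri (\<lambda>A. A - {x}) T)"
  using assms(1)
proof (induction rule: tri.induct)
  case (nabla X i j)
  show ?case
  proof (cases "x = i \<or> x = j")
    case False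
    then show ?thesis using tri.nabla[of "X - {x}" "G - {x}" i j] nabla by (auto simp: insert_Diff_if)
  qed (use nabla in auto)
next
  case (delta X i j)
  show ?case
  proof (cases "x = i \<or> x = j")
    case False
    then show ?thesis using tri.delta[of "X - {x}" "G - {x}" i j] delta by (auto simp: insert_Diff_if)
  qed (use delta in auto)
next
  case (upper X i j k)
  consider "x \<notin> {i,j,k}" | "x = i" | "x = k" using assms(2) upper by force
  then show ?case
  proof cases
    case 1
    then show ?thesis using tri.upper[of "X - {x}" "G - {x}" i j k] upper by (auto simp: insert_Diff_if)
  next
    case 2
    then show ?thesis using tri.nabla[of "X - {x}" "G - {x}" j k] upper by (auto simp: insert_Diff_if)
  next
    case 3
    then show ?thesis using tri.rot[OF tri.rot[OF tri.nabla[of "X - {x}" "G - {x}" i j]]] upper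
      by (auto simp: insert_Diff_if)
  qed
next
  case (lower X i j k)
  consider "x \<notin> {i,j,k}" | "x = i" | "x = k" using assms(2) lower by force
  then show ?case
  proof cases
    case 1
    then show ?thesis using tri.lower[of "X - {x}" "G - {x}" i j k] lower by (auto simp: insert_Diff_if)
  next
    case 2
    then show ?thesis using tri.delta[of "X - {x}" "G - {x}" j k] lower by (auto simp: insert_Diff_if)
  next
    case 3
    then show ?thesis using tri.rot[OF tri.rot[OF tri.delta[of "X - {x}" "G - {x}" i j]]] lower
      by (auto simp: insert_Diff_if)
  qed
next
  case (rot A B C)
  then show ?case by (auto intro: tri.rot)
qed

text \<open>A test function supported on the edges at \<open>A\<close>. On a triangle
  \<open>(A, B, C)\<close> its coboundary is \<open>h B - h C\<close>, the fall of \<open>h\<close>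
  along the link of \<open>A\<close>.\<close>

definition link :: "'a \<Rightarrow> ('a \<Rightarrow> int) \<Rightarrow> 'a \<Rightarrow> 'a \<Rightarrow> int" where
  "link A h P Q = (if P = Q then 0 else if P = A then h Q else if Q = A then - h P else 0)"

lemma antisymmetric_link: "antisymmetric (link A h)"
  unfolding antisymmetric_def link_def by auto

lemma bdry_link:
  assumes "A \<notin> boundary_sets a b"
  shows "bdry a b (link A h) = 0"
proof -
  have "link A h {Suc k..<b} {k..<b} - link A h {a..<k} {a..<Suc k} = 0" if "k \<in> {a..<b}" for k
  proof -
    have "{Suc k..<b} \<in> boundary_sets a b" "{k..<b} \<in> boundary_sets a b"
      "{a..<k} \<in> boundary_sets a b" "{a..<Suc k} \<in> boundary_sets a b"
      using that unfolding boundary_sets_def by auto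
    with assms have "A \<noteq> {Suc k..<b}" "A \<noteq> {k..<b}" "A \<noteq> {a..<k}" "A \<noteq> {a..<Suc k}" by metis+
    then show ?thesis unfolding link_def by auto
  qed
  then show ?thesis unfolding bdry_def by (simp add: sum.neutral)
qed

lemma coboundary_link_away: "A \<notin> corners T \<Longrightarrow> coboundary (link A h) T = 0"
  by (cases T) (auto simp: link_def)

lemma coboundary_link:
  assumes "\<not> degenerate (A, B, C)"
  shows "coboundary (link A h) (A, B, C) = h B - h C"
    and "coboundary (link A h) (C, A, B) = h B - h C"
    and "coboundary (link A h) (B, C, A) = h B - h C"
  using assms by (auto simp: link_def)

lemma tri_nondegenerate: "tri G T \<Longrightarrow> \<not> degenerate T"
  by (induction rule: tri.induct) (auto elim!: equalityE)

lemma coboundary_link_pos: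
  assumes "\<not> degenerate (P, Q, R)" "A \<in> corners (P, Q, R)"
    "A = P \<Longrightarrow> h Q > h R" "A = Q \<Longrightarrow> h R > h P" "A = R \<Longrightarrow> h P > h Q"
  shows "coboundary (link A h) (P, Q, R) > 0"
  using assms coboundary_link[of P Q R h] coboundary_link[of Q R P h] coboundary_link[of R P Q h]
  by auto

text \<open>Sets that differ by an exchange of two elements stay distinct when only one element is
  deleted. This is why upper and lower triangles never collapse.\<close>

lemma insert_minus_neq:
  assumes "i \<noteq> k" "i \<notin> X" "k \<notin> X"
  shows "insert i X - {x} \<noteq> insert k X - {x}"
  using assms by (cases "x = i") blast+

text \<open>The function \<open>h\<close> ranks the neighbours of \<open>A\<close> so that it decreases along the link of \<open>A\<close>
  in every triangle collapsed by the deletion of \<open>x\<close>.\<close>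

lemma coboundary_link_collapsed_max:
  fixes A :: "nat set" and x :: nat
  defines "h \<equiv> \<lambda>Q. if x \<in> A then 2 * int (card Q) + of_bool (x \<notin> Q)
                    else of_bool (x \<in> Q) - 2 * int (card Q)"
  assumes "tri G T" "finite G" "\<forall>y\<in>G. y \<le> x"
    "degenerate (map_tri (\<lambda>A. A - {x}) T)" "A \<in> corners T"
  shows "coboundary (link A h) T > 0"
  using assms(2,5,6)
proof (induction rule: tri.induct)
  case (nabla X i j)
  then have "finite X" using assms(3) finite_subset by blast
  moreover have "x = i \<or> x = j" using nabla by auto
  then have "x = j" using nabla assms(4) by force
  ultimately have "A = X \<Longrightarrow> h (insert j X) > h (insert i X)" "A = insert j X \<Longrightarrow> h (insert i X) > h (X)"
    "A = insert i X \<Longrightarrow> h (X) > h (insert j X)"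
    using nabla(1-4) by (simp_all add: h_def card_insert_if)
  then show ?case
    by (intro coboundary_link_pos[OF tri_nondegenerate[OF tri.nabla[OF nabla(1-4)]] nabla(6)])
next
  case (delta X i j)
  then have "finite X" using assms(3) finite_subset by blast
  moreover have "x = i \<or> x = j" using delta by auto
  then have "x = j" using delta assms(4) by force
  ultimately have "A = insert i X \<Longrightarrow> h (insert j X) > h (insert i (insert j X))" "A = insert j X \<Longrightarrow> h (insert i (insert j X)) > h (insert i X)"
    "A = insert i (insert j X) \<Longrightarrow> h (insert i X) > h (insert j X)"
    using delta(1-4) by (simp_all add: h_def card_insert_if)
  then show ?case
    by (intro coboundary_link_pos[OF tri_nondegenerate[OF tri.delta[OF delta(1-4)]] delta(6)])
next
  case (upper X i j k)
  then show ?case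
    using insert_minus_neq[of i k X x] insert_minus_neq[of k j X x] insert_minus_neq[of j i X x] by simp
next
  case (lower X i j k)
  then show ?case
    using insert_minus_neq[of j k "insert i X" x] insert_minus_neq[of i j "insert k X" x]
      insert_minus_neq[of k i "insert j X" x] by (simp add: insert_commute)
next
  case (rot A B C)
  then show ?case by (auto simp: algebra_simps)
qed

text \<open>Reversing the order of the ground set mirrors the triangles, so \<open>h\<close> is the
  negative of the ranking used for a largest element.\<close>

lemma coboundary_link_collapsed_min:
  fixes A :: "nat set" and x :: nat
  defines "h \<equiv> \<lambda>Q. if x \<in> A then - 2 * int (card Q) - of_bool (x \<notin> Q)
                    else 2 * int (card Q) - of_bool (x \<in> Q)"
  assumes "tri G T" "finite G" "\<forall>y\<in>G. x \<le> y"
    "degenerate (map_tri (\<lambda>A. A - {x}) T)" "A \<in> corners T"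
  shows "coboundary (link A h) T > 0"
  using assms(2,5,6)
proof (induction rule: tri.induct)
  case (nabla X i j)
  then have "finite X" using assms(3) finite_subset by blast
  moreover have "x = i \<or> x = j" using nabla by auto
  then have "x = i" using nabla assms(4) by force
  ultimately have "A = X \<Longrightarrow> h (insert j X) > h (insert i X)" "A = insert j X \<Longrightarrow> h (insert i X) > h (X)"
    "A = insert i X \<Longrightarrow> h (X) > h (insert j X)"
    using nabla(1-4) by (simp_all add: h_def card_insert_if)
  then show ?case
    by (intro coboundary_link_pos[OF tri_nondegenerate[OF tri.nabla[OF nabla(1-4)]] nabla(6)])
next
  case (delta X i j)
  then have "finite X" using assms(3) finite_subset by blast
  moreover have "x = i \<or> x = j" using delta by auto
  then have "x = i" using delta assms(4) by force
  ultimately have "A = insert i X \<Longrightarrow> h (insert j X) > h (insert i (insert j X))" "A = insert j X \<Longrightarrow> h (insert i (insert j X)) > h (insert i X)"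
    "A = insert i (insert j X) \<Longrightarrow> h (insert i X) > h (insert j X)"
    using delta(1-4) by (simp_all add: h_def card_insert_if)
  then show ?case
    by (intro coboundary_link_pos[OF tri_nondegenerate[OF tri.delta[OF delta(1-4)]] delta(6)])
next
  case (upper X i j k)
  then show ?case
    using insert_minus_neq[of i k X x] insert_minus_neq[of k j X x] insert_minus_neq[of j i X x] by simp
next
  case (lower X i j k)
  then show ?case
    using insert_minus_neq[of j k "insert i X" x] insert_minus_neq[of i j "insert k X" x]
      insert_minus_neq[of k i "insert j X" x] by (simp add: insert_commute)
next
  case (rot A B C)
  then show ?case by (auto simp: algebra_simps)
qed

lemma coboundary_link_collapsed:
  assumes "finite G" "(\<forall>y\<in>G. y \<le> x) \<or> (\<forall>y\<in>G. x \<le> y)"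
  obtains h where "\<And>T. tri G T \<Longrightarrow> degenerate (map_tri (\<lambda>A. A - {x}) T) \<Longrightarrow> A \<in> corners T \<Longrightarrow>
    coboundary (link A h) T > 0"
  using assms(2)
proof
  assume "\<forall>y\<in>G. y \<le> x"
  then show thesis using coboundary_link_collapsed_max[OF _ assms(1)] that by blast
next
  assume "\<forall>y\<in>G. x \<le> y"
  then show thesis using coboundary_link_collapsed_min[OF _ assms(1)] that by blast
qed

section \<open>Contraction of whole chains\<close>

definition contract :: "nat \<Rightarrow> (nat set \<times> nat set \<times> nat set) multiset \<Rightarrow>
    (nat set \<times> nat set \<times> nat set) multiset" where
  "contract x c = filter_mset (\<lambda>T. \<not> degenerate T) (image_mset (map_tri (\<lambda>A. A - {x})) c)"

lemma bdry_delete_max: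
  assumes "antisymmetric f"
  shows "bdry a (Suc b) (\<lambda>A B. f (A - {b}) (B - {b})) = bdry a b f"
proof (cases "a \<le> b")
  case True
  have "{Suc k..<Suc b} - {b} = {Suc k..<b}" "{k..<Suc b} - {b} = {k..<b}" for k by auto
  moreover have "{a..<k} - {b} = {a..<k}" "k < b \<Longrightarrow> {a..<Suc k} - {b} = {a..<Suc k}" if "k \<le> b" for k
    using that by auto
  moreover have "{a..<Suc b} - {b} = {a..<b}" by auto
  ultimately show ?thesis using True antisymmetric_diag[OF assms]
    unfolding bdry_def by (simp add: sum.atLeastLessThan_Suc)
qed (simp add: bdry_def)

lemma bdry_delete_min:
  assumes "antisymmetric f"
  shows "bdry a b (\<lambda>A B. f (A - {a}) (B - {a})) = bdry (Suc a) b f"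
proof (cases "a < b")
  case True
  have "{a..<k} - {a} = {Suc a..<k}" for k by auto
  moreover have "{k..<b} - {a} = {k..<b}" if "k > a" for k using that by auto
  ultimately show ?thesis using True antisymmetric_diag[OF assms]
    unfolding bdry_def by (simp add: sum.atLeast_Suc_lessThan[of a b])
qed (simp add: bdry_def)

lemma boundary_sets_delete_max:
  "a \<le> b \<Longrightarrow> (\<lambda>A. A - {b}) ` boundary_sets a (Suc b) = boundary_sets a b"
proof -
  assume "a \<le> b"
  then have e: "{a..Suc b} = insert (Suc b) {a..b}" by auto
  have "{k..<Suc b} - {b} = {k..<b}" for k by auto
  moreover have "{a..<k} - {b} = {a..<k}" if "k \<le> b" for k using that by auto
  moreover have "{a..<Suc b} - {b} = {a..<b}" by auto
  ultimately show ?thesis using \<open>a \<le> b\<close> unfolding boundary_sets_def e image_Un image_image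
    by (auto simp: image_iff) (metis Suc_leI atLeastAtMost_iff less_irrefl order_refl)
qed

lemma boundary_sets_delete_min:
  "a < b \<Longrightarrow> (\<lambda>A. A - {a}) ` boundary_sets a b = boundary_sets (Suc a) b"
proof -
  assume "a < b"
  then have e: "{a..b} = insert a {Suc a..b}" by auto
  have "{a..<k} - {a} = {Suc a..<k}" for k by auto
  moreover have "{k..<b} - {a} = {k..<b}" if "k > a" for k using that by auto
  ultimately show ?thesis using \<open>a < b\<close> unfolding boundary_sets_def e image_Un image_image
    by (auto simp: image_iff) (metis Suc_leI atLeastAtMost_iff less_irrefl order_refl)
qed

lemma sum_mset_coboundary_contract:
  assumes "antisymmetric f"
  shows "(\<Sum>T\<in>#contract x c. coboundary f T) =
         (\<Sum>T\<in>#c. coboundary (\<lambda>A B. f (A - {x}) (B - {x})) T)"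
  unfolding contract_def
  by (induction c) (use coboundary_degenerate[OF assms] in \<open>auto simp: coboundary_comp[of f "\<lambda>A. A - {x}"]\<close>)

lemma antisymmetric_comp: "antisymmetric f \<Longrightarrow> antisymmetric (\<lambda>A B. f (g A) (g B))"
  unfolding antisymmetric_def by blast

lemma corners_map_tri: "corners (map_tri g T) = g ` corners T"
  by (cases T) auto

lemma int_sum_mset_nonneg:
  fixes g :: "'a \<Rightarrow> int"
  shows "(\<And>T. T \<in># c \<Longrightarrow> g T \<ge> 0) \<Longrightarrow> (\<Sum>T\<in>#c. g T) \<ge> 0"
  by (induction c) (auto intro!: add_nonneg_nonneg)

lemma sum_mset_ge_member:
  fixes g :: "'a \<Rightarrow> int"
  assumes "\<And>T. T \<in># c \<Longrightarrow> g T \<ge> 0" "T \<in># c"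
  shows "(\<Sum>T\<in>#c. g T) \<ge> g T"
proof -
  obtain d where "c = add_mset T d" using assms(2) by (metis insert_DiffM)
  then show ?thesis using int_sum_mset_nonneg[of d g] assms(1) by auto
qed

text \<open>The danger is a set \<open>A\<close> all of whose triangles collapse, so that its image
  is no longer a corner. Then \<open>h\<close> falls strictly in every triangle at \<open>A\<close>,
  and the sum of \<open>link A h\<close> over the chain is positive; but it is zero, since
  \<open>A\<close> is not on the boundary.\<close>

lemma chain_sets_contract:
  assumes "chain a b c" and x: "(\<forall>y\<in>{a..<b}. y \<le> x) \<or> (\<forall>y\<in>{a..<b}. x \<le> y)"
    and bd: "(\<lambda>A. A - {x}) ` boundary_sets a b = boundary_sets a' b'"
  shows "chain_sets a' b' (contract x c) = (\<lambda>A. A - {x}) ` chain_sets a b c"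
proof -
  let ?g = "\<lambda>A. A - {x}"
  have "A - {x} \<in> chain_sets a' b' (contract x c)"
    if A: "A \<in> chain_sets a b c" for A
  proof (rule ccontr)
    assume n: "A - {x} \<notin> chain_sets a' b' (contract x c)"
    then have nb: "A \<notin> boundary_sets a b"
      using bd unfolding chain_sets_def by blast
    then obtain T where T: "T \<in># c" "A \<in> corners T"
      using A unfolding chain_sets_def by auto
    have deg: "degenerate (map_tri ?g S)" if "S \<in># c" "A \<in> corners S" for S
    proof (rule ccontr)
      assume "\<not> degenerate (map_tri ?g S)"
      then have "map_tri ?g S \<in># contract x c" using that unfolding contract_def by auto
      moreover have "A - {x} \<in> corners (map_tri ?g S)"
        using that by (simp add: corners_map_tri)
      ultimately show False using n unfolding chain_sets_def by blast
    qed
    obtain h where h: "\<And>T. tri {a..<b} T \<Longrightarrow> degenerate (map_tri ?g T) \<Longrightarrow> A \<in> corners T \<Longrightarrow>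
      coboundary (link A h) T > 0"
      using coboundary_link_collapsed[OF _ x] by (metis finite_atLeastLessThan)
    have tr: "tri {a..<b} S" if "S \<in># c" for S using that assms(1) unfolding chain_def by auto
    have "coboundary (link A h) S \<ge> 0" if "S \<in># c" for S
      using h[OF tr[OF that] deg[OF that]] coboundary_link_away[of A S h] by force
    then have "(\<Sum>T\<in>#c. coboundary (link A h) T) \<ge> coboundary (link A h) T"
      using T(1) by (rule sum_mset_ge_member)
    moreover have "coboundary (link A h) T > 0" using h tr deg T by blast
    moreover have "(\<Sum>T\<in>#c. coboundary (link A h) T) = 0"
      using assms(1) antisymmetric_link[of A h] bdry_link[OF nb] unfolding chain_def by simp
    ultimately show False by simp
  qed
  moreover have "\<exists>B\<in>chain_sets a b c. A = B - {x}" if "A \<in> chain_sets a' b' (contract x c)" for A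
    using that unfolding chain_sets_def contract_def bd[symmetric]
    by (auto simp: corners_map_tri)
  ultimately show ?thesis by blast
qed

lemma chain_contract_max:
  assumes "chain a (Suc b) c"
  shows "chain a b (contract b c)"
  unfolding chain_def
proof (intro conjI allI ballI impI)
  fix T assume "T \<in># contract b c"
  then obtain S where S: "S \<in># c" "T = map_tri (\<lambda>A. A - {b}) S" "\<not> degenerate T"
    unfolding contract_def by auto
  then have "tri ({a..<Suc b} - {b}) T"
    using tri_delete[of "{a..<Suc b}" S b] assms unfolding chain_def by auto
  moreover have "{a..<Suc b} - {b} = {a..<b}" by auto
  ultimately show "tri {a..<b} T" by simp
next
  fix f :: "nat set \<Rightarrow> nat set \<Rightarrow> int" assume f: "antisymmetric f"
  show "(\<Sum>T\<in>#contract b c. coboundary f T) = bdry a b f"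
    using assms antisymmetric_comp[OF f, of "\<lambda>A. A - {b}"] bdry_delete_max[OF f]
    unfolding chain_def sum_mset_coboundary_contract[OF f] by simp
qed

lemma chain_contract_min:
  assumes "chain a b c" "a < b"
  shows "chain (Suc a) b (contract a c)"
  unfolding chain_def
proof (intro conjI allI ballI impI)
  fix T assume "T \<in># contract a c"
  then obtain S where S: "S \<in># c" "T = map_tri (\<lambda>A. A - {a}) S" "\<not> degenerate T"
    unfolding contract_def by auto
  then have "tri ({a..<b} - {a}) T"
    using tri_delete[of "{a..<b}" S a] assms unfolding chain_def by auto
  moreover have "{a..<b} - {a} = {Suc a..<b}" by auto
  ultimately show "tri {Suc a..<b} T" by simp
next
  fix f :: "nat set \<Rightarrow> nat set \<Rightarrow> int" assume f: "antisymmetric f"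
  show "(\<Sum>T\<in>#contract a c. coboundary f T) = bdry (Suc a) b f"
    using assms antisymmetric_comp[OF f, of "\<lambda>A. A - {a}"] bdry_delete_min[OF f]
    unfolding chain_def sum_mset_coboundary_contract[OF f] by simp
qed

subsection \<open>Expansion by a new largest element\<close>

definition lift :: "nat \<Rightarrow> nat \<Rightarrow> nat set \<Rightarrow> nat set" where
  "lift m b X = (if card X \<le> m then insert b X else X)"

text \<open>Upper and lower triangles lie in one level and are lifted as a whole or not at all. Only
  a nabla or delta triangle between the levels \<open>m\<close> and \<open>m + 1\<close> is torn; it
  becomes an upper or lower triangle with \<open>b\<close> as largest index, which inverts the
  corresponding case of \<open>tri_delete\<close>.\<close>

lemma tri_lift:
  assumes "tri G T" "finite G" "\<forall>y\<in>G. y < b"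
  shows "tri (insert b G) (map_tri (lift m b) T)"
  using assms(1)
proof (induction rule: tri.induct)
  case (nabla X i j)
  have fin: "finite X" using nabla assms(2) finite_subset by blast
  have lt: "i < b" "j < b" "b \<notin> X" using nabla assms(3) by blast+
  consider "card X < m" | "card X = m" | "card X > m" by linarith
  then show ?case
  proof cases
    case 1
    then show ?thesis using tri.nabla[of "insert b X" "insert b G" i j] nabla fin lt
      by (auto simp: lift_def insert_commute)
  next
    case 2
    then show ?thesis using tri.rot[OF tri.upper[of X "insert b G" i j b]] nabla fin lt
      by (auto simp: lift_def insert_commute)
  next
    case 3
    then show ?thesis using tri.nabla[of X "insert b G" i j] nabla fin lt
      by (auto simp: lift_def insert_commute)
  qed
next
  case (delta X i j)
  have fin: "finite X" using delta assms(2) finite_subset by blast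
  have lt: "i < b" "j < b" "b \<notin> X" using delta assms(3) by blast+
  consider "Suc (card X) < m" | "Suc (card X) = m" | "Suc (card X) > m" by linarith
  then show ?case
  proof cases
    case 1
    then show ?thesis using tri.delta[of "insert b X" "insert b G" i j] delta fin lt
      by (auto simp: lift_def insert_commute)
  next
    case 2
    then show ?thesis using tri.rot[OF tri.lower[of X "insert b G" i j b]] delta fin lt
      by (auto simp: lift_def insert_commute)
  next
    case 3
    then show ?thesis using tri.delta[of X "insert b G" i j] delta fin lt
      by (auto simp: lift_def insert_commute)
  qed
next
  case (upper X i j k)
  have fin: "finite X" using upper assms(2) finite_subset by blast
  have lt: "i < b" "j < b" "k < b" "b \<notin> X" using upper assms(3) by blast+
  show ?case
  proof (cases "Suc (card X) \<le> m")
    case True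
    then show ?thesis using tri.upper[of "insert b X" "insert b G" i j k] upper fin lt
      by (auto simp: lift_def insert_commute)
  next
    case False
    then show ?thesis using tri.upper[of X "insert b G" i j k] upper fin lt
      by (auto simp: lift_def insert_commute)
  qed
next
  case (lower X i j k)
  have fin: "finite X" using lower assms(2) finite_subset by blast
  have lt: "i < b" "j < b" "k < b" "b \<notin> X" using lower assms(3) by blast+
  show ?case
  proof (cases "Suc (Suc (card X)) \<le> m")
    case True
    then show ?thesis using tri.lower[of "insert b X" "insert b G" i j k] lower fin lt
      by (auto simp: lift_def insert_commute)
  next
    case False
    then show ?thesis using tri.lower[of X "insert b G" i j k] lower fin lt
      by (auto simp: lift_def insert_commute)
  qed
next
  case (rot A B C)
  then show ?case by (auto intro: tri.rot)
qed

definition low_half :: "nat \<Rightarrow> nat \<Rightarrow> nat set \<Rightarrow> nat set \<times> nat set \<times> nat set" where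
  "low_half b k X = (X, insert b X, insert k X)"

definition high_half :: "nat \<Rightarrow> nat \<Rightarrow> nat set \<Rightarrow> nat set \<times> nat set \<times> nat set" where
  "high_half b k X = (insert k X, insert b X, insert k (insert b X))"

text \<open>Lifting the sets of size at most \<open>m\<close> opens a gap along the left boundary up to level \<open>m\<close>,
  and along the right boundary from level \<open>m\<close> on.\<close>

definition left_fill :: "nat \<Rightarrow> nat \<Rightarrow> nat \<Rightarrow> nat \<Rightarrow> (nat set \<times> nat set \<times> nat set) multiset" where
  "left_fill m a b k = (if k - a \<le> m then {#low_half b k {a..<k}#} else {#}) +
     (if k - a < m then {#high_half b k {a..<k}#} else {#})"

definition right_fill :: "nat \<Rightarrow> nat \<Rightarrow> nat \<Rightarrow> (nat set \<times> nat set \<times> nat set) multiset" where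
  "right_fill m b k = (if m \<le> b - Suc k then {#high_half b k {Suc k..<b}#} else {#}) +
     (if m < b - Suc k then {#low_half b k {Suc k..<b}#} else {#})"

definition expand :: "nat \<Rightarrow> nat \<Rightarrow> nat \<Rightarrow> (nat set \<times> nat set \<times> nat set) multiset \<Rightarrow>
    (nat set \<times> nat set \<times> nat set) multiset" where
  "expand m a b c = image_mset (map_tri (lift m b)) c +
     (\<Sum>k\<in>{a..<b}. left_fill m a b k + right_fill m b k)"

lemma set_mset_expand:
  "set_mset (expand m a b c) = map_tri (lift m b) ` set_mset c \<union>
     (\<Union>k\<in>{a..<b}. set_mset (left_fill m a b k + right_fill m b k))"
  unfolding expand_def by (simp add: set_mset_sum)

text \<open>The filling is a strip between the old boundary path and its lifted copy. The values
  \<open>g k\<close> belong to the rungs of the strip and will telescope; a rung above level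
  \<open>m\<close> is a single point and contributes zero.\<close>

lemma left_fill_coboundary:
  fixes m a b :: nat
  assumes "antisymmetric f" "a \<le> k" "k < b"
  defines "g \<equiv> \<lambda>k. f {a..<k} (lift m b {a..<k})"
  shows "(\<Sum>T\<in>#left_fill m a b k. coboundary f T) =
     f (lift m b {a..<k}) (lift m b {a..<Suc k}) - f {a..<k} {a..<Suc k} + g k - g (Suc k)"
proof -
  note [simp] = antisymmetric_diag[OF assms(1)]
  let ?X = "{a..<k}" let ?Y = "{a..<Suc k}"
  have Y: "insert k ?X = ?Y" "insert k (insert b ?X) = insert b ?Y" using assms by auto
  have c: "card ?X = k - a" "card ?Y = Suc (k - a)" using assms by auto
  note e = antisymmetricD[OF assms(1), of ?Y ?X] antisymmetricD[OF assms(1), of "insert b ?Y" ?Y]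
    antisymmetricD[OF assms(1), of "insert b ?X" ?Y]
  consider "k - a < m" | "k - a = m" | "k - a > m" by linarith
  then show ?thesis
    by cases (use e in \<open>simp_all add: left_fill_def low_half_def high_half_def g_def lift_def Y c
      del: card_atLeastLessThan\<close>)
qed

lemma right_fill_coboundary:
  fixes m b :: nat
  assumes "antisymmetric f" "k < b"
  defines "g \<equiv> \<lambda>k. f (lift m b {k..<b}) (insert b {k..<b})"
  shows "(\<Sum>T\<in>#right_fill m b k. coboundary f T) =
     f (insert b {Suc k..<b}) (insert b {k..<b}) - f (lift m b {Suc k..<b}) (lift m b {k..<b})
      + g (Suc k) - g k"
proof -
  note [simp] = antisymmetric_diag[OF assms(1)]
  let ?X = "{Suc k..<b}" let ?Y = "{k..<b}"
  have Y: "insert k ?X = ?Y" "insert k (insert b ?X) = insert b ?Y" using assms by auto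
  have c: "card ?X = b - Suc k" "card ?Y = Suc (b - Suc k)" using assms by auto
  note e = antisymmetricD[OF assms(1), of ?Y ?X] antisymmetricD[OF assms(1), of "insert b ?Y" ?Y]
    antisymmetricD[OF assms(1), of "insert b ?X" ?Y]
  consider "b - Suc k < m" | "b - Suc k = m" | "b - Suc k > m" by linarith
  then show ?thesis
    by cases (use e in \<open>simp_all add: right_fill_def low_half_def high_half_def g_def lift_def Y c
      del: card_atLeastLessThan\<close>)
qed

lemma sum_mset_sum:
  fixes g :: "'a \<Rightarrow> int"
  shows "finite I \<Longrightarrow> (\<Sum>T\<in>#(\<Sum>k\<in>I. M k). g T) = (\<Sum>k\<in>I. \<Sum>T\<in>#M k. g T)"
  by (induction I rule: finite_induct) auto

lemma expand_coboundary:
  assumes c: "chain a b c" and f: "antisymmetric f" and m: "m < b - a"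
  shows "(\<Sum>T\<in>#expand m a b c. coboundary f T) = bdry a (Suc b) f"
proof -
  let ?L = "\<lambda>k. lift m b {a..<k}" let ?R = "\<lambda>k. lift m b {k..<b}"
  let ?g = "\<lambda>k. f {a..<k} (?L k)" and ?h = "\<lambda>k. f (?R k) (insert b {k..<b})"
  have ab: "a \<le> b" using m by simp
  have "(\<Sum>T\<in>#expand m a b c. coboundary f T) =
    (\<Sum>T\<in>#c. coboundary (\<lambda>A B. f (lift m b A) (lift m b B)) T) +
    (\<Sum>k\<in>{a..<b}. (\<Sum>T\<in>#left_fill m a b k. coboundary f T) + (\<Sum>T\<in>#right_fill m b k. coboundary f T))"
    unfolding expand_def
    by (simp add: sum_mset_sum coboundary_comp image_mset.compositionality comp_def)
  also have "(\<Sum>T\<in>#c. coboundary (\<lambda>A B. f (lift m b A) (lift m b B)) T) =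
     (\<Sum>k\<in>{a..<b}. f (?R (Suc k)) (?R k) - f (?L k) (?L (Suc k)))"
    using c antisymmetric_comp[OF f, of "lift m b"] unfolding chain_def bdry_def by simp
  also have "\<dots> + (\<Sum>k\<in>{a..<b}. (\<Sum>T\<in>#left_fill m a b k. coboundary f T) +
       (\<Sum>T\<in>#right_fill m b k. coboundary f T)) =
     (\<Sum>k\<in>{a..<b}. (f (insert b {Suc k..<b}) (insert b {k..<b}) - f {a..<k} {a..<Suc k}) +
        ((?h (Suc k) - ?g (Suc k)) - (?h k - ?g k)))"
    unfolding sum.distrib[symmetric]
    by (intro sum.cong) (auto simp: left_fill_coboundary[OF f] right_fill_coboundary[OF f])
  also have "\<dots> = (\<Sum>k\<in>{a..<b}. f (insert b {Suc k..<b}) (insert b {k..<b}) - f {a..<k} {a..<Suc k}) +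
      ((?h b - ?g b) - (?h a - ?g a))"
    unfolding sum.distrib using sum_Suc_diff'[OF ab, of "\<lambda>k. ?h k - ?g k"] by simp
  \<comment> \<open>Here \<open>m < b - a\<close> enters: the empty set is lifted and the full set
    \<open>{a..<b}\<close> is not. Two of the four end rungs are therefore points, and the other two
    are the steps that add \<open>b\<close> on the two sides of the new boundary.\<close>
  also have "(?h b - ?g b) - (?h a - ?g a) = f {} {b} - f {a..<b} {a..<Suc b}"
    using m antisymmetric_diag[OF f] by (simp add: lift_def atLeastLessThanSuc)
  also have "(\<Sum>k\<in>{a..<b}. f (insert b {Suc k..<b}) (insert b {k..<b}) - f {a..<k} {a..<Suc k}) =
     (\<Sum>k\<in>{a..<b}. f {Suc k..<Suc b} {k..<Suc b} - f {a..<k} {a..<Suc k})"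
    by (intro sum.cong) (auto simp: atLeastLessThanSuc)
  finally show ?thesis
    using ab unfolding bdry_def by (simp add: atLeastLessThanSuc)
qed

lemma chain_expand:
  assumes c: "chain a b c" and m: "m < b - a"
  shows "chain a (Suc b) (expand m a b c)"
  unfolding chain_def
proof (intro conjI allI ballI impI)
  fix T assume "T \<in># expand m a b c"
  then consider S where "S \<in># c" "T = map_tri (lift m b) S"
    | k where "k \<in> {a..<b}" "T \<in># left_fill m a b k + right_fill m b k"
    unfolding set_mset_expand by blast
  then show "tri {a..<Suc b} T"
  proof cases
    case 1
    then show ?thesis using tri_lift[of "{a..<b}" S b m] c m unfolding chain_def
      by (auto simp: atLeastLessThanSuc)
  next
    case (2 k)
    then have "tri {a..<Suc b} (low_half b k X)" "tri {a..<Suc b} (high_half b k X)"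
      if "X = {a..<k} \<or> X = {Suc k..<b}" for X
      unfolding low_half_def high_half_def using that
      by (auto intro!: tri.nabla tri.delta)
    moreover have "T \<in> {low_half b k {a..<k}, high_half b k {a..<k},
        high_half b k {Suc k..<b}, low_half b k {Suc k..<b}}"
      using 2(2) unfolding left_fill_def right_fill_def
      by (simp split: if_split_asm) blast+
    ultimately show ?thesis by blast
  qed
qed (use expand_coboundary[OF c _ m] in auto)

text \<open>Boundary sets need not be corners of \<open>c\<close>. If the lift of such a set leaves
  the new boundary path, it is a corner of one of the filling triangles.\<close>

lemma lift_in_expand:
  assumes A: "A \<in> chain_sets a b c" and m: "m < b - a"
  shows "lift m b A \<in> chain_sets a (Suc b) (expand m a b c)"
proof -
  have sub: "corners T \<subseteq> chain_sets a (Suc b) (expand m a b c)"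
    if "T \<in># image_mset (map_tri (lift m b)) c \<or> (\<exists>k\<in>{a..<b}. T \<in># left_fill m a b k + right_fill m b k)" for T
    using that unfolding chain_sets_def set_mset_expand by auto
  have bd: "X \<in> chain_sets a (Suc b) (expand m a b c)" if "X \<in> boundary_sets a (Suc b)" for X
    using that unfolding chain_sets_def by auto
  consider T where "T \<in># c" "A \<in> corners T" | k where "k \<in> {a..b}" "A = {a..<k}"
    | k where "k \<in> {a..b}" "A = {k..<b}"
    using A unfolding chain_sets_def boundary_sets_def by blast
  then show ?thesis
  proof cases
    case 1
    then have "lift m b A \<in> corners (map_tri (lift m b) T)" by (simp add: corners_map_tri)
    then show ?thesis using sub[of "map_tri (lift m b) T"] 1 by auto
  next
    case (2 k)
    show ?thesis
    proof (cases "k - a \<le> m")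
      case True
      then have "low_half b k {a..<k} \<in># left_fill m a b k" "k \<in> {a..<b}"
        using 2 m by (auto simp: left_fill_def)
      then have "corners (low_half b k {a..<k}) \<subseteq> chain_sets a (Suc b) (expand m a b c)"
        by (intro sub) auto
      then show ?thesis using 2 True by (auto simp: lift_def low_half_def)
    next
      case False
      have "A \<in> boundary_sets a (Suc b)" unfolding boundary_sets_def using 2 by auto
      then show ?thesis using bd 2 False by (auto simp: lift_def)
    qed
  next
    case (3 k)
    show ?thesis
    proof (cases "b - k \<le> m")
      case True
      have "insert b A = {k..<Suc b}" using 3 by auto
      then have "insert b A \<in> boundary_sets a (Suc b)" using 3 unfolding boundary_sets_def by auto
      then show ?thesis using bd 3 True by (auto simp: lift_def)
    next
      case False
      then have "high_half b k {Suc k..<b} \<in># right_fill m b k" "k \<in> {a..<b}"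
        using 3 m by (auto simp: right_fill_def)
      then have "corners (high_half b k {Suc k..<b}) \<subseteq> chain_sets a (Suc b) (expand m a b c)"
        by (intro sub) auto
      moreover have "insert k {Suc k..<b} = A" using 3 False by auto
      ultimately show ?thesis using 3 False by (auto simp: lift_def high_half_def)
    qed
  qed
qed

section \<open>Weak separation of the sets of a chain\<close>

text \<open>The two parts can always be taken to be the elements below all of \<open>D\<close> and
  the elements above all of \<open>D\<close>. This removes the quantifiers over sets from the
  definition of surrounding.\<close>

lemma surround_split_iff:
  fixes D E :: "nat set"
  shows "(\<exists>E' E''. E = E' \<union> E'' \<and> E' \<noteq> {} \<and> E'' \<noteq> {} \<and>
      (\<forall>b\<in>E'. \<forall>a\<in>D. b < a) \<and> (\<forall>a\<in>D. \<forall>b\<in>E''. a < b)) \<longleftrightarrow>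
    (\<exists>x\<in>E. \<forall>a\<in>D. x < a) \<and> (\<exists>x\<in>E. \<forall>a\<in>D. a < x) \<and>
    (\<forall>x\<in>E. (\<forall>a\<in>D. x < a) \<or> (\<forall>a\<in>D. a < x))" (is "?l \<longleftrightarrow> ?r")
proof
  assume ?l
  then obtain E' E'' x y where e: "E = E' \<union> E''" "x \<in> E'" "y \<in> E''"
    "\<forall>b\<in>E'. \<forall>a\<in>D. b < a" "\<forall>a\<in>D. \<forall>b\<in>E''. a < b" by blast
  show ?r
  proof (intro conjI ballI)
    show "\<exists>x\<in>E. \<forall>a\<in>D. x < a" using e(1,2,4) by blast
    show "\<exists>x\<in>E. \<forall>a\<in>D. a < x" using e(1,3,5) by blast
    show "(\<forall>a\<in>D. z < a) \<or> (\<forall>a\<in>D. a < z)" if "z \<in> E" for z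
      using that e(1,4,5) by blast
  qed
next
  assume r: ?r
  let ?E' = "{x\<in>E. \<forall>a\<in>D. x < a}" and ?E'' = "{x\<in>E. \<forall>a\<in>D. a < x}"
  have "E = ?E' \<union> ?E''" using r by blast
  moreover have "?E' \<noteq> {}" "?E'' \<noteq> {}" using r by blast+
  moreover have "\<forall>b\<in>?E'. \<forall>a\<in>D. b < a" "\<forall>a\<in>D. \<forall>b\<in>?E''. a < b" by simp_all
  ultimately show ?l by (intro exI[of _ ?E'] exI[of _ ?E'']) (intro conjI)
qed

lemma surrounded_by_iff:
  "surrounded_by A B \<longleftrightarrow> A - B \<noteq> {} \<and>
    (\<exists>x\<in>B - A. \<forall>a\<in>A - B. x < a) \<and> (\<exists>x\<in>B - A. \<forall>a\<in>A - B. a < x) \<and>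
    (\<forall>x\<in>B - A. (\<forall>a\<in>A - B. x < a) \<or> (\<forall>a\<in>A - B. a < x))"
  unfolding surrounded_by_def surround_split_iff ..

lemma surrounded_by_above: "surrounded_by A B \<Longrightarrow> a \<in> A - B \<Longrightarrow> \<exists>y\<in>B - A. a < y"
  unfolding surrounded_by_iff by blast

lemma surrounded_by_below: "surrounded_by A B \<Longrightarrow> a \<in> A - B \<Longrightarrow> \<exists>x\<in>B - A. x < a"
  unfolding surrounded_by_iff by blast

lemma weakly_separated_iff:
  "weakly_separated A B \<longleftrightarrow> set_lessdot A B \<or> set_lessdot B A \<or>
     (surrounded_by A B \<and> card B \<le> card A) \<or> (surrounded_by B A \<and> card A \<le> card B)"
  unfolding weakly_separated_def strongly_separated_def set_lessdot_def by auto

lemma weakly_separated_sym: "weakly_separated A B \<Longrightarrow> weakly_separated B A"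
  unfolding weakly_separated_iff by blast

lemma weakly_separated_delete_common:
  assumes "finite A" "finite B" "x \<in> A \<longleftrightarrow> x \<in> B"
  shows "weakly_separated (A - {x}) (B - {x}) \<longleftrightarrow> weakly_separated A B"
proof -
  have "A - {x} - (B - {x}) = A - B" "B - {x} - (A - {x}) = B - A" using assms(3) by auto
  moreover have "card (A - {x}) \<le> card (B - {x}) \<longleftrightarrow> card A \<le> card B"
    "card (B - {x}) \<le> card (A - {x}) \<longleftrightarrow> card B \<le> card A"
    using assms card_gt_0_iff[of A] card_gt_0_iff[of B] by (auto simp: card_Diff_singleton_if)
  ultimately show ?thesis
    unfolding weakly_separated_iff set_lessdot_def surrounded_by_iff by simp
qed

text \<open>The shape of a pair that fails to be weakly separated only through its first and
  last elements.\<close>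

definition overfull :: "nat \<Rightarrow> nat \<Rightarrow> nat set \<Rightarrow> nat set \<Rightarrow> bool" where
  "overfull p q A B \<longleftrightarrow> p \<in> A - B \<and> q \<in> A - B \<and> surrounded_by B A \<and> card A = Suc (card B)"

text \<open>If the pair were not weakly separated, the only relation left after deleting
  \<open>p\<close> would make \<open>B\<close> surround \<open>A - {p}\<close>, which needs
  \<open>card B < card A\<close>. Deleting \<open>q\<close> gives \<open>card A < card B\<close> in
  the same way.\<close>

lemma no_alternation:
  assumes sub: "A \<subseteq> {p..q}" "B \<subseteq> {p..q}" and p: "p \<in> A - B" and q: "q \<in> B - A"
    and wp: "weakly_separated (A - {p}) B" and wq: "weakly_separated A (B - {q})"
  shows "weakly_separated A B"
proof (rule ccontr)
  assume n: "\<not> weakly_separated A B"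
  have fin: "finite A" "finite B" using sub finite_subset by blast+
  have pl: "x \<in> B - A \<Longrightarrow> p < x" and ql: "x \<in> A - B \<Longrightarrow> x < q" for x
    using sub p q by (metis DiffD1 DiffD2 atLeastAtMost_iff in_mono le_neq_implies_less)+
  have nl: "\<not> set_lessdot A B" using n unfolding weakly_separated_iff by blast
  have "card B \<le> card (A - {p})"
  proof -
    have "\<not> set_lessdot (A - {p}) B" using nl pl unfolding set_lessdot_def by blast
    moreover have "\<not> set_lessdot B (A - {p})"
    proof
      assume "set_lessdot B (A - {p})"
      then have "A - B = {p}" using q p ql unfolding set_lessdot_def by (auto dest: order.asym)
      then have "set_lessdot A B" using pl unfolding set_lessdot_def by auto
      then show False using nl by blast
    qed
    moreover have "\<not> surrounded_by B (A - {p})"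
    proof
      assume "surrounded_by B (A - {p})"
      from surrounded_by_above[OF this, of q] obtain y where "y \<in> (A - {p}) - (B)" "q < y"
        using q by blast
      then show False using ql[of y] by simp
    qed
    ultimately show ?thesis using wp unfolding weakly_separated_iff by blast
  qed
  moreover have "card A \<le> card (B - {q})"
  proof -
    have "\<not> set_lessdot A (B - {q})" using nl ql unfolding set_lessdot_def by blast
    moreover have "\<not> set_lessdot (B - {q}) A"
    proof
      assume "set_lessdot (B - {q}) A"
      then have "B - A = {q}" using q p pl unfolding set_lessdot_def by (auto dest: order.asym)
      then have "set_lessdot A B" using ql unfolding set_lessdot_def by auto
      then show False using nl by blast
    qed
    moreover have "\<not> surrounded_by A (B - {q})"
    proof
      assume "surrounded_by A (B - {q})"
      from surrounded_by_below[OF this, of p] obtain y where "y \<in> (B - {q}) - (A)" "y < p"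
        using p by blast
      then show False using pl[of y] by simp
    qed
    ultimately show ?thesis using wq unfolding weakly_separated_iff by blast
  qed
  moreover have "card (A - {p}) = card A - 1" "card (B - {q}) = card B - 1" "card A > 0" "card B > 0"
    using p q fin by (auto simp: card_gt_0_iff)
  ultimately show False by linarith
qed

text \<open>Failure of separation gives \<open>card B < card A\<close>, while separation after
  deleting one end gives \<open>card A - 1 \<le> card B\<close>. The only case without such a bound
  is that both deletions leave ordered pairs.\<close>

lemma overfull_if_both_ends:
  assumes sub: "A \<subseteq> {p..q}" "B \<subseteq> {p..q}" and p: "p \<in> A - B" and q: "q \<in> A - B"
    and wp: "weakly_separated (A - {p}) B" and wq: "weakly_separated (A - {q}) B"
    and n: "\<not> weakly_separated A B"
  shows "overfull p q A B"
proof -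
  have fin: "finite A" "finite B" using sub finite_subset by blast+
  have pl: "x \<in> B - A \<Longrightarrow> p < x" and ql: "x \<in> B - A \<Longrightarrow> x < q" for x
    using sub p q by (metis DiffD1 DiffD2 atLeastAtMost_iff in_mono le_neq_implies_less)+
  have nl: "\<not> set_lessdot A B" "\<not> set_lessdot B A"
    and ns: "surrounded_by B A \<Longrightarrow> card B < card A"
    using n unfolding weakly_separated_iff by auto
  then obtain z where z: "z \<in> B - A" unfolding set_lessdot_def by blast
  have pq: "p < q" using pl[OF z] ql[OF z] by simp
  have c: "card (A - {p}) = card A - 1" "card (A - {q}) = card A - 1" "card A > 0"
    using p q fin by (auto simp: card_gt_0_iff)
  have d: "card A + card (B - A) = card B + card (A - B)"
    using fin card_Un_disjoint[of A "B - A"] card_Un_disjoint[of B "A - B"]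
    by (metis Diff_disjoint Un_Diff_cancel Un_commute finite_Diff)
  have surr: "surrounded_by B A \<and> card A \<le> Suc (card B)"
  proof -
    have "\<not> set_lessdot (A - {p}) B" using nl pl unfolding set_lessdot_def by blast
    moreover have "\<not> surrounded_by (A - {p}) B"
    proof
      assume "surrounded_by (A - {p}) B"
      from surrounded_by_above[OF this, of q] obtain y where "y \<in> B - A" "q < y"
        using p q pq by blast
      then show False using ql[of y] by simp
    qed
    ultimately consider (less) "set_lessdot B (A - {p})"
      | (surr) "surrounded_by B (A - {p})" "card (A - {p}) \<le> card B"
      using wp unfolding weakly_separated_iff by blast
    then show ?thesis
    proof cases
      case surr
      then have "surrounded_by B A" using p pl unfolding surrounded_by_iff by auto
      then show ?thesis using surr c by simp
    next
      case less
      then have s: "surrounded_by B A" using z p q pl pq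
        unfolding surrounded_by_iff set_lessdot_def by auto
      have "\<not> set_lessdot B (A - {q})" using z p pl pq unfolding set_lessdot_def by (auto dest: order.asym)
    moreover have "\<not> surrounded_by (A - {q}) B"
    proof
      assume "surrounded_by (A - {q}) B"
      from surrounded_by_below[OF this, of p] obtain y where "y \<in> B - A" "y < p"
        using p q pq by blast
      then show False using pl[of y] by simp
    qed
      ultimately consider "set_lessdot (A - {q}) B" | "card (A - {q}) \<le> card B"
        using wq unfolding weakly_separated_iff by blast
      then show ?thesis
      proof cases
        case 1
        \<comment> \<open>Any further element of \<open>A - B\<close> would have to lie both above
          and below \<open>z\<close>. So \<open>A - B\<close> has at most two elements and
          \<open>B - A\<close> at least one, which bounds \<open>card A\<close> without any
          surrounding relation.\<close>
        have "A - B \<subseteq> {p, q}"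
        proof
          fix x assume x: "x \<in> A - B"
          show "x \<in> {p, q}"
          proof (rule ccontr)
            assume "x \<notin> {p, q}"
            then have "x \<in> A - {q} - B" "z \<in> B - (A - {q})" "z \<in> B - (A - {p})" "x \<in> A - {p} - B"
              using x z by auto
            then have "x < z" "z < x" using less 1 unfolding set_lessdot_def by blast+
            then show False by simp
          qed
        qed
        then have "card (A - B) \<le> 2" using card_mono[of "{p,q}" "A - B"] pq by simp
        moreover have "card (B - A) \<ge> 1" using z fin by (metis Diff_iff One_nat_def Suc_leI card_gt_0_iff empty_iff finite_Diff)
        ultimately show ?thesis using s d by linarith
      qed (use s c in simp)
    qed
  qed
  then show ?thesis using p q ns unfolding overfull_def by auto
qed

lemma not_weakly_separated_overfull:
  assumes sub: "A \<subseteq> {p..q}" "B \<subseteq> {p..q}"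
    and wp: "weakly_separated (A - {p}) (B - {p})" and wq: "weakly_separated (A - {q}) (B - {q})"
    and n: "\<not> weakly_separated A B"
  shows "overfull p q A B \<or> overfull p q B A"
proof -
  have fin: "finite A" "finite B" using sub finite_subset by blast+
  have d: "p \<in> A \<longleftrightarrow> p \<notin> B" "q \<in> A \<longleftrightarrow> q \<notin> B"
    using n wp wq weakly_separated_delete_common[OF fin, of p] weakly_separated_delete_common[OF fin, of q]
    by blast+
  have n': "\<not> weakly_separated B A" using n weakly_separated_sym by blast
  note ws = wp wq wp[THEN weakly_separated_sym] wq[THEN weakly_separated_sym]
  consider "p \<in> A - B" "q \<in> A - B" | "p \<in> B - A" "q \<in> B - A" | "p \<in> A - B" "q \<in> B - A"
    | "p \<in> B - A" "q \<in> A - B" using d by blast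
  then show ?thesis
  proof cases
    case 1
    then show ?thesis using overfull_if_both_ends[OF sub 1] ws n by simp
  next
    case 2
    then show ?thesis using overfull_if_both_ends[OF sub(2,1) 2] ws n' by simp
  next
    case 3
    then show ?thesis using no_alternation[OF sub 3] ws n by simp
  next
    case 4
    then show ?thesis using no_alternation[OF sub(2,1) 4] ws n' by simp
  qed
qed

text \<open>The alternation \<open>z < q < Suc q\<close>, with only \<open>q\<close> from the first
  set, leaves no relation except that \<open>A - {p}\<close> is surrounded. That would need
  \<open>card B + 1 \<le> card A - 1\<close>, but the right side equals
  \<open>card B\<close>.\<close>

lemma overfull_rotated_not_separated:
  assumes sub: "A \<subseteq> {p..q}" "B \<subseteq> {p..q}" and t: "overfull p q A B"
  shows "\<not> weakly_separated (A - {p}) (insert (Suc q) B)"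
proof -
  have fin: "finite A" "finite B" using sub finite_subset by blast+
  have s: "surrounded_by B A" "p \<in> A - B" "q \<in> A - B" and ca: "card A = Suc (card B)"
    using t unfolding overfull_def by auto
  then obtain z where z: "z \<in> B - A" unfolding surrounded_by_iff by blast
  have zq: "z < q" using z s sub by (metis DiffD1 DiffD2 atLeastAtMost_iff in_mono le_neq_implies_less)
  have pq: "p < q" using z zq sub by force
  have Sq: "Suc q \<notin> A" "Suc q \<notin> B" using sub by auto
  have "\<not> set_lessdot (A - {p}) (insert (Suc q) B)"
    using s z zq pq Sq unfolding set_lessdot_def by (auto dest: order.asym)
  moreover have "\<not> set_lessdot (insert (Suc q) B) (A - {p})"
    using s pq Sq unfolding set_lessdot_def by force
  moreover have "\<not> card (insert (Suc q) B) \<le> card (A - {p})"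
    using s(2) fin ca Sq by simp
  moreover have "\<not> surrounded_by (insert (Suc q) B) (A - {p})"
  proof
    assume "surrounded_by (insert (Suc q) B) (A - {p})"
    then obtain y where "y \<in> A" "Suc q < y" using Sq unfolding surrounded_by_iff by auto
    then show False using sub by force
  qed
  ultimately show ?thesis unfolding weakly_separated_iff by blast
qed

lemma overfull_rotations:
  assumes sub: "A \<subseteq> {p..q}" "B \<subseteq> {p..q}" and t1: "overfull p q A B"
    and t2: "overfull (Suc p) (Suc q) (insert (Suc q) B) (A - {p})"
    and t3: "overfull (Suc (Suc p)) (Suc (Suc q)) (insert (Suc (Suc q)) (A - {p})) (insert (Suc q) B - {Suc p})"
  shows "q = p + 2 \<and> A = {p, p + 2} \<and> B = {p + 1}"
proof -
  let ?O = "insert (Suc (Suc q)) (A - {p})" and ?I = "insert (Suc q) B - {Suc p}"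
  have fin: "finite A" "finite B" using sub finite_subset by blast+
  have out: "x \<notin> A" "x \<notin> B" if "x > q" for x using sub that by force+
  have s: "surrounded_by B A" "p \<in> A - B" "q \<in> A - B" and ca: "card A = Suc (card B)"
    using t1 unfolding overfull_def by auto
  obtain z where z: "z \<in> B - A" using s(1) unfolding surrounded_by_iff by blast
  have zq: "z < q" "p < z" using z s sub by (metis DiffD1 DiffD2 atLeastAtMost_iff in_mono le_neq_implies_less)+
  have Sp: "Suc p \<in> B - A" using t2 zq unfolding overfull_def by auto
  \<comment> \<open>After two rotations \<open>q\<close> lies in the outer set and
    \<open>Suc q\<close> in the inner one. A second element of \<open>B - A\<close> would also
    survive in the inner set, and then \<open>q\<close> would separate two inner elements.\<close>
  have "x = Suc p" if x: "x \<in> B - A" for x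
  proof (rule ccontr)
    assume "x \<noteq> Suc p"
    have "x \<le> q" using x sub by auto
    then have "x \<in> ?I - ?O" "Suc q \<in> ?I - ?O" "q \<in> ?O - ?I"
      using x \<open>x \<noteq> Suc p\<close> s zq out by auto
    moreover have "surrounded_by ?I ?O" using t3 unfolding overfull_def by auto
    ultimately have "q < x \<or> Suc q < q" unfolding surrounded_by_iff by (metis order.asym)
    then show False using \<open>x \<le> q\<close> by simp
  qed
  then have BA: "B - A = {Suc p}" using Sp by blast
  have d: "card A + card (B - A) = card B + card (A - B)"
    using fin card_Un_disjoint[of A "B - A"] card_Un_disjoint[of B "A - B"]
    by (metis Diff_disjoint Un_Diff_cancel Un_commute finite_Diff)
  then have "card (A - B) = 2" using BA ca by simp
  moreover have "card {p, q} = 2" using zq by simp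
  ultimately have AB: "A - B = {p, q}" using s fin
    by (metis card_subset_eq empty_subsetI finite_Diff insert_subset)
  have "Suc (Suc p) \<in> ?O - ?I" using t3 unfolding overfull_def by auto
  then have "Suc (Suc p) \<in> A - B" using zq by auto
  then have q: "q = p + 2" using AB by auto
  have "A \<inter> B = {}"
  proof -
    have "x \<in> {p, Suc p, q}" if "x \<in> A" for x
    proof -
      have "p \<le> x" "x \<le> p + 2" using that sub q by auto
      then show ?thesis using q by auto
    qed
    then show ?thesis using AB BA by blast
  qed
  then show ?thesis using AB BA q by auto
qed

section \<open>The ground set with three elements\<close>

lemma coboundary_link_if:
  assumes "\<not> degenerate (A, B, C)"
  shows "coboundary (link V h) (A, B, C) = (if V = A then h B - h C else
      if V = B then h C - h A else if V = C then h A - h B else 0)"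
  using assms by (auto simp: link_def)

text \<open>Equality with \<open>{t}\<close> or \<open>{s, u}\<close> is replaced by membership of
  \<open>s\<close>, \<open>t\<close>, \<open>u\<close>, so that every concrete triangle in the next
  lemma becomes a simplifier computation.\<close>

lemma tri_three_eval:
  fixes s t u :: nat and h h' :: "nat set \<Rightarrow> int" and A B C :: "nat set"
  defines "e \<equiv> (\<lambda>P Q. if card P = 1 \<and> card Q = 2 then of_bool (u \<in> Q \<and> s \<notin> P)
                  else if card P = 2 \<and> card Q = 1 then - of_bool (u \<in> P \<and> s \<notin> Q) else (0::int))"
  assumes "distinct [s, t, u]" "A \<subseteq> {s,t,u}" "B \<subseteq> {s,t,u}" "C \<subseteq> {s,t,u}" "\<not> degenerate (A, B, C)"
    and "let T = \<lambda>Q. t \<in> Q \<and> s \<notin> Q \<and> u \<notin> Q; S = \<lambda>Q. t \<notin> Q \<and> s \<in> Q \<and> u \<in> Q;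
      E = e A B + e B C + e C A in
      (T A \<longrightarrow> h B > h C \<or> (E = 1 \<and> \<not> S B \<and> \<not> S C)) \<and>
      (T B \<longrightarrow> h C > h A \<or> (E = 1 \<and> \<not> S C \<and> \<not> S A)) \<and>
      (T C \<longrightarrow> h A > h B \<or> (E = 1 \<and> \<not> S A \<and> \<not> S B)) \<and>
      (S A \<longrightarrow> h' B > h' C \<or> (E = 1 \<and> \<not> T B \<and> \<not> T C)) \<and>
      (S B \<longrightarrow> h' C > h' A \<or> (E = 1 \<and> \<not> T C \<and> \<not> T A)) \<and>
      (S C \<longrightarrow> h' A > h' B \<or> (E = 1 \<and> \<not> T A \<and> \<not> T B)) \<and> E \<ge> 0"
  shows "({t} \<in> corners (A, B, C) \<longrightarrow> coboundary (link {t} h) (A, B, C) > 0 \<or>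
       (coboundary e (A, B, C) = 1 \<and> {s, u} \<notin> corners (A, B, C))) \<and>
     ({s, u} \<in> corners (A, B, C) \<longrightarrow> coboundary (link {s, u} h') (A, B, C) > 0 \<or>
       (coboundary e (A, B, C) = 1 \<and> {t} \<notin> corners (A, B, C))) \<and>
     coboundary e (A, B, C) \<ge> 0"
proof -
  have T: "{t} = Q \<longleftrightarrow> t \<in> Q \<and> s \<notin> Q \<and> u \<notin> Q" if "Q \<subseteq> {s,t,u}" for Q
    using that assms(2) by auto
  have S: "{s, u} = Q \<longleftrightarrow> t \<notin> Q \<and> s \<in> Q \<and> u \<in> Q" if "Q \<subseteq> {s,t,u}" for Q
    using that assms(2) by auto
  note TS = T[OF assms(3)] T[OF assms(4)] T[OF assms(5)] S[OF assms(3)] S[OF assms(4)] S[OF assms(5)]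
  note L = coboundary_link_if[OF assms(6)]
  note c = assms(7)[unfolded Let_def, folded TS]
  have ne: "A \<noteq> B" "B \<noteq> C" "C \<noteq> A" using assms(6) by auto
  have ts: "{t} \<noteq> {s, u}" using assms(2) by auto
  have E: "coboundary e (A, B, C) = e A B + e B C + e C A" by simp
  have "coboundary (link {t} h) (A, B, C) > 0 \<or> (coboundary e (A, B, C) = 1 \<and> {s, u} \<notin> {A, B, C})"
    if "{t} \<in> {A, B, C}"
  proof -
    consider "{t} = A" | "{t} = B" | "{t} = C" using \<open>{t} \<in> {A, B, C}\<close> by blast
    then show ?thesis unfolding L E insert_iff empty_iff by cases (use c ne ts in \<open>simp; blast\<close>)+
  qed
  moreover have "coboundary (link {s, u} h') (A, B, C) > 0 \<or> (coboundary e (A, B, C) = 1 \<and> {t} \<notin> {A, B, C})"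
    if "{s, u} \<in> {A, B, C}"
  proof -
    consider "{s, u} = A" | "{s, u} = B" | "{s, u} = C" using \<open>{s, u} \<in> {A, B, C}\<close> by blast
    then show ?thesis unfolding L E insert_iff empty_iff by cases (use c ne ts in \<open>simp; blast\<close>)+
  qed
  moreover have "coboundary e (A, B, C) \<ge> 0" unfolding E
    using c[THEN conjunct2, THEN conjunct2, THEN conjunct2, THEN conjunct2, THEN conjunct2, THEN conjunct2] .
  ultimately show ?thesis unfolding corners.simps by (intro conjI impI)
qed

text \<open>Summed over a chain, \<open>f\<close> and \<open>g\<close> give \<open>0\<close> and \<open>e\<close> gives \<open>1\<close>. Hence if both \<open>{t}\<close> and \<open>{s, u}\<close>
  occur, so do the two exceptional triangles, which contribute \<open>2\<close> to the sum of \<open>e\<close>.\<close>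

lemma tri_three:
  assumes "tri G T" "G = {s, t, u}" "s < t" "t < u"
  defines "f \<equiv> link {t} (\<lambda>Q. (of_bool (s \<in> Q) - of_bool (u \<in> Q)) * (1 + of_bool (t \<in> Q)))"
    and "g \<equiv> link {s, u} (\<lambda>Q. (of_bool (u \<in> Q) - of_bool (s \<in> Q)) * (2 - of_bool (t \<in> Q)))"
    and "e \<equiv> (\<lambda>P Q. if card P = 1 \<and> card Q = 2 then of_bool (u \<in> Q \<and> s \<notin> P)
                  else if card P = 2 \<and> card Q = 1 then - of_bool (u \<in> P \<and> s \<notin> Q) else (0::int))"
  shows "({t} \<in> corners T \<longrightarrow> coboundary f T > 0 \<or> (coboundary e T = 1 \<and> {s, u} \<notin> corners T)) \<and>
     ({s, u} \<in> corners T \<longrightarrow> coboundary g T > 0 \<or> (coboundary e T = 1 \<and> {t} \<notin> corners T)) \<and>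
     coboundary e T \<ge> 0"
  using assms(1)
proof (induction rule: tri.induct)
  case (nabla X i j)
  note nd = tri_nondegenerate[OF tri.nabla[OF nabla(1-4)]]
  have ij: "i = s \<and> j = t \<or> i = s \<and> j = u \<or> i = t \<and> j = u" using nabla(2-4) assms(2-4) by auto
  have X: "X \<subseteq> {s, t, u}" "i \<notin> X" "j \<notin> X" using nabla(1-3) assms(2) by auto
  have "i = s \<and> j = t \<and> (X = {} \<or> X = {u}) \<or> i = s \<and> j = u \<and> (X = {} \<or> X = {t}) \<or>
     i = t \<and> j = u \<and> (X = {} \<or> X = {s})" using ij X by blast
  then show ?case unfolding f_def g_def e_def
    using nabla nd assms(2-4) by (intro tri_three_eval) (elim conjE disjE; simp)+
next
  case (delta X i j)
  note nd = tri_nondegenerate[OF tri.delta[OF delta(1-4)]]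
  have ij: "i = s \<and> j = t \<or> i = s \<and> j = u \<or> i = t \<and> j = u" using delta(2-4) assms(2-4) by auto
  have X: "X \<subseteq> {s, t, u}" "i \<notin> X" "j \<notin> X" using delta(1-3) assms(2) by auto
  have "i = s \<and> j = t \<and> (X = {} \<or> X = {u}) \<or> i = s \<and> j = u \<and> (X = {} \<or> X = {t}) \<or>
     i = t \<and> j = u \<and> (X = {} \<or> X = {s})" using ij X by blast
  then show ?case unfolding f_def g_def e_def
    using delta nd assms(2-4) by (intro tri_three_eval) (elim conjE disjE; simp)+
next
  case (upper X i j k)
  note nd = tri_nondegenerate[OF tri.upper[OF upper(1-6)]]
  have "i = s" "j = t" "k = u" "X = {}" using upper assms(2-4) by auto
  then show ?case unfolding f_def g_def e_def
    using nd assms(3,4) by (intro tri_three_eval) simp_all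
next
  case (lower X i j k)
  note nd = tri_nondegenerate[OF tri.lower[OF lower(1-6)]]
  have "i = s" "j = t" "k = u" "X = {}" using lower assms(2-4) by auto
  then show ?case unfolding f_def g_def e_def
    using nd assms(3,4) by (intro tri_three_eval) simp_all
next
  case (rot A B C)
  have "coboundary F (B, C, A) = coboundary F (A, B, C)" for F :: "nat set \<Rightarrow> nat set \<Rightarrow> int" by simp
  moreover have "corners (B, C, A) = corners (A, B, C)" by auto
  ultimately show ?case using rot.IH by metis
qed

lemma sum_mset_ge_two:
  fixes g :: "'a \<Rightarrow> int"
  assumes "\<And>T. T \<in># c \<Longrightarrow> g T \<ge> 0" "S \<in># c" "T \<in># c" "S \<noteq> T"
  shows "(\<Sum>T\<in>#c. g T) \<ge> g S + g T"
proof -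
  obtain d where d: "c = add_mset S d" using assms(2) by (metis insert_DiffM)
  then have "T \<in># d" using assms(3,4) by auto
  then show ?thesis using sum_mset_ge_member[of d g T] assms(1) d by auto
qed

lemma sum_coboundary_link:
  assumes "chain a b c" "A \<notin> boundary_sets a b"
  shows "(\<Sum>T\<in>#c. coboundary (link A h) T) = 0"
proof -
  have "(\<Sum>T\<in>#c. coboundary (link A h) T) = bdry a b (link A h)"
    using assms(1)[unfolded chain_def, THEN conjunct2] antisymmetric_link[of A h] by simp
  then show ?thesis using bdry_link[OF assms(2)] by simp
qed

text \<open>The rankings in \<open>f\<close> and \<open>g\<close> fall in all triangles at
  \<open>{t}\<close> and at \<open>{s, u}\<close> but one each: the nabla triangle
  \<open>({t}, {t, u}, {s, t})\<close> and the delta triangle \<open>({s}, {u}, {s, u})\<close>,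
  where \<open>s\<close>, \<open>t\<close>, \<open>u\<close> are \<open>a\<close>,
  \<open>a + 1\<close>, \<open>a + 2\<close>. A closed link has to use the exception.\<close>

lemma no_crossing_in_three:
  assumes c: "chain a (a + 3) c"
    and t: "{a + 1} \<in> chain_sets a (a + 3) c" and su: "{a, a + 2} \<in> chain_sets a (a + 3) c"
  shows False
proof -
  define f where "f = link {a+1} (\<lambda>Q. (of_bool (a \<in> Q) - of_bool (a+2 \<in> Q)) * (1 + of_bool (a+1 \<in> Q)))"
  define g where "g = link {a, a+2} (\<lambda>Q. (of_bool (a+2 \<in> Q) - of_bool (a \<in> Q)) * (2 - of_bool (a+1 \<in> Q)))"
  define e where "e = (\<lambda>P Q. if card P = 1 \<and> card Q = 2 then of_bool (a+2 \<in> Q \<and> a \<notin> P)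
                  else if card P = 2 \<and> card Q = 1 then - of_bool (a+2 \<in> P \<and> a \<notin> Q) else (0::int))"
  have G: "{a..<a+3} = {a, a+1, a+2}" by auto
  have main: "({a+1} \<in> corners T \<longrightarrow> coboundary f T > 0 \<or> (coboundary e T = 1 \<and> {a, a+2} \<notin> corners T)) \<and>
     ({a, a+2} \<in> corners T \<longrightarrow> coboundary g T > 0 \<or> (coboundary e T = 1 \<and> {a+1} \<notin> corners T)) \<and>
     coboundary e T \<ge> 0" if "T \<in># c" for T
    using tri_three[of "{a..<a+3}" T a "a+1" "a+2"] c that G unfolding f_def g_def e_def chain_def by auto
  have "antisymmetric e" unfolding antisymmetric_def e_def by auto
  then have "(\<Sum>T\<in>#c. coboundary e T) = bdry a (a+3) e"
    using c[unfolded chain_def, THEN conjunct2] by simp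
  also have "\<dots> = 1"
    unfolding bdry_def G by (simp add: e_def)
  finally have e1: "(\<Sum>T\<in>#c. coboundary e T) = 1" .
  have atl: "{a..a+3} = {a, a+1, a+2, a+3}" by auto
  have nb: "{a+1} \<notin> boundary_sets a (a+3)"
  proof
    assume "{a+1} \<in> boundary_sets a (a+3)"
    then have "\<exists>k\<in>{a..a+3}. {a+1} = {a..<k} \<or> {a+1} = {k..<a+3}" unfolding boundary_sets_def by auto
    then obtain k where k: "k \<in> {a..a+3}" "{a+1} = {a..<k} \<or> {a+1} = {k..<a+3}" by blast
    have "a + 1 \<in> {a..<k} \<Longrightarrow> a \<in> {a..<k}" "a + 1 \<in> {k..<a+3} \<Longrightarrow> a + 2 \<in> {k..<a+3}" by auto
    then show False using k by (metis add_left_cancel insertI1 n_not_Suc_n one_add_one plus_1_eq_Suc singletonD add.right_neutral zero_neq_one)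
  qed
  have nb': "{a, a+2} \<notin> boundary_sets a (a+3)"
  proof
    assume "{a, a+2} \<in> boundary_sets a (a+3)"
    then obtain k where k: "{a, a+2} = {a..<k} \<or> {a, a+2} = {k..<a+3}" unfolding boundary_sets_def by auto
    have "a + 2 \<in> {a..<k} \<Longrightarrow> a + 1 \<in> {a..<k}" "a \<in> {k..<a+3} \<Longrightarrow> a + 1 \<in> {k..<a+3}" by auto
    then have "a + 1 \<in> {a, a + 2}" using k by (metis insertI1 insertI2)
    then show False by simp
  qed
  have 1: "\<exists>T\<in>#c. {a+1} \<in> corners T \<and> \<not> coboundary f T > 0"
  proof (rule ccontr)
    assume n: "\<not> ?thesis"
    obtain T where T: "T \<in># c" "{a+1} \<in> corners T" using t nb unfolding chain_sets_def by auto
    have "coboundary f S \<ge> 0" if "S \<in># c" for S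
    proof (cases "{a+1} \<in> corners S")
      case True
      then have "coboundary f S > 0" using n that by blast
      then show ?thesis by simp
    qed (simp add: f_def coboundary_link_away)
    then have "(\<Sum>T\<in>#c. coboundary f T) \<ge> coboundary f T" using T by (intro sum_mset_ge_member)
    moreover have "coboundary f T > 0" using n T by blast
    moreover have "(\<Sum>T\<in>#c. coboundary f T) = 0"
      unfolding f_def by (rule sum_coboundary_link[OF c nb])
    ultimately show False by simp
  qed
  have 2: "\<exists>T\<in>#c. {a, a+2} \<in> corners T \<and> \<not> coboundary g T > 0"
  proof (rule ccontr)
    assume n: "\<not> ?thesis"
    obtain T where T: "T \<in># c" "{a, a+2} \<in> corners T" using su nb' unfolding chain_sets_def by auto
    have "coboundary g S \<ge> 0" if "S \<in># c" for S
    proof (cases "{a, a+2} \<in> corners S")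
      case True
      then have "coboundary g S > 0" using n that by blast
      then show ?thesis by simp
    qed (simp add: g_def coboundary_link_away)
    then have "(\<Sum>T\<in>#c. coboundary g T) \<ge> coboundary g T" using T by (intro sum_mset_ge_member)
    moreover have "coboundary g T > 0" using n T by blast
    moreover have "(\<Sum>T\<in>#c. coboundary g T) = 0"
      unfolding g_def by (rule sum_coboundary_link[OF c nb'])
    ultimately show False by simp
  qed
  obtain S where S: "S \<in># c" "{a+1} \<in> corners S" "\<not> coboundary f S > 0" using 1 by blast
  obtain T where T: "T \<in># c" "{a, a+2} \<in> corners T" "\<not> coboundary g T > 0" using 2 by blast
  have "coboundary e S = 1" "{a, a+2} \<notin> corners S" "coboundary e T = 1"
    using main[OF S(1)] main[OF T(1)] S T by blast+
  moreover from this have "S \<noteq> T" using T by blast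
  ultimately have "(\<Sum>T\<in>#c. coboundary e T) \<ge> 1 + 1" using sum_mset_ge_two[of c "coboundary e" S T] main S(1) T(1) by simp
  then show False using e1 by simp
qed

text \<open>Expanding at level \<open>card B\<close> and contracting the smallest element turns an overfull pair
  \<open>(A, B)\<close> into the overfull pair \<open>(B \<union> {b}, A - {a})\<close> of a rotated chain.\<close>

lemma chain_sets_weakly_separated:
  "chain a (a + N) c \<Longrightarrow> A \<in> chain_sets a (a + N) c \<Longrightarrow> B \<in> chain_sets a (a + N) c \<Longrightarrow>
    weakly_separated A B"
proof (induction N arbitrary: a c A B)
  case 0
  then have "A = {}" "B = {}" using chain_sets_subset[of a a c] by auto
  then show ?case unfolding weakly_separated_def strongly_separated_def by simp
next
  case (Suc N)
  have sub: "A \<subseteq> {a..a + N}" if "chain a (a + Suc N) c" "A \<in> chain_sets a (a + Suc N) c" for a c A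
    using chain_sets_subset[OF that] by auto
  \<comment> \<open>This and the next claim are stated for arbitrary chains over
    \<open>Suc N\<close> elements because they are applied to rotated chains, which have the same
    size. The induction hypothesis is used only for contractions to \<open>N\<close>
    elements.\<close>
  have over: "overfull a (a + N) A B \<or> overfull a (a + N) B A"
    if c: "chain a (a + Suc N) c" and A: "A \<in> chain_sets a (a + Suc N) c"
      and B: "B \<in> chain_sets a (a + Suc N) c" and n: "\<not> weakly_separated A B" for a c A B
  proof (rule not_weakly_separated_overfull[OF sub[OF c A] sub[OF c B] _ _ n])
    have "chain (Suc a) (Suc a + N) (contract a c)"
      using chain_contract_min[OF c] by simp
    moreover have "chain_sets (Suc a) (Suc a + N) (contract a c) = (\<lambda>A. A - {a}) ` chain_sets a (a + Suc N) c"
      using boundary_sets_delete_min[of a "a + Suc N"] by (intro chain_sets_contract[OF c]) auto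
    ultimately show "weakly_separated (A - {a}) (B - {a})"
      using A B by (intro Suc.IH[of "Suc a" "contract a c"]) auto
    have "chain a (a + N) (contract (a + N) c)"
      using chain_contract_max[of a "a + N" c] c by simp
    moreover have "chain_sets a (a + N) (contract (a + N) c) = (\<lambda>A. A - {a + N}) ` chain_sets a (a + Suc N) c"
      using boundary_sets_delete_max[of a "a + N"] by (intro chain_sets_contract[OF c]) auto
    ultimately show "weakly_separated (A - {a + N}) (B - {a + N})"
      using A B by (intro Suc.IH[of a "contract (a + N) c"]) auto
  qed
  have rotate: "\<exists>c'. chain (Suc a) (Suc a + Suc N) c' \<and>
      A - {a} \<in> chain_sets (Suc a) (Suc a + Suc N) c' \<and>
      insert (Suc (a + N)) B \<in> chain_sets (Suc a) (Suc a + Suc N) c' \<and>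
      overfull (Suc a) (Suc (a + N)) (insert (Suc (a + N)) B) (A - {a})"
    if c: "chain a (a + Suc N) c" and A: "A \<in> chain_sets a (a + Suc N) c"
      and B: "B \<in> chain_sets a (a + Suc N) c" and t: "overfull a (a + N) A B" for a c A B
  proof -
    let ?b = "a + Suc N"
    have ca: "card A = Suc (card B)" using t unfolding overfull_def by simp
    have "card A \<le> Suc N" using card_mono[OF _ sub[OF c A]] by simp
    then have m: "card B < ?b - a" using ca by simp
    \<comment> \<open>At this level exactly \<open>B\<close> receives the new largest element,
      because \<open>A\<close> is larger by one.\<close>
    let ?d = "expand (card B) a ?b c"
    have d: "chain a (Suc ?b) ?d" by (rule chain_expand[OF c m])
    have "lift (card B) ?b A \<in> chain_sets a (Suc ?b) ?d" "lift (card B) ?b B \<in> chain_sets a (Suc ?b) ?d"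
      using lift_in_expand[OF A m] lift_in_expand[OF B m] by auto
    then have AB: "A \<in> chain_sets a (Suc ?b) ?d" "insert ?b B \<in> chain_sets a (Suc ?b) ?d"
      using ca by (auto simp: lift_def)
    let ?e = "contract a ?d"
    have e: "chain (Suc a) (Suc a + Suc N) ?e" using chain_contract_min[OF d] by simp
    have "chain_sets (Suc a) (Suc a + Suc N) ?e = (\<lambda>A. A - {a}) ` chain_sets a (Suc ?b) ?d"
      using boundary_sets_delete_min[of a "Suc ?b"] by (intro chain_sets_contract[OF d]) auto
    moreover have "insert ?b B - {a} = insert ?b B" using t unfolding overfull_def by auto
    ultimately have AB': "A - {a} \<in> chain_sets (Suc a) (Suc a + Suc N) ?e"
      "insert (Suc (a + N)) B \<in> chain_sets (Suc a) (Suc a + Suc N) ?e"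
      using AB by (metis (no_types, lifting) image_eqI add_Suc_right)+
    have "\<not> weakly_separated (A - {a}) (insert (Suc (a + N)) B)"
      by (rule overfull_rotated_not_separated[OF sub[OF c A] sub[OF c B] t])
    then have "overfull (Suc a) (Suc a + N) (A - {a}) (insert (Suc (a + N)) B) \<or>
       overfull (Suc a) (Suc a + N) (insert (Suc (a + N)) B) (A - {a})"
      by (rule over[OF e AB'])
    moreover have "Suc (a + N) \<notin> A" using sub[OF c A] by auto
    ultimately have "overfull (Suc a) (Suc (a + N)) (insert (Suc (a + N)) B) (A - {a})"
      unfolding overfull_def by auto
    then show ?thesis using e AB' by blast
  qed
  have no: "\<not> overfull a (a + N) A B"
    if c: "chain a (a + Suc N) c" and A: "A \<in> chain_sets a (a + Suc N) c"
      and B: "B \<in> chain_sets a (a + Suc N) c" for a c A B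
  proof
    assume t1: "overfull a (a + N) A B"
    obtain c' where c': "chain (Suc a) (Suc a + Suc N) c'"
      "A - {a} \<in> chain_sets (Suc a) (Suc a + Suc N) c'"
      "insert (Suc (a + N)) B \<in> chain_sets (Suc a) (Suc a + Suc N) c'"
      and t2: "overfull (Suc a) (Suc (a + N)) (insert (Suc (a + N)) B) (A - {a})"
      using rotate[OF c A B t1] by blast
    have t3: "overfull (Suc (Suc a)) (Suc (Suc (a + N))) (insert (Suc (Suc (a + N))) (A - {a}))
        (insert (Suc (a + N)) B - {Suc a})"
      using rotate[OF c'(1,3,2)] t2 by auto
    have "a + N = a + 2 \<and> A = {a, a + 2} \<and> B = {a + 1}"
      by (rule overfull_rotations[OF sub[OF c A] sub[OF c B] t1 t2 t3])
    then have "N = 2" "A = {a, a + 2}" "B = {a + 1}" by auto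
    then show False using no_crossing_in_three[of a c] c A B by (simp add: numeral_3_eq_3)
  qed
  show ?case
    using over[OF Suc.prems] no[OF Suc.prems] no[OF Suc.prems(1,3,2)] by blast
qed

section \<open>Counting\<close>

text \<open>A fibre of the deletion has at most two members, and the double fibres are the pairs
  \<open>X\<close>, \<open>insert b X\<close>.\<close>

lemma card_delete_image:
  assumes "finite V"
  shows "card V = card ((\<lambda>A. A - {b}) ` V) + card {X \<in> V. b \<notin> X \<and> insert b X \<in> V}"
proof -
  let ?V0 = "{A \<in> V. b \<notin> A}" and ?V1 = "(\<lambda>A. A - {b}) ` {A \<in> V. b \<in> A}"
  have "inj_on (\<lambda>A. A - {b}) {A \<in> V. b \<in> A}" by (auto simp: inj_on_def)
  then have c1: "card ?V1 = card {A \<in> V. b \<in> A}" by (rule card_image)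
  have "V = ?V0 \<union> {A \<in> V. b \<in> A}" by auto
  then have "card V = card ?V0 + card {A \<in> V. b \<in> A}"
    using assms card_Un_disjoint[of ?V0 "{A \<in> V. b \<in> A}"] by auto
  moreover have "card ?V0 + card ?V1 = card (?V0 \<union> ?V1) + card (?V0 \<inter> ?V1)"
    using assms by (intro card_Un_Int) auto
  moreover have "?V0 \<union> ?V1 = (\<lambda>A. A - {b}) ` V" (is "?L = ?R")
  proof (intro equalityI subsetI)
    fix X assume "X \<in> ?L"
    moreover have "X \<in> ?R" if "X \<in> V" "b \<notin> X"
      using that by (intro image_eqI[of _ _ X]) auto
    ultimately show "X \<in> ?R" by blast
  next
    fix X assume "X \<in> ?R"
    then obtain A where "A \<in> V" "X = A - {b}" by blast
    then show "X \<in> ?L" by (cases "b \<in> A") auto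
  qed
  moreover have "?V0 \<inter> ?V1 = {X \<in> V. b \<notin> X \<and> insert b X \<in> V}"
  proof (intro equalityI subsetI)
    fix X assume "X \<in> {X \<in> V. b \<notin> X \<and> insert b X \<in> V}"
    moreover from this have "X = insert b X - {b}" by auto
    ultimately show "X \<in> ?V0 \<inter> ?V1" by blast
  qed (auto simp: insert_absorb)
  ultimately show ?thesis using c1 by simp
qed

text \<open>The function \<open>e\<close> looks only at the upper end of a step between the two
  levels. In a delta triangle the two steps share their upper end and cancel. In a nabla triangle
  they do not, and the values differ exactly if one of the two added elements is
  \<open>b\<close>.\<close>

lemma tri_level_jump:
  fixes b m :: nat
  defines "e \<equiv> (\<lambda>P Q. if card P = m \<and> card Q = Suc m then of_bool (b \<in> Q)
                  else if card P = Suc m \<and> card Q = m then - of_bool (b \<in> P) else (0::int))"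
  assumes "tri G T" "finite G" "coboundary e T \<noteq> 0"
  shows "\<exists>X. card X = m \<and> b \<notin> X \<and> X \<in> corners T \<and> insert b X \<in> corners T"
  using assms(2,4)
proof (induction rule: tri.induct)
  case (nabla X i j)
  then have fin: "finite X" using assms(3) finite_subset by blast
  have "card X = m" "(b \<in> insert j X) \<noteq> (b \<in> insert i X)"
    using nabla fin by (auto simp: e_def split: if_splits)
  then show ?case by (intro exI[of _ X]) auto
next
  case (delta X i j)
  then have fin: "finite X" using assms(3) finite_subset by blast
  show ?case using delta fin by (auto simp: e_def card_insert_if split: if_splits)
next
  case (upper X i j k)
  then have fin: "finite X" using assms(3) finite_subset by blast
  show ?case using upper fin by (auto simp: e_def card_insert_if split: if_splits)
next
  case (lower X i j k)
  then have fin: "finite X" using assms(3) finite_subset by blast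
  show ?case using lower fin by (auto simp: e_def card_insert_if split: if_splits)
next
  case (rot A B C)
  have "coboundary e (B, C, A) = coboundary e (A, B, C)" by simp
  moreover have "corners (B, C, A) = corners (A, B, C)" by auto
  ultimately show ?case using rot by simp
qed

text \<open>Below the top, the right boundary path contains the largest element after the step from
  level \<open>m\<close>, and the left path does not. Some triangle must account for this
  difference. For \<open>m = N\<close> the difference vanishes, but the left boundary itself
  supplies the pair.\<close>

lemma chain_level_pair:
  assumes c: "chain a (Suc (a + N)) c" and m: "m \<le> N"
  shows "\<exists>X \<in> chain_sets a (Suc (a + N)) c. a + N \<notin> X \<and> insert (a + N) X \<in> chain_sets a (Suc (a + N)) c
     \<and> card X = m"
proof (cases "m = N")
  case True
  have "{a..<a + N} \<in> boundary_sets a (Suc (a + N))" "{a..<Suc (a + N)} \<in> boundary_sets a (Suc (a + N))"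
    unfolding boundary_sets_def by auto
  then show ?thesis using True unfolding chain_sets_def
    by (intro bexI[of _ "{a..<a + N}"]) (auto simp: atLeastLessThanSuc)
next
  case False
  define e where "e = (\<lambda>P Q. if card P = m \<and> card Q = Suc m then of_bool (a + N \<in> Q)
                  else if card P = Suc m \<and> card Q = m then - of_bool (a + N \<in> P) else (0::int))"
  have "antisymmetric e" unfolding antisymmetric_def e_def by auto
  then have "(\<Sum>T\<in>#c. coboundary e T) = bdry a (Suc (a + N)) e"
    using c[unfolded chain_def, THEN conjunct2] by simp
  \<comment> \<open>The set \<open>{Suc k..<Suc (a + N)}\<close> has \<open>m\<close> elements
    exactly for \<open>k = a + N - m\<close>. On the left path \<open>a + N\<close> enters only with
    the step from level \<open>N\<close>.\<close>
  also have "\<dots> = (\<Sum>k\<in>{a..<Suc (a + N)}. if k = a + N - m then 1 else 0)"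
    unfolding bdry_def
  proof (intro sum.cong refl)
    fix k assume k: "k \<in> {a..<Suc (a + N)}"
    then have "e {a..<k} {a..<Suc k} = 0" using False by (auto simp: e_def)
    moreover have "e {Suc k..<Suc (a + N)} {k..<Suc (a + N)} = (if k = a + N - m then 1 else 0)"
      using k m by (auto simp: e_def)
    ultimately show "e {Suc k..<Suc (a + N)} {k..<Suc (a + N)} - e {a..<k} {a..<Suc k} =
        (if k = a + N - m then 1 else 0)" by simp
  qed
  also have "\<dots> = 1" using m False by auto
  finally have "(\<Sum>T\<in>#c. coboundary e T) \<noteq> 0" by simp
  moreover have "(\<Sum>T\<in>#c. coboundary e T) = 0" if "\<forall>T\<in>#c. coboundary e T = 0"
    using that by (induction c) auto
  ultimately obtain T where T: "T \<in># c" "coboundary e T \<noteq> 0" by blast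
  then have "tri {a..<Suc (a + N)} T" using c unfolding chain_def by blast
  then obtain X where "card X = m" "a + N \<notin> X" "X \<in> corners T" "insert (a + N) X \<in> corners T"
    using tri_level_jump[of _ T m "a + N"] T(2) unfolding e_def by blast
  then show ?thesis using T(1) unfolding chain_sets_def by blast
qed

lemma finite_chain_sets: "chain a b c \<Longrightarrow> finite (chain_sets a b c)"
  using chain_sets_subset[of a b c] finite_subset[of "chain_sets a b c" "Pow {a..<b}"] by auto

lemma card_chain_sets:
  "chain a (a + N) c \<Longrightarrow> N * (N + 1) + 2 \<le> 2 * card (chain_sets a (a + N) c)"
proof (induction N arbitrary: c)
  case 0
  have "{} \<in> chain_sets a a c" unfolding chain_sets_def boundary_sets_def by auto
  then show ?case using finite_chain_sets[OF 0] card_gt_0_iff[of "chain_sets a a c"] by fastforce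
next
  case (Suc N)
  let ?b = "a + N" and ?V = "chain_sets a (Suc (a + N)) c"
  let ?P = "{X \<in> ?V. ?b \<notin> X \<and> insert ?b X \<in> ?V}"
  have c: "chain a (Suc ?b) c" using Suc.prems by simp
  have fin: "finite ?V" using finite_chain_sets[OF c] .
  have "chain_sets a ?b (contract ?b c) = (\<lambda>A. A - {?b}) ` ?V"
    using boundary_sets_delete_max[of a ?b] by (intro chain_sets_contract[OF c]) auto
  then have "N * (N + 1) + 2 \<le> 2 * card ((\<lambda>A. A - {?b}) ` ?V)"
    using Suc.IH[OF chain_contract_max[OF c]] by simp
  moreover have "{..N} \<subseteq> card ` ?P"
  proof
    fix m assume "m \<in> {..N}"
    then obtain X where "X \<in> ?V" "?b \<notin> X" "insert ?b X \<in> ?V" "card X = m"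
      using chain_level_pair[OF c, of m] by auto
    then show "m \<in> card ` ?P" by blast
  qed
  then have "card {..N} \<le> card (card ` ?P)" using fin by (intro card_mono) auto
  moreover have "card (card ` ?P) \<le> card ?P" using fin by (intro card_image_le) auto
  ultimately show ?case using card_delete_image[OF fin, of ?b] by (simp add: algebra_simps)
qed

text \<open>A largest element that lies in only one of the sets cannot belong to a surrounded set.
  Weak separation asks the surrounding set not to be larger, so shrinking it is harmless; if its
  upper part vanishes, the pair becomes ordered.\<close>

lemma weakly_separated_delete_max:
  assumes fin: "finite A" "finite B" and le: "\<forall>x\<in>A \<union> B. x \<le> q" and ws: "weakly_separated A B"
  shows "weakly_separated (A - {q}) (B - {q})"
proof -
  have main: "weakly_separated (C - {q}) D" if q: "q \<in> C - D" and ws: "weakly_separated C D"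
    and fin: "finite C" and le: "\<forall>x\<in>C \<union> D. x \<le> q" for C D
  proof -
    have "\<not> surrounded_by C D"
    proof
      assume "surrounded_by C D"
      from surrounded_by_above[OF this q] obtain y where "y \<in> D" "q < y" by blast
      then show False using le by (meson UnI2 not_le)
    qed
    then consider "set_lessdot C D" | "set_lessdot D C" | "surrounded_by D C" "card C \<le> card D"
      using ws unfolding weakly_separated_iff by blast
    then show ?thesis
    proof cases
      case 3
      have c: "card (C - {q}) \<le> card D" using 3(2) by (meson card_Diff1_le le_trans)
      have s: "\<exists>x\<in>C - D. \<forall>a\<in>D - C. x < a" "D - C \<noteq> {}"
        "\<forall>x\<in>C - D. (\<forall>a\<in>D - C. x < a) \<or> (\<forall>a\<in>D - C. a < x)"
        using 3(1) unfolding surrounded_by_iff by auto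
      have e: "D - (C - {q}) = D - C" "C - {q} - D = C - D - {q}" using q by auto
      have low: "\<exists>x\<in>C - D - {q}. \<forall>a\<in>D - C. x < a"
      proof -
        obtain x z where x: "x \<in> C - D" "\<forall>a\<in>D - C. x < a" and z: "z \<in> D - C" using s by blast
        then have "x < z" "z \<le> q" using le by auto
        then show ?thesis using x by auto
      qed
      show ?thesis
      proof (cases "\<exists>x\<in>C - D - {q}. \<forall>a\<in>D - C. a < x")
        case True
        then have "surrounded_by D (C - {q})" unfolding surrounded_by_iff e using s low by blast
        then show ?thesis using c unfolding weakly_separated_iff by blast
      next
        case False
        then have "set_lessdot (C - {q}) D" unfolding set_lessdot_def e using s(3) by blast
        then show ?thesis unfolding weakly_separated_iff by blast
      qed
    next
      case 1
      then have "set_lessdot (C - {q}) D" using q unfolding set_lessdot_def by blast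
      then show ?thesis unfolding weakly_separated_iff by blast
    next
      case 2
      then have "set_lessdot D (C - {q})" using q unfolding set_lessdot_def by blast
      then show ?thesis unfolding weakly_separated_iff by blast
    qed
  qed
  consider "q \<in> A \<longleftrightarrow> q \<in> B" | "q \<in> A - B" | "q \<in> B - A" by blast
  then show ?thesis
  proof cases
    case 1
    then show ?thesis using weakly_separated_delete_common[OF fin 1] ws by simp
  next
    case 2
    then show ?thesis using main[OF 2 ws fin(1) le] by simp
  next
    case 3
    then show ?thesis using main[OF 3 weakly_separated_sym[OF ws] fin(2)] le weakly_separated_sym by auto
  qed
qed

text \<open>Since \<open>q\<close> is on top and makes its set the larger one, the separation of
  \<open>X\<close> from \<open>insert q Y\<close> can only be \<open>set_lessdot X Y\<close>.
  Exchanging the roles gives the opposite order. Hence a weakly separated collection has at most one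
  pair \<open>X\<close>, \<open>insert q X\<close> on each level.\<close>

lemma weakly_separated_same_level:
  assumes fin: "finite X" "finite Y" and le: "\<forall>x\<in>X \<union> Y. x < q" and c: "card X = card Y"
    and XY: "weakly_separated X (insert q Y)" and YX: "weakly_separated Y (insert q X)"
  shows "X = Y"
proof (rule ccontr)
  assume "X \<noteq> Y"
  have main: "set_lessdot C D" "C - D \<noteq> {}" if "weakly_separated C (insert q D)" "\<forall>x\<in>C \<union> D. x < q"
    "finite C" "finite D" "card C = card D" "C \<noteq> D" for C D
  proof -
    show ne: "C - D \<noteq> {}" using that(3-6) card_subset_eq[of D C] by auto
    then obtain x where x: "x \<in> C - D" by blast
    have q: "q \<notin> C" "q \<notin> D" using that(2) by auto
    have "q \<in> insert q D - C" "x \<in> C - insert q D" "x < q" using x q that(2) by auto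
    then have "\<not> set_lessdot (insert q D) C" unfolding set_lessdot_def by (meson order.asym)
    moreover have "\<not> card (insert q D) \<le> card C" using that q by simp
    moreover have "\<not> surrounded_by (insert q D) C"
    proof
      assume "surrounded_by (insert q D) C"
      from surrounded_by_above[OF this, of q] obtain y where "y \<in> C" "q < y" using q by blast
      then show False using that(2) order.asym[of y q] by blast
    qed
    ultimately have "set_lessdot C (insert q D)" using that(1) unfolding weakly_separated_iff by blast
    then show "set_lessdot C D" using q unfolding set_lessdot_def by blast
  qed
  have "set_lessdot X Y" "X - Y \<noteq> {}" using main[OF XY le fin c \<open>X \<noteq> Y\<close>] by auto
  moreover have "set_lessdot Y X" "Y - X \<noteq> {}"
    using main[OF YX _ fin(2,1) c[symmetric] \<open>X \<noteq> Y\<close>[symmetric]] le by auto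
  ultimately show False unfolding set_lessdot_def by (meson all_not_in_conv order.asym)
qed

lemma card_weakly_separated_le:
  "D \<subseteq> Pow {a..<a + N} \<Longrightarrow> pairwise weakly_separated D \<Longrightarrow> 2 * card D \<le> N * (N + 1) + 2"
proof (induction N arbitrary: D)
  case 0
  then have "D \<subseteq> {{}}" by auto
  then have "card D \<le> card {{}::nat set}" by (intro card_mono) auto
  then show ?case by simp
next
  case (Suc N)
  let ?q = "a + N" let ?P = "{X \<in> D. ?q \<notin> X \<and> insert ?q X \<in> D}"
  have sub: "X \<subseteq> {a..?q}" "finite X" if "X \<in> D" for X
  proof -
    have "X \<subseteq> {a..<a + Suc N}" using that Suc.prems(1) by blast
    then show "X \<subseteq> {a..?q}" "finite X" using finite_subset[of X "{a..<a + Suc N}"] by auto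
  qed
  have fin: "finite D" using Suc.prems(1) finite_subset by blast
  have "(\<lambda>A. A - {?q}) ` D \<subseteq> Pow {a..<?q}"
  proof (intro subsetI PowI; elim imageE; hypsubst)
    fix A y assume "A \<in> D" "y \<in> A - {?q}"
    then show "y \<in> {a..<?q}" using sub(1)[of A] by fastforce
  qed
  moreover have "pairwise weakly_separated ((\<lambda>A. A - {?q}) ` D)"
    unfolding pairwise_def
  proof (intro ballI impI)
    fix A' B' assume AB: "A' \<in> (\<lambda>A. A - {?q}) ` D" "B' \<in> (\<lambda>A. A - {?q}) ` D" "A' \<noteq> B'"
    then obtain A B where *: "A \<in> D" "A' = A - {?q}" "B \<in> D" "B' = B - {?q}" by blast
    have "A \<noteq> B" using * AB(3) by blast
    then have "weakly_separated A B" using pairwiseD[OF Suc.prems(2) *(1,3)] by simp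
    moreover have "\<forall>x\<in>A \<union> B. x \<le> ?q" using sub(1)[OF *(1)] sub(1)[OF *(3)] by auto
    ultimately show "weakly_separated A' B'"
      unfolding * using weakly_separated_delete_max[OF sub(2)[OF *(1)] sub(2)[OF *(3)]] by blast
  qed
  ultimately have 1: "2 * card ((\<lambda>A. A - {?q}) ` D) \<le> N * (N + 1) + 2" by (rule Suc.IH)
  have lt: "\<forall>x\<in>X. x < ?q" if "X \<in> ?P" for X
  proof
    fix x assume "x \<in> X"
    then have "x \<le> ?q" "x \<noteq> ?q" using that sub(1)[of X] by auto
    then show "x < ?q" by simp
  qed
  have "inj_on card ?P"
  proof (rule inj_onI)
    fix X Y assume X: "X \<in> ?P" and Y: "Y \<in> ?P" and c: "card X = card Y"
    have "X \<noteq> insert ?q Y" "Y \<noteq> insert ?q X" using X Y by auto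
    then have "weakly_separated X (insert ?q Y)" "weakly_separated Y (insert ?q X)"
      using X Y pairwiseD[OF Suc.prems(2)] by auto
    then show "X = Y"
      using weakly_separated_same_level[of X Y ?q] lt[OF X] lt[OF Y] X Y sub(2) c by blast
  qed
  then have "card ?P = card (card ` ?P)" by (rule card_image[symmetric])
  also have "card ` ?P \<subseteq> {..N}"
  proof (intro subsetI; elim imageE; hypsubst)
    fix X assume X: "X \<in> ?P"
    have "X \<subseteq> {a..<?q}" using lt[OF X] sub(1)[of X] X by fastforce
    then show "card X \<in> {..N}" using card_mono[of "{a..<?q}" X] by simp
  qed
  then have "card (card ` ?P) \<le> card {..N}" by (intro card_mono) auto
  finally have "card ?P \<le> Suc N" by simp
  then show ?case using 1 card_delete_image[OF fin, of ?q] by (simp add: algebra_simps)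
qed

lemma chain_sets_maximal:
  assumes "chain 1 (Suc n) c"
  shows "maximal_w_collection n (chain_sets 1 (Suc n) c)"
proof -
  have e: "{1..n} = {1..<1 + n}" by auto
  have c: "chain 1 (1 + n) c" using assms by simp
  let ?V = "chain_sets 1 (1 + n) c"
  have "?V \<subseteq> Pow {1..n}" using chain_sets_subset[OF c] unfolding e by blast
  then have "w_collection n ?V"
    unfolding w_collection_def pairwise_def using chain_sets_weakly_separated[OF c] by blast
  moreover have "D = ?V" if D: "w_collection n D" "?V \<subseteq> D" for D
  proof -
    have "D \<subseteq> Pow {1..<1 + n}" "pairwise weakly_separated D"
      using D(1) unfolding w_collection_def e by auto
    then have "2 * card D \<le> n * (n + 1) + 2" and "finite D"
      using card_weakly_separated_le[of D 1 n] finite_subset by auto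
    moreover from this have "card ?V \<le> card D" using D(2) by (intro card_mono)
    moreover have "n * (n + 1) + 2 \<le> 2 * card ?V" by (rule card_chain_sets[OF c])
    ultimately have "card ?V = card D" by linarith
    then show "D = ?V" using D(2) \<open>finite D\<close> card_subset_eq[of D ?V] by simp
  qed
  ultimately show ?thesis unfolding maximal_w_collection_def by simp
qed

section \<open>Plane geometry\<close>

definition cross :: "complex \<Rightarrow> complex \<Rightarrow> real" where
  "cross u v = Re u * Im v - Im u * Re v"

lemma cross_add_right: "cross u (v + w) = cross u v + cross u w"
  and cross_diff_right: "cross u (v - w) = cross u v - cross u w"
  and cross_diff_left: "cross (v - w) u = cross v u - cross w u"
  and cross_scaleR_right: "cross u (c *\<^sub>R v) = c * cross u v"
  and cross_self: "cross u u = 0"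
  and cross_skew: "cross u v = - cross v u"
  by (simp_all add: cross_def algebra_simps)

lemma cross_sum_right: "cross u (\<Sum>i\<in>I. f i) = (\<Sum>i\<in>I. cross u (f i))"
  by (induction I rule: infinite_finite_induct) (simp_all add: cross_add_right, simp_all add: cross_def)

text \<open>Translates orientation into linear functionals, for use with supporting lines.\<close>

lemma inner_ii_mult: "inner (\<i> * u) v = cross u v"
  by (simp add: cross_def inner_complex_def)

lemma cross_triangle_rotate: "cross (b - a) (c - a) = cross (c - b) (a - b)"
  by (simp add: cross_def algebra_simps)

lemma not_collinear_if_cross:
  assumes "cross (b - a) (c - a) \<noteq> 0"
  shows "\<not> collinear {a, b, c}"
proof
  assume "collinear {a, b, c}"
  then have "collinear {b, a, c}" by (simp add: insert_commute)
  then have "collinear {0, b - a, c - a}" using collinear_3[of b a c] by (simp add: NO_MATCH_def)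
  then consider "b - a = 0" | "c - a = 0" | k where "c - a = k *\<^sub>R (b - a)"
    unfolding collinear_lemma by blast
  then show False using assms by cases (auto simp: cross_scaleR_right cross_self, auto simp: cross_def)
qed

lemma interior_triangle_nonempty:
  assumes "cross (b - a) (c - a) \<noteq> 0"
  shows "interior (convex hull {a, b, c :: complex}) \<noteq> {}"
proof -
  have "(1/3) *\<^sub>R a + (1/3) *\<^sub>R b + (1/3) *\<^sub>R c \<in> interior (convex hull {a, b, c})"
    unfolding interior_convex_hull_3_minimal[OF not_collinear_if_cross[OF assms] DIM_complex]
    by (auto intro!: exI[of _ "1/3"])
  then show ?thesis by blast
qed

lemma triangle_edge:
  fixes a b c :: complex
  assumes "cross (b - a) (c - a) > 0"
  shows "closed_segment a b edge_of (convex hull {a, b, c})"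
proof -
  have nc: "\<not> collinear {a, b, c}" using not_collinear_if_cross assms by simp
  then have "\<not> affine_dependent {a, b, c}" "a \<noteq> b" by (auto simp: collinear_3_eq_affine_dependent)
  then have "(convex hull {a, b}) face_of (convex hull {a, b, c})"
    by (subst face_of_convex_hull_affine_independent) (auto intro!: exI[of _ "{a, b}"])
  then show ?thesis unfolding edge_of_def segment_convex_hull
    using \<open>a \<noteq> b\<close> by (simp add: aff_dim_convex_hull)
qed

lemma triangle_extreme_points:
  fixes a b c :: complex
  assumes "cross (b - a) (c - a) > 0"
  shows "x extreme_point_of (convex hull {a, b, c}) \<longleftrightarrow> x \<in> {a, b, c}"
  using not_collinear_if_cross[of b a c] assms
  by (intro extreme_point_of_convex_hull_affine_independent) (auto simp: collinear_3_eq_affine_dependent)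

text \<open>A local form of lying to the left of \<open>u v\<close>, which makes sets on the same
  side comparable. The numbers \<open>s\<close> and \<open>\<tau>\<close> are the coordinates of
  \<open>z - midpoint u v\<close> along the side and along its normal: move towards \<open>z\<close>
  and correct sideways along the side.\<close>

lemma triangle_contains_normal:
  fixes u v z :: complex
  assumes "cross (v - u) (z - u) > 0"
  shows "\<exists>d>0. \<forall>t. 0 \<le> t \<and> t \<le> d \<longrightarrow> midpoint u v + t *\<^sub>R (\<i> * (v - u)) \<in> convex hull {u, v, z}"
proof -
  define w where "w = v - u"
  have w: "norm w ^ 2 > 0" using assms by (auto simp: w_def cross_def)
  define s where "s = inner w (z - midpoint u v) / norm w ^ 2"
  define \<tau> where "\<tau> = cross w (z - u) / norm w ^ 2"
  have \<tau>: "\<tau> > 0" using assms w by (simp add: \<tau>_def w_def)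
  have cm: "cross w (z - midpoint u v) = cross w (z - u)"
    by (simp add: cross_def w_def midpoint_def field_simps)
  have nw: "norm w ^ 2 = Re w ^ 2 + Im w ^ 2" by (simp add: cmod_power2)
  have z: "z - midpoint u v = s *\<^sub>R w + \<tau> *\<^sub>R (\<i> * w)"
  proof -
    have "norm w ^ 2 *\<^sub>R (z - midpoint u v) =
      inner w (z - midpoint u v) *\<^sub>R w + cross w (z - midpoint u v) *\<^sub>R (\<i> * w)"
      unfolding nw by (simp add: complex_eq_iff inner_complex_def cross_def algebra_simps power2_eq_square)
    then have "z - midpoint u v = (1 / norm w ^ 2) *\<^sub>R (inner w (z - midpoint u v) *\<^sub>R w + cross w (z - midpoint u v) *\<^sub>R (\<i> * w))"
      using w by (metis less_irrefl nonzero_divide_eq_eq one_neq_zero scaleR_one scaleR_scaleR)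
    then show ?thesis unfolding s_def \<tau>_def cm by (simp add: scaleR_add_right)
  qed
  \<comment> \<open>The bound on \<open>t\<close> is what keeps the weights \<open>\<alpha>\<close>
    and \<open>\<beta>\<close> of \<open>u\<close> and \<open>v\<close> nonnegative after the
    sideways correction \<open>l * s\<close>.\<close>
  have "midpoint u v + t *\<^sub>R (\<i> * w) \<in> convex hull {u, v, z}"
    if t: "0 \<le> t" "t \<le> \<tau> / (1 + 2 * \<bar>s\<bar>)" for t
  proof -
    define l where "l = t / \<tau>"
    have l: "0 \<le> l" "l * (1 + 2 * \<bar>s\<bar>) \<le> 1" using t \<tau> by (auto simp: l_def field_simps)
    have b: "\<bar>l * s\<bar> \<le> 1/2 - l/2" using l by (simp add: abs_mult field_simps)
    define \<alpha> where "\<alpha> = 1/2 - l/2 + l * s"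
    define \<beta> where "\<beta> = 1/2 - l/2 - l * s"
    have "midpoint u v + t *\<^sub>R (\<i> * w) = midpoint u v + l *\<^sub>R (z - midpoint u v - s *\<^sub>R w)"
      using \<tau> z by (simp add: l_def)
    also have "\<dots> = \<alpha> *\<^sub>R u + \<beta> *\<^sub>R v + l *\<^sub>R z"
      by (simp add: \<alpha>_def \<beta>_def w_def midpoint_def complex_eq_iff field_simps)
    finally have "midpoint u v + t *\<^sub>R (\<i> * w) = \<alpha> *\<^sub>R u + \<beta> *\<^sub>R v + l *\<^sub>R z" .
    moreover have "0 \<le> \<alpha>" "0 \<le> \<beta>" "\<alpha> + \<beta> + l = 1" using b l by (auto simp: \<alpha>_def \<beta>_def abs_le_iff)
    ultimately show ?thesis unfolding convex_hull_3 using l(1) by blast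
  qed
  moreover have "\<tau> / (1 + 2 * \<bar>s\<bar>) > 0" using \<tau> by simp
  ultimately show ?thesis unfolding w_def by blast
qed

lemma convex_contains_normal:
  fixes u v z :: complex
  assumes "convex P" "u \<in> P" "v \<in> P" "z \<in> P" "cross (v - u) (z - u) > 0"
  obtains d where "d > 0" "\<And>t. 0 \<le> t \<Longrightarrow> t \<le> d \<Longrightarrow> midpoint u v + t *\<^sub>R (\<i> * (v - u)) \<in> P"
proof -
  have "convex hull {u, v, z} \<subseteq> P" using assms by (intro hull_minimal) auto
  then show thesis using triangle_contains_normal[OF assms(5)] that by blast
qed

lemma cross_midpoint_normal:
  "cross (v - u) (midpoint u v + t *\<^sub>R (\<i> * (v - u)) - u) = t * norm (v - u) ^ 2"
  unfolding cmod_power2 by (simp add: cross_def midpoint_def power2_eq_square field_simps)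

lemma cross_closed_segment: "x \<in> closed_segment u v \<Longrightarrow> cross (v - u) (x - u) = 0"
proof -
  assume "x \<in> closed_segment u v"
  then obtain t where "x = (1 - t) *\<^sub>R u + t *\<^sub>R v" unfolding closed_segment_def by blast
  then have "x - u = t *\<^sub>R (v - u)" by (simp add: algebra_simps)
  then show ?thesis by (simp add: cross_scaleR_right cross_self)
qed

lemma cross_flip: "cross (u - v) (x - v) = - cross (v - u) (x - u)"
  by (simp add: cross_def algebra_simps)

lemma cross_pos_neq: "cross (v - u) (z - u) > 0 \<Longrightarrow> u \<noteq> v"
  by (auto simp: cross_def)

lemma overlap_on_same_side:
  assumes "convex P" "u \<in> P" "v \<in> P" "z \<in> P" "cross (v - u) (z - u) > 0"
    and "convex Q" "u \<in> Q" "v \<in> Q" "z' \<in> Q" "cross (v - u) (z' - u) > 0"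
  shows "\<exists>y\<in>P \<inter> Q. cross (v - u) (y - u) > 0"
proof -
  obtain d where d: "d > 0" "\<And>t. 0 \<le> t \<Longrightarrow> t \<le> d \<Longrightarrow> midpoint u v + t *\<^sub>R (\<i> * (v - u)) \<in> P"
    using convex_contains_normal[OF assms(1-5)] by blast
  obtain d' where d': "d' > 0" "\<And>t. 0 \<le> t \<Longrightarrow> t \<le> d' \<Longrightarrow> midpoint u v + t *\<^sub>R (\<i> * (v - u)) \<in> Q"
    using convex_contains_normal[OF assms(6-10)] by blast
  have "midpoint u v + min d d' *\<^sub>R (\<i> * (v - u)) \<in> P \<inter> Q" using d d' by simp
  moreover have "cross (v - u) (midpoint u v + min d d' *\<^sub>R (\<i> * (v - u)) - u) > 0"
    unfolding cross_midpoint_normal using d(1) d'(1) cross_pos_neq[OF assms(5)] by simp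
  ultimately show ?thesis by blast
qed

text \<open>With points on both sides, short normals in both directions would lie in
  \<open>P\<close>. They form a segment through the midpoint that leaves the face, contrary to the
  definition of a face.\<close>

lemma face_segment_one_side:
  assumes P: "convex P" and f: "closed_segment u v face_of P"
    and z: "z \<in> P" "cross (v - u) (z - u) > 0" and y: "y \<in> P"
  shows "cross (v - u) (y - u) \<ge> 0"
proof (rule ccontr)
  assume "\<not> ?thesis"
  then have y': "cross (u - v) (y - v) > 0" by (simp add: cross_flip[of u v])
  have uv: "u \<in> P" "v \<in> P" using face_of_imp_subset[OF f] by auto
  obtain d where d: "d > 0" "\<And>t. 0 \<le> t \<Longrightarrow> t \<le> d \<Longrightarrow> midpoint u v + t *\<^sub>R (\<i> * (v - u)) \<in> P"
    using convex_contains_normal[OF P uv z] by blast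
  obtain d' where d': "d' > 0" "\<And>t. 0 \<le> t \<Longrightarrow> t \<le> d' \<Longrightarrow> midpoint v u + t *\<^sub>R (\<i> * (u - v)) \<in> P"
    using convex_contains_normal[OF P uv(2,1) y y'] by blast
  define t where "t = min d d'"
  define r where "r = midpoint u v + t *\<^sub>R (\<i> * (v - u))"
  define l where "l = midpoint u v + t *\<^sub>R (\<i> * (u - v))"
  have t: "t > 0" using d(1) d'(1) by (simp add: t_def)
  have "r \<in> P" "l \<in> P" using d d' t by (auto simp: r_def l_def t_def midpoint_sym[of v u])
  moreover have "midpoint u v = midpoint r l"
    unfolding r_def l_def by (simp add: midpoint_def complex_eq_iff field_simps)
  moreover have "cross (v - u) (r - u) > 0"
    unfolding r_def cross_midpoint_normal using t cross_pos_neq[OF z(2)] by simp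
  then have r: "r \<notin> closed_segment u v" using cross_closed_segment by force
  have "r \<noteq> l"
    using t cross_pos_neq[OF z(2)] by (auto simp: r_def l_def complex_eq_iff)
  then have "midpoint r l \<in> open_segment r l" by simp
  moreover have "midpoint u v \<in> closed_segment u v" by simp
  ultimately show False using f r unfolding face_of_def by metis
qed

text \<open>Strict convexity of the ball; it will certify the vertices of a lens.\<close>

lemma extreme_point_on_sphere:
  fixes x :: "'a::euclidean_space"
  assumes "P \<subseteq> cball c r" "x \<in> P" "dist c x = r"
  shows "x extreme_point_of P"
  unfolding extreme_point_of_def
proof (intro conjI ballI notI)
  fix a b assume "a \<in> P" "b \<in> P" "x \<in> open_segment a b"
  then have "dist c a \<le> r" "dist c b \<le> r" using assms(1) by auto
  then show False using dist_decreases_open_segment[OF \<open>x \<in> open_segment a b\<close>, of c] assms(3) by auto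
qed (use assms in auto)

lemma face_of_in_rel_interior:
  fixes e :: "complex set"
  assumes P: "convex P" and e: "closed_segment u v edge_of P" and e': "e' edge_of P" and m: "midpoint u v \<in> e'"
  shows "e' = closed_segment u v"
proof -
  have "u \<noteq> v" using e unfolding edge_of_def by auto
  then have "midpoint u v \<in> rel_interior (closed_segment u v)" by (simp add: rel_interior_closed_segment)
  then have sub: "closed_segment u v \<subseteq> e'"
    using subset_of_face_of[of e' P "closed_segment u v"] e e' m edge_of_imp_subset unfolding edge_of_def by blast
  then have "closed_segment u v face_of e'"
    using face_of_subset[of "closed_segment u v" P e'] e e' edge_of_imp_subset unfolding edge_of_def by blast
  moreover have "convex e'" using e' face_of_imp_convex unfolding edge_of_def by blast
  ultimately show ?thesis using face_of_aff_dim_lt[of e' "closed_segment u v"] e e' unfolding edge_of_def by force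
qed

text \<open>A supporting line at the midpoint contains both ends and cuts out an edge of
  \<open>P\<close>. As \<open>a\<close> and \<open>b\<close> are extreme, they are the ends of that
  edge, so it is no longer than the given segment.\<close>

lemma edge_of_frontier_segment:
  fixes P :: "complex set"
  assumes P: "convex P" "compact P" "interior P \<noteq> {}"
    and ab: "a extreme_point_of P" "b extreme_point_of P" "a \<noteq> b" "closed_segment a b \<subseteq> frontier P"
    and edges: "\<And>e. e edge_of P \<Longrightarrow> \<exists>p q. e = closed_segment p q"
  shows "closed_segment a b edge_of P"
proof -
  define m where "m = midpoint a b"
  have cl: "closed P" using P(2) by (rule compact_imp_closed)
  have abP: "a \<in> P" "b \<in> P" using ab unfolding extreme_point_of_def by auto
  have "m \<in> frontier P" using ab(4) by (auto simp: m_def)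
  then have m: "m \<in> P" "m \<notin> rel_interior P"
    using cl rel_interior_nonempty_interior[OF P(3)] by (auto simp: frontier_def)
  obtain w where w: "w \<noteq> 0" "\<And>y. y \<in> P \<Longrightarrow> w \<bullet> m \<le> w \<bullet> y"
    using supporting_hyperplane_rel_boundary[OF P(1) m] by metis
  define F where "F = P \<inter> {y. w \<bullet> y = w \<bullet> m}"
  have F: "F face_of P" unfolding F_def using w(2) P(1) by (intro face_of_Int_supporting_hyperplane_ge)
  have "w \<bullet> m \<le> w \<bullet> a" "w \<bullet> m \<le> w \<bullet> b" using w(2) abP by auto
  moreover have "2 * (w \<bullet> m) = w \<bullet> a + w \<bullet> b"
    by (simp add: m_def midpoint_def inner_add_right field_simps)
  ultimately have abF: "a \<in> F" "b \<in> F" using abP unfolding F_def by auto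
  have "aff_dim F \<le> aff_dim {y. w \<bullet> y = w \<bullet> m}" unfolding F_def by (intro aff_dim_subset) auto
  also have "\<dots> = 1" using w(1) by (simp add: aff_dim_hyperplane)
  finally have "aff_dim F \<le> 1" .
  moreover have "aff_dim F \<ge> 1"
    using aff_dim_subset[of "{a, b}" F] abF ab(3) by simp
  ultimately have Fe: "F edge_of P" using F unfolding edge_of_def by simp
  then obtain p q where pq: "F = closed_segment p q" using edges by blast
  have "a extreme_point_of F" "b extreme_point_of F" using ab abF extreme_point_of_face[OF F] by auto
  then have "{a, b} = {p, q}" using ab(3) unfolding pq extreme_point_of_segment by auto
  then have "F = closed_segment a b" unfolding pq by simp
  then show ?thesis using Fe by simp
qed

section \<open>Tiles\<close>

lemma nth_image_atMost: "length xs = Suc q \<Longrightarrow> set xs = (!) xs ` {..q}"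
  by (auto simp: in_set_conv_nth image_iff less_Suc_eq_le)

locale zonogon_frame =
  fixes n :: nat and \<xi> :: "nat \<Rightarrow> complex"
  assumes gen: "zonogon_generators n \<xi>"
begin

lemma norm_generator: "i \<in> {1..n} \<Longrightarrow> norm (\<xi> i) = 1"
  using gen unfolding zonogon_generators_def by simp

lemma cross_generators:
  assumes "i \<in> {1..n}" "j \<in> {1..n}" "i < j"
  shows "cross (\<xi> j) (\<xi> i) > 0"
proof -
  have im: "Im (\<xi> k) > 0" "norm (\<xi> k) = 1" if "k \<in> {1..n}" for k
    using gen that unfolding zonogon_generators_def by simp_all
  have cis: "\<xi> k = cis (Arg (\<xi> k))" "0 < Arg (\<xi> k)" "Arg (\<xi> k) < pi" if "k \<in> {1..n}" for k
  proof -
    have "\<xi> k \<noteq> 0" using im(1)[OF that] by auto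
    then show "\<xi> k = cis (Arg (\<xi> k))" using cis_Arg[of "\<xi> k"] im(2)[OF that] by (simp add: sgn_div_norm)
    show "0 < Arg (\<xi> k)" "Arg (\<xi> k) < pi" using Arg_lt_pi[of "\<xi> k"] im(1)[OF that] by auto
  qed
  have "Arg (\<xi> j) < Arg (\<xi> i)" using gen assms unfolding zonogon_generators_def by simp
  then have "sin (Arg (\<xi> i) - Arg (\<xi> j)) > 0"
    using cis[OF assms(1)] cis[OF assms(2)] by (intro sin_gt_zero) auto
  also have "sin (Arg (\<xi> i) - Arg (\<xi> j)) = cross (cis (Arg (\<xi> j))) (cis (Arg (\<xi> i)))"
    by (simp add: cross_def sin_diff)
  finally show ?thesis using cis(1)[OF assms(1)] cis(1)[OF assms(2)] by simp
qed

text \<open>The coefficients come from Cramer's rule. The last inequality uses unit length: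
  \<open>\<xi> j\<close> lies on the circle, strictly beyond the chord from \<open>\<xi> i\<close>
  to \<open>\<xi> k\<close>.\<close>

lemma generator_between:
  assumes "i \<in> {1..n}" "j \<in> {1..n}" "k \<in> {1..n}" "i < j" "j < k"
  obtains \<alpha> \<beta> where "\<xi> j = \<alpha> *\<^sub>R \<xi> i + \<beta> *\<^sub>R \<xi> k" "\<alpha> > 0" "\<beta> > 0" "\<alpha> + \<beta> > 1"
proof
  define d where "d = cross (\<xi> k) (\<xi> i)"
  define \<alpha> where "\<alpha> = cross (\<xi> k) (\<xi> j) / d"
  define \<beta> where "\<beta> = cross (\<xi> j) (\<xi> i) / d"
  have d: "d > 0" "cross (\<xi> k) (\<xi> j) > 0" "cross (\<xi> j) (\<xi> i) > 0"
    using cross_generators assms by (auto simp: d_def)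
  then show pos: "\<alpha> > 0" "\<beta> > 0" by (auto simp: \<alpha>_def \<beta>_def)
  have "d *\<^sub>R \<xi> j = cross (\<xi> k) (\<xi> j) *\<^sub>R \<xi> i + cross (\<xi> j) (\<xi> i) *\<^sub>R \<xi> k"
    by (simp add: d_def complex_eq_iff cross_def algebra_simps)
  then have "(1 / d) *\<^sub>R (d *\<^sub>R \<xi> j) = \<alpha> *\<^sub>R \<xi> i + \<beta> *\<^sub>R \<xi> k"
    by (simp add: \<alpha>_def \<beta>_def scaleR_add_right)
  then show eq: "\<xi> j = \<alpha> *\<^sub>R \<xi> i + \<beta> *\<^sub>R \<xi> k" using d(1) by simp
  have n: "Re (\<xi> i) ^ 2 + Im (\<xi> i) ^ 2 = 1" "Re (\<xi> k) ^ 2 + Im (\<xi> k) ^ 2 = 1" "Re (\<xi> j) ^ 2 + Im (\<xi> j) ^ 2 = 1"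
    using norm_generator assms by (metis cmod_power2 power_one)+
  let ?s = "Re (\<xi> i) * Re (\<xi> k) + Im (\<xi> i) * Im (\<xi> k)"
  have "?s ^ 2 + d ^ 2 = (Re (\<xi> i) ^ 2 + Im (\<xi> i) ^ 2) * (Re (\<xi> k) ^ 2 + Im (\<xi> k) ^ 2)"
    unfolding d_def cross_def by algebra
  then have "?s ^ 2 + d ^ 2 = 1" using n by simp
  moreover have "d ^ 2 > 0" using d(1) by simp
  ultimately have "?s ^ 2 < 1 ^ 2" unfolding power_one by linarith
  then have s: "?s < 1" by (smt (verit) power_mono)
  have "1 = \<alpha>^2 * (Re (\<xi> i) ^ 2 + Im (\<xi> i) ^ 2) + \<beta>^2 * (Re (\<xi> k) ^ 2 + Im (\<xi> k) ^ 2) + 2 * \<alpha> * \<beta> * ?s"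
    unfolding n(3)[symmetric] eq by (simp add: power2_eq_square algebra_simps)
  also have "\<dots> < \<alpha>^2 + \<beta>^2 + 2 * \<alpha> * \<beta>" using n s pos by simp
  also have "\<dots> = (\<alpha> + \<beta>)^2" by (simp add: power2_eq_square algebra_simps)
  finally show "\<alpha> + \<beta> > 1" using pos by (smt (verit) power_le_one)
qed

lemma cross_three_generators:
  assumes "i \<in> {1..n}" "j \<in> {1..n}" "k \<in> {1..n}" "i < j" "j < k"
  shows "cross (\<xi> k - \<xi> i) (\<xi> j - \<xi> i) > 0"
proof -
  obtain \<alpha> \<beta> where e: "\<xi> j = \<alpha> *\<^sub>R \<xi> i + \<beta> *\<^sub>R \<xi> k" "\<alpha> + \<beta> > 1" using generator_between[OF assms] by metis
  have "cross (\<xi> k - \<xi> i) (\<xi> j - \<xi> i) = (\<alpha> + \<beta> - 1) * cross (\<xi> k) (\<xi> i)"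
    unfolding e(1) by (simp add: cross_def algebra_simps)
  then show ?thesis using e(2) cross_generators[OF assms(1,3)] assms(4,5) by simp
qed

text \<open>Reflecting the arc between \<open>\<xi> i\<close> and \<open>\<xi> k\<close> in the
  midpoint of its chord keeps it inside the unit disc. In a lens this relates the two boundary paths
  to each other's circle.\<close>

lemma norm_three_generators:
  assumes "i \<in> {1..n}" "j \<in> {1..n}" "k \<in> {1..n}" "i < j" "j < k"
  shows "norm (\<xi> i + \<xi> k - \<xi> j) \<le> 1"
proof -
  obtain \<alpha> \<beta> where e: "\<xi> j = \<alpha> *\<^sub>R \<xi> i + \<beta> *\<^sub>R \<xi> k" "\<alpha> + \<beta> > 1" using generator_between[OF assms] by metis
  have n: "Re (\<xi> i) ^ 2 + Im (\<xi> i) ^ 2 = 1" "Re (\<xi> k) ^ 2 + Im (\<xi> k) ^ 2 = 1" "Re (\<xi> j) ^ 2 + Im (\<xi> j) ^ 2 = 1"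
    using norm_generator assms by (metis cmod_power2 power_one)+
  define s where "s = Re (\<xi> i) * Re (\<xi> k) + Im (\<xi> i) * Im (\<xi> k)"
  define a b where "a = Re (\<xi> i) * Re (\<xi> j) + Im (\<xi> i) * Im (\<xi> j)"
    and "b = Re (\<xi> k) * Re (\<xi> j) + Im (\<xi> k) * Im (\<xi> j)"
  have "a = \<alpha> * (Re (\<xi> i) ^ 2 + Im (\<xi> i) ^ 2) + \<beta> * s" "b = \<alpha> * s + \<beta> * (Re (\<xi> k) ^ 2 + Im (\<xi> k) ^ 2)"
    unfolding a_def b_def s_def e(1) by (simp_all add: power2_eq_square algebra_simps)
  then have "a + b = (\<alpha> + \<beta>) * (1 + s)" unfolding n by (simp add: algebra_simps)
  moreover have "0 \<le> (Re (\<xi> i) + Re (\<xi> k))^2 + (Im (\<xi> i) + Im (\<xi> k))^2" by simp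
  then have "0 \<le> 2 + 2 * s" using n unfolding s_def by (simp add: power2_eq_square algebra_simps)
  ultimately have "1 + s \<le> a + b" using e(2) mult_right_mono[of 1 "\<alpha> + \<beta>" "1 + s"] by simp
  moreover have "norm (\<xi> i + \<xi> k - \<xi> j) ^ 2 = 3 + 2 * s - 2 * a - 2 * b"
    unfolding cmod_power2 s_def a_def b_def using n by (simp add: power2_eq_square algebra_simps)
  ultimately have "norm (\<xi> i + \<xi> k - \<xi> j) ^ 2 \<le> 1" by simp
  then show ?thesis by (simp add: power_le_one_iff abs_square_le_1)
qed

lemma pt_insert: "X \<subseteq> {1..n} \<Longrightarrow> i \<notin> X \<Longrightarrow> pt \<xi> (insert i X) = pt \<xi> X + \<xi> i"
  unfolding pt_def using finite_subset[of X "{1..n}"] by (simp add: add.commute)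

lemma pt_remove: "X \<subseteq> {1..n} \<Longrightarrow> i \<in> X \<Longrightarrow> pt \<xi> (X - {i}) = pt \<xi> X - \<xi> i"
  unfolding pt_def using finite_subset[of X "{1..n}"] by (simp add: sum_diff1)

lemma pt_inject:
  assumes "X \<subseteq> {1..n}" "Y \<subseteq> {1..n}"
  shows "pt \<xi> X = pt \<xi> Y \<longleftrightarrow> X = Y"
proof
  assume eq: "pt \<xi> X = pt \<xi> Y"
  define c :: "nat \<Rightarrow> int" where "c i = of_bool (i \<in> X) - of_bool (i \<in> Y)" for i
  have *: "(\<Sum>i\<in>{1..n}. of_int (of_bool (i \<in> Z)) * \<xi> i) = pt \<xi> Z" if "Z \<subseteq> {1..n}" for Z
  proof -
    have "(\<Sum>i\<in>{1..n}. of_int (of_bool (i \<in> Z)) * \<xi> i) = (\<Sum>i\<in>{1..n}. if i \<in> Z then \<xi> i else 0)"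
      by (intro sum.cong) auto
    also have "\<dots> = pt \<xi> Z" unfolding pt_def using that by (simp add: sum.inter_restrict[symmetric] Int_absorb1)
    finally show ?thesis .
  qed
  have "(\<Sum>i\<in>{1..n}. of_int (c i) * \<xi> i) = pt \<xi> X - pt \<xi> Y"
    unfolding c_def of_int_diff left_diff_distrib sum_subtractf using *[OF assms(1)] *[OF assms(2)] by simp
  then have "\<forall>i\<in>{1..n}. c i = 0" using gen eq unfolding zonogon_generators_def by simp
  then show "X = Y" using assms unfolding c_def by (auto split: if_splits simp: of_bool_def)
qed simp

lemma tri_left:
  "tri {1..n} (A, B, C) \<Longrightarrow> cross (pt \<xi> B - pt \<xi> A) (pt \<xi> C - pt \<xi> A) > 0"
proof (induction "(A, B, C)" arbitrary: A B C rule: tri.induct)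
  case (nabla X i j)
  then show ?case using cross_generators[of i j] by (simp add: pt_insert)
next
  case (delta X i j)
  then have "cross (\<xi> j - \<xi> i) (\<xi> j) > 0"
    using cross_generators[of i j] by (simp add: cross_diff_left cross_self cross_skew[of "\<xi> i"])
  then show ?case using delta by (simp add: pt_insert)
next
  case (upper X i j k)
  then show ?case using cross_three_generators[of i j k] by (simp add: pt_insert)
next
  case (lower X i j k)
  have "cross (\<xi> k - \<xi> j) (\<xi> k - \<xi> i) = cross (\<xi> k - \<xi> i) (\<xi> j - \<xi> i)"
    by (simp add: cross_def algebra_simps)
  then have "cross (\<xi> k - \<xi> j) (\<xi> k - \<xi> i) > 0" using cross_three_generators[of i j k] lower by simp
  then show ?case using lower by (simp add: pt_insert algebra_simps)
next
  case (rot A B C)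
  then show ?case using cross_triangle_rotate[of "pt \<xi> B" "pt \<xi> A" "pt \<xi> C"] by simp
qed

text \<open>Sides oriented counterclockwise. One point strictly to the left is enough, since a
  convex set lies on one side of its edge.\<close>

definition sides :: "complex set \<Rightarrow> (nat set \<times> nat set) set" where
  "sides P = {(A, B). A \<subseteq> {1..n} \<and> B \<subseteq> {1..n} \<and> closed_segment (pt \<xi> A) (pt \<xi> B) edge_of P \<and>
     (\<exists>z\<in>P. cross (pt \<xi> B - pt \<xi> A) (z - pt \<xi> A) > 0)}"

text \<open>All that is remembered of a tile. Only \<open>L \<subseteq> sides P\<close> and the
  covering of the frontier are asked for; that \<open>L\<close> contains every side follows in
  \<open>sides_eq\<close>.\<close>

definition triangulates :: "complex set \<Rightarrow> (nat set \<times> nat set) set \<Rightarrow>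
    (nat set \<times> nat set \<times> nat set) multiset \<Rightarrow> bool" where
  "triangulates P L M \<longleftrightarrow> convex P \<and> compact P \<and> interior P \<noteq> {} \<and> L \<subseteq> sides P \<and> finite L \<and>
     frontier P \<subseteq> (\<Union>(A, B)\<in>L. closed_segment (pt \<xi> A) (pt \<xi> B)) \<and>
     (\<forall>T\<in>#M. tri {1..n} T) \<and>
     (\<forall>f. antisymmetric f \<longrightarrow> (\<Sum>T\<in>#M. coboundary f T) = (\<Sum>(A, B)\<in>L. f A B)) \<and>
     (\<Union>T\<in>set_mset M. corners T) = {X. X \<subseteq> {1..n} \<and> pt \<xi> X extreme_point_of P}"

lemma triangle_triangulates:
  assumes T: "tri {1..n} (A, B, C)"
  shows "triangulates (convex hull {pt \<xi> A, pt \<xi> B, pt \<xi> C}) {(A, B), (B, C), (C, A)} {#(A, B, C)#}"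
proof -
  let ?P = "convex hull {pt \<xi> A, pt \<xi> B, pt \<xi> C}"
  have sub: "A \<subseteq> {1..n}" "B \<subseteq> {1..n}" "C \<subseteq> {1..n}" using tri_corners_subset[OF T] by auto
  have l: "cross (pt \<xi> B - pt \<xi> A) (pt \<xi> C - pt \<xi> A) > 0"
    "cross (pt \<xi> C - pt \<xi> B) (pt \<xi> A - pt \<xi> B) > 0"
    "cross (pt \<xi> A - pt \<xi> C) (pt \<xi> B - pt \<xi> C) > 0"
    using tri_left[OF T] tri_left[OF tri.rot[OF T]] tri_left[OF tri.rot[OF tri.rot[OF T]]] by auto
  have hull: "{pt \<xi> B, pt \<xi> C, pt \<xi> A} = {pt \<xi> A, pt \<xi> B, pt \<xi> C}"
    "{pt \<xi> C, pt \<xi> A, pt \<xi> B} = {pt \<xi> A, pt \<xi> B, pt \<xi> C}" by auto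
  have inP: "pt \<xi> A \<in> ?P" "pt \<xi> B \<in> ?P" "pt \<xi> C \<in> ?P" by (auto intro: hull_inc)
  have "{(A, B), (B, C), (C, A)} \<subseteq> sides ?P"
    using triangle_edge[OF l(1)] triangle_edge[OF l(2)] triangle_edge[OF l(3)] l inP sub
    unfolding sides_def hull by blast
  moreover have "interior ?P \<noteq> {}" using interior_triangle_nonempty l(1) by simp
  moreover have "frontier ?P \<subseteq> (\<Union>(A, B)\<in>{(A, B), (B, C), (C, A)}. closed_segment (pt \<xi> A) (pt \<xi> B))"
    by (subst frontier_of_triangle) auto
  moreover have "(\<Sum>(A, B)\<in>{(A, B), (B, C), (C, A)}. f A B) = f A B + f B C + f C A"
    for f :: "nat set \<Rightarrow> nat set \<Rightarrow> int"
    using tri_nondegenerate[OF T] by auto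
  moreover have "corners (A, B, C) = {X. X \<subseteq> {1..n} \<and> pt \<xi> X extreme_point_of ?P}"
    unfolding triangle_extreme_points[OF l(1)] using sub pt_inject by auto
  moreover have "compact ?P" by (simp add: compact_convex_hull finite_imp_compact)
  ultimately show ?thesis unfolding triangulates_def using T by simp
qed

lemma lens_triangulates:
  assumes lens: "lens n \<xi> P" and edges: "\<And>e. e edge_of P \<Longrightarrow> \<exists>a b. e = closed_segment a b"
  shows "\<exists>L M. triangulates P L M"
proof -
  obtain X Y us vs where X: "X \<subseteq> {1..n}" and Y: "Y \<subseteq> {1..n}"
    and us: "set us \<subseteq> {1..n} - X" "sorted_wrt (<) us" "length us \<ge> 3"
    and vs: "set vs \<subseteq> Y" "sorted_wrt (>) vs" "length vs \<ge> 3"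
    and ends: "insert (hd us) X = Y - {hd vs}" "insert (last us) X = Y - {last vs}"
    and P: "P = convex hull (set (map (\<lambda>i. pt \<xi> (insert i X)) us) \<union> set (map (\<lambda>j. pt \<xi> (Y - {j})) vs))"
    and fr: "frontier P = polyline (map (\<lambda>i. pt \<xi> (insert i X)) us) \<union> polyline (map (\<lambda>j. pt \<xi> (Y - {j})) vs)"
    using lens unfolding lens_def Let_def by blast
  define q r where "q = length us - 1" and "r = length vs - 1"
  have q: "length us = Suc q" "q \<ge> 2" and r: "length vs = Suc r" "r \<ge> 2" using us(3) vs(3) by (auto simp: q_def r_def)
  define u v where "u k = insert (us ! k) X" and "v k = Y - {vs ! k}" for k
  have us_lt: "us ! k < us ! l" if "k < l" "l \<le> q" for k l
    using sorted_wrt_nth_less[OF us(2)] that q by simp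
  have vs_lt: "vs ! l < vs ! k" if "k < l" "l \<le> r" for k l
    using sorted_wrt_nth_less[OF vs(2)] that r by simp
  have us_in: "us ! k \<in> {1..n} - X" if "k \<le> q" for k
    using subsetD[OF us(1) nth_mem[of k us]] q that by simp
  have vs_in: "vs ! k \<in> Y" if "k \<le> r" for k
    using subsetD[OF vs(1) nth_mem[of k vs]] r that by simp
  have ne: "us \<noteq> []" "vs \<noteq> []" using q r by auto
  have ends': "insert (us ! 0) X = Y - {vs ! 0}" "insert (us ! q) X = Y - {vs ! r}"
    using ends q r ne by (auto simp: hd_conv_nth last_conv_nth)
  have i0q: "us ! 0 < us ! q" using us_lt q by simp
  \<comment> \<open>The common ends of the two paths force \<open>vs ! 0 = us ! q\<close> and
    \<open>vs ! r = us ! 0\<close>, so \<open>Y\<close> is \<open>X\<close> with the two outer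
    indices added.\<close>
  have "us ! q \<in> Y" using ends'(2) by blast
  moreover have "us ! q \<notin> Y - {vs ! 0}" unfolding ends'(1)[symmetric] using i0q us_in[of q] by simp
  ultimately have j0: "vs ! 0 = us ! q" by simp
  have "us ! 0 \<in> Y" using ends'(1) by blast
  moreover have "us ! 0 \<notin> Y - {vs ! r}" unfolding ends'(2)[symmetric] using i0q us_in[of 0] by simp
  ultimately have jr: "vs ! r = us ! 0" by simp
  have YX: "Y = insert (us ! q) (insert (us ! 0) X)"
    unfolding ends'(1) j0 using \<open>us ! q \<in> Y\<close> by auto
  have u_sub: "u k \<subseteq> {1..n}" if "k \<le> q" for k using us_in[OF that] X by (auto simp: u_def)
  have v_sub: "v k \<subseteq> {1..n}" for k using Y by (auto simp: v_def)
  have uv: "u 0 = v 0" "u q = v r" using ends' by (auto simp: u_def v_def)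
  have pu: "pt \<xi> (u k) = pt \<xi> X + \<xi> (us ! k)" if "k \<le> q" for k
    using us_in[OF that] X by (simp add: u_def pt_insert)
  have pv: "pt \<xi> (v k) = pt \<xi> Y - \<xi> (vs ! k)" if "k \<le> r" for k
    using vs_in[OF that] Y by (simp add: v_def pt_remove)
  have pY: "pt \<xi> Y = pt \<xi> X + \<xi> (us ! 0) + \<xi> (us ! q)"
    unfolding YX using us_in[of 0] us_in[of q] i0q X by (subst pt_insert; auto simp: pt_insert)
  have upper_set: "set (map (\<lambda>i. pt \<xi> (insert i X)) us) = (\<lambda>k. pt \<xi> (u k)) ` {..q}"
    unfolding set_map nth_image_atMost[OF q(1)] image_image u_def ..
  have lower_set: "set (map (\<lambda>j. pt \<xi> (Y - {j})) vs) = (\<lambda>k. pt \<xi> (v k)) ` {..r}"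
    unfolding set_map nth_image_atMost[OF r(1)] image_image v_def ..
  let ?S = "(\<lambda>k. pt \<xi> (u k)) ` {..q} \<union> (\<lambda>k. pt \<xi> (v k)) ` {..r}"
  have PS: "P = convex hull ?S" unfolding P upper_set lower_set ..
  have upper_poly: "polyline (map (\<lambda>i. pt \<xi> (insert i X)) us) =
      (\<Union>k<q. closed_segment (pt \<xi> (u k)) (pt \<xi> (u (Suc k))))"
    unfolding polyline_def u_def using q by (intro SUP_cong) auto
  have lower_poly: "polyline (map (\<lambda>j. pt \<xi> (Y - {j})) vs) =
      (\<Union>k<r. closed_segment (pt \<xi> (v k)) (pt \<xi> (v (Suc k))))"
    unfolding polyline_def v_def using r by (intro SUP_cong) auto
  have inP: "k \<le> q \<Longrightarrow> pt \<xi> (u k) \<in> P" "k \<le> r \<Longrightarrow> pt \<xi> (v k) \<in> P" for k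
    unfolding PS by (auto intro!: hull_inc)
  have small: "norm (\<xi> (us ! 0) + \<xi> (us ! q) - \<xi> j) \<le> 1"
    if "us ! 0 \<le> j" "j \<le> us ! q" for j
  proof -
    have g: "us ! 0 \<in> {1..n}" "us ! q \<in> {1..n}" using us_in[of 0] us_in[of q] by auto
    show ?thesis
    proof (cases "j = us ! 0 \<or> j = us ! q")
      case True
      then show ?thesis using norm_generator[OF g(1)] norm_generator[OF g(2)] by auto
    next
      case False
      then show ?thesis using norm_three_generators[of "us ! 0" j "us ! q"] g that by auto
    qed
  qed
  have us_range: "us ! 0 \<le> us ! k" "us ! k \<le> us ! q" if "k \<le> q" for k
    using us_lt[of 0 k] us_lt[of k q] that le_neq_implies_less[of k q]
    by (metis gr0I le_refl less_imp_le order.refl)+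
  have vs_range: "us ! 0 \<le> vs ! k" "vs ! k \<le> us ! q" if "k \<le> r" for k
    using vs_lt[of 0 k] vs_lt[of k r] that le_neq_implies_less[of k r] unfolding j0[symmetric] jr[symmetric]
    by (metis gr0I le_refl less_imp_le order.refl)+
  \<comment> \<open>The lens lies in the unit discs about \<open>pt \<xi> X\<close> and
    \<open>pt \<xi> Y\<close>. The upper points are on the first circle and the lower points on the
    second, so all of them are extreme.\<close>
  have "dist (pt \<xi> X) (pt \<xi> (u k)) \<le> 1" if "k \<le> q" for k
    using us_in[OF that] norm_generator by (simp add: pu[OF that] dist_norm)
  moreover have "dist (pt \<xi> X) (pt \<xi> (v k)) \<le> 1" if "k \<le> r" for k
  proof -
    have "pt \<xi> (v k) - pt \<xi> X = \<xi> (us ! 0) + \<xi> (us ! q) - \<xi> (vs ! k)"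
      by (simp add: pv[OF that] pY)
    then show ?thesis using small[OF vs_range[OF that]] by (metis dist_commute dist_norm)
  qed
  ultimately have "?S \<subseteq> cball (pt \<xi> X) 1" by auto
  then have inX: "P \<subseteq> cball (pt \<xi> X) 1" unfolding PS by (intro hull_minimal) auto
  have "dist (pt \<xi> Y) (pt \<xi> (v k)) \<le> 1" if "k \<le> r" for k
    using vs_in[OF that] Y norm_generator by (auto simp: pv[OF that] dist_norm)
  moreover have "dist (pt \<xi> Y) (pt \<xi> (u k)) \<le> 1" if "k \<le> q" for k
  proof -
    have "pt \<xi> Y - pt \<xi> (u k) = \<xi> (us ! 0) + \<xi> (us ! q) - \<xi> (us ! k)"
      by (simp add: pu[OF that] pY)
    then show ?thesis using small[OF us_range[OF that]] by (simp add: dist_norm)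
  qed
  ultimately have "?S \<subseteq> cball (pt \<xi> Y) 1" by auto
  then have inY: "P \<subseteq> cball (pt \<xi> Y) 1" unfolding PS by (intro hull_minimal) auto
  have ext_u: "pt \<xi> (u k) extreme_point_of P" if "k \<le> q" for k
    using extreme_point_on_sphere[OF inX inP(1)[OF that]] us_in[OF that] norm_generator
    by (simp add: pu[OF that] dist_norm)
  have ext_v: "pt \<xi> (v k) extreme_point_of P" if "k \<le> r" for k
    using extreme_point_on_sphere[OF inY inP(2)[OF that]] vs_in[OF that] Y norm_generator
    by (auto simp: pv[OF that] dist_norm)
  have tri_u: "tri {1..n} (u a, u c, u b)" if "a < b" "b < c" "c \<le> q" for a b c
    unfolding u_def using X us_in[of a] us_in[of b] us_in[of c] us_lt[of a b] us_lt[of b c] that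
    by (intro tri.upper) auto
  have tri_v: "tri {1..n} (v a, v b, v c)" if "a < b" "b < c" "c \<le> r" for a b c
  proof -
    let ?X = "Y - {vs ! a, vs ! b, vs ! c}"
    have lt: "vs ! c < vs ! b" "vs ! b < vs ! a" using vs_lt that by auto
    have inY: "vs ! a \<in> Y" "vs ! b \<in> Y" "vs ! c \<in> Y" using vs_in that by auto
    have "tri {1..n} (insert (vs ! c) (insert (vs ! b) ?X), insert (vs ! c) (insert (vs ! a) ?X),
        insert (vs ! b) (insert (vs ! a) ?X))"
      using lt inY Y by (intro tri.lower) auto
    moreover have "insert (vs ! c) (insert (vs ! b) ?X) = v a" "insert (vs ! c) (insert (vs ! a) ?X) = v b"
      "insert (vs ! b) (insert (vs ! a) ?X) = v c"
      unfolding v_def using lt inY by auto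
    ultimately show ?thesis by simp
  qed
  have convP: "convex P" unfolding PS by simp
  have compP: "compact P" unfolding PS by (simp add: compact_convex_hull finite_imp_compact)
  have intP: "interior P \<noteq> {}"
  proof -
    have "convex hull {pt \<xi> (u 0), pt \<xi> (u 2), pt \<xi> (u 1)} \<subseteq> P"
      using inP(1)[of 0] inP(1)[of 1] inP(1)[of 2] q(2) convP by (intro hull_minimal) auto
    moreover have "interior (convex hull {pt \<xi> (u 0), pt \<xi> (u 2), pt \<xi> (u 1)}) \<noteq> {}"
      using tri_left[OF tri_u[of 0 1 2]] q(2) by (intro interior_triangle_nonempty) auto
    ultimately show ?thesis using interior_mono by blast
  qed
  have upper_side: "(u (Suc k), u k) \<in> sides P" if k: "k < q" for k
  proof -
    \<comment> \<open>A third vertex of the same path shows on which side of the segment the lens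
      lies.\<close>
    have "\<exists>l\<le>q. tri {1..n} (u (Suc k), u k, u l)"
    proof (cases "k = 0")
      case True
      then show ?thesis using tri.rot[OF tri.rot[OF tri_u[of 0 1 2]]] q by auto
    next
      case False
      then show ?thesis using tri.rot[OF tri_u[of 0 k "Suc k"]] k by auto
    qed
    then obtain l where l: "l \<le> q" "tri {1..n} (u (Suc k), u k, u l)" by blast
    have "pt \<xi> (u (Suc k)) \<noteq> pt \<xi> (u k)" using cross_pos_neq[OF tri_left[OF l(2)]] .
    moreover have "closed_segment (pt \<xi> (u (Suc k))) (pt \<xi> (u k)) \<subseteq> frontier P"
      unfolding fr upper_poly using k by (auto simp: closed_segment_commute)
    ultimately have "closed_segment (pt \<xi> (u (Suc k))) (pt \<xi> (u k)) edge_of P"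
      using ext_u k by (intro edge_of_frontier_segment[OF convP compP intP _ _ _ _ edges]) auto
    then show ?thesis unfolding sides_def using u_sub k tri_left[OF l(2)] inP(1)[OF l(1)] by auto
  qed
  have lower_side: "(v k, v (Suc k)) \<in> sides P" if k: "k < r" for k
  proof -
    have "\<exists>l\<le>r. tri {1..n} (v k, v (Suc k), v l)"
    proof (cases "k = 0")
      case True
      then show ?thesis using tri_v[of 0 1 2] r by auto
    next
      case False
      then show ?thesis using tri.rot[OF tri_v[of 0 k "Suc k"]] k by auto
    qed
    then obtain l where l: "l \<le> r" "tri {1..n} (v k, v (Suc k), v l)" by blast
    have "pt \<xi> (v k) \<noteq> pt \<xi> (v (Suc k))" using cross_pos_neq[OF tri_left[OF l(2)]] .
    moreover have "closed_segment (pt \<xi> (v k)) (pt \<xi> (v (Suc k))) \<subseteq> frontier P"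
      unfolding fr lower_poly using k by auto
    ultimately have "closed_segment (pt \<xi> (v k)) (pt \<xi> (v (Suc k))) edge_of P"
      using ext_v k by (intro edge_of_frontier_segment[OF convP compP intP _ _ _ _ edges]) auto
    then show ?thesis unfolding sides_def using v_sub k tri_left[OF l(2)] inP(2)[OF l(1)] by auto
  qed
  \<comment> \<open>Index 0 is the left end, so counterclockwise the lower path is run forwards and
    the upper path backwards. Both fans have their apex at this end.\<close>
  define Lu and Ll where "Lu = (\<lambda>k. (u (Suc k), u k)) ` {..<q}" and "Ll = (\<lambda>k. (v k, v (Suc k))) ` {..<r}"
  define Mu and Ml where "Mu = (\<Sum>k\<in>{1..<q}. {#(u 0, u (Suc k), u k)#})"
    and "Ml = (\<Sum>k\<in>{1..<r}. {#(v 0, v k, v (Suc k))#})"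
  have u_eq: "u k = u l \<longleftrightarrow> us ! k = us ! l" if "k \<le> q" "l \<le> q" for k l
    using us_in[OF that(1)] us_in[OF that(2)] unfolding u_def by (metis DiffD2 insert_iff)
  have v_eq: "v k = v l \<longleftrightarrow> vs ! k = vs ! l" if "k \<le> r" "l \<le> r" for k l
    using vs_in[OF that(1)] vs_in[OF that(2)] unfolding v_def by (metis DiffE DiffI singletonD singletonI)
  have u_inj: "k = l" if "u k = u l" "k \<le> q" "l \<le> q" for k l
    using that u_eq us_lt[of k l] us_lt[of l k] by (metis less_irrefl linorder_neqE_nat)
  have v_inj: "k = l" if "v k = v l" "k \<le> r" "l \<le> r" for k l
    using that v_eq vs_lt[of k l] vs_lt[of l k] by (metis less_irrefl linorder_neqE_nat)
  \<comment> \<open>A common ordered pair would identify \<open>us ! Suc k\<close> with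
    \<open>vs ! Suc l\<close> and \<open>us ! k\<close> with \<open>vs ! l\<close>, but
    \<open>us\<close> increases and \<open>vs\<close> decreases.\<close>
  have disj: "Lu \<inter> Ll = {}"
  proof -
    have False if "u (Suc k) = v l" "u k = v (Suc l)" "k < q" "l < r" for k l
    proof -
      have lt: "us ! k < us ! Suc k" "vs ! Suc l < vs ! l" using us_lt vs_lt that by auto
      have "us ! Suc k \<in> v l - v (Suc l)" "us ! k \<in> v (Suc l) - v l"
        using that lt us_in[of k] us_in[of "Suc k"] by (auto simp: u_def simp flip: that(1,2))
      then have "us ! Suc k = vs ! Suc l" "us ! k = vs ! l" by (auto simp: v_def)
      then show False using lt by simp
    qed
    then show ?thesis unfolding Lu_def Ll_def by auto
  qed
  have "(\<Sum>T\<in>#Mu + Ml. coboundary f T) = (\<Sum>(A, B)\<in>Lu \<union> Ll. f A B)" if f: "antisymmetric f"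
    for f :: "nat set \<Rightarrow> nat set \<Rightarrow> int"
  proof -
    \<comment> \<open>The diagonals from \<open>u 0\<close> telescope. What remains is the chord
      from \<open>u 0\<close> to \<open>u q\<close>, which the lower fan contributes with the
      opposite sign.\<close>
    have "(\<Sum>T\<in>#Mu. coboundary f T) = (\<Sum>k\<in>{1..<q}. f (u (Suc k)) (u k) + (f (u 0) (u (Suc k)) - f (u 0) (u k)))"
      unfolding Mu_def using antisymmetricD[OF f, of "u _" "u 0"]
      by (simp add: sum_mset_sum algebra_simps)
    also have "\<dots> = (\<Sum>k\<in>{1..<q}. f (u (Suc k)) (u k)) + (f (u 0) (u q) - f (u 0) (u 1))"
      unfolding sum.distrib using sum_Suc_diff'[of 1 q "\<lambda>k. f (u 0) (u k)"] q by simp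
    also have "\<dots> = (\<Sum>k\<in>{0..<q}. f (u (Suc k)) (u k)) + f (u 0) (u q)"
      using q(2) antisymmetricD[OF f, of "u 1" "u 0"] by (simp add: sum.atLeast_Suc_lessThan[of 0 q])
    finally have 1: "(\<Sum>T\<in>#Mu. coboundary f T) = (\<Sum>k<q. f (u (Suc k)) (u k)) + f (u 0) (u q)"
      by (simp add: atLeast0LessThan)
    have "(\<Sum>T\<in>#Ml. coboundary f T) = (\<Sum>k\<in>{1..<r}. f (v k) (v (Suc k)) - (f (v 0) (v (Suc k)) - f (v 0) (v k)))"
      unfolding Ml_def using antisymmetricD[OF f, of "v _" "v 0"]
      by (simp add: sum_mset_sum algebra_simps)
    also have "\<dots> = (\<Sum>k\<in>{1..<r}. f (v k) (v (Suc k))) - (f (v 0) (v r) - f (v 0) (v 1))"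
      unfolding sum_subtractf[of "\<lambda>k. f (v k) (v (Suc k))"] using sum_Suc_diff'[of 1 r "\<lambda>k. f (v 0) (v k)"] r by simp
    also have "\<dots> = (\<Sum>k\<in>{0..<r}. f (v k) (v (Suc k))) - f (v 0) (v r)"
      using r(2) by (simp add: sum.atLeast_Suc_lessThan[of 0 r])
    finally have 2: "(\<Sum>T\<in>#Ml. coboundary f T) = (\<Sum>k<r. f (v k) (v (Suc k))) - f (v 0) (v r)"
      by (simp add: atLeast0LessThan)
    have "inj_on (\<lambda>k. (u (Suc k), u k)) {..<q}" using u_inj by (auto simp: inj_on_def)
    then have 3: "(\<Sum>(A, B)\<in>Lu. f A B) = (\<Sum>k<q. f (u (Suc k)) (u k))"
      unfolding Lu_def by (simp add: sum.reindex)
    have "inj_on (\<lambda>k. (v k, v (Suc k))) {..<r}" using v_inj by (auto simp: inj_on_def)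
    then have 4: "(\<Sum>(A, B)\<in>Ll. f A B) = (\<Sum>k<r. f (v k) (v (Suc k)))"
      unfolding Ll_def by (simp add: sum.reindex)
    have "(\<Sum>(A, B)\<in>Lu \<union> Ll. f A B) = (\<Sum>(A, B)\<in>Lu. f A B) + (\<Sum>(A, B)\<in>Ll. f A B)"
      using disj by (intro sum.union_disjoint) (auto simp: Lu_def Ll_def)
    then show ?thesis using 1 2 3 4 uv by simp
  qed
  moreover have "tri {1..n} T" if "T \<in># Mu + Ml" for T
    using that tri_u tri_v by (auto simp: Mu_def Ml_def set_mset_sum)
  moreover have "(\<Union>T\<in>set_mset (Mu + Ml). corners T) = u ` {..q} \<union> v ` {..r}"
  proof -
    have fan: "(\<Union>k\<in>{1..<m}. {w 0, w (Suc k), w k}) = w ` {..m}" if "m \<ge> 2" for m and w :: "nat \<Rightarrow> nat set"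
    proof (intro equalityI subsetI)
      fix x assume "x \<in> w ` {..m}"
      then obtain k where k: "k \<le> m" "x = w k" by auto
      consider "k \<le> 1" | "k > 1" by linarith
      then show "x \<in> (\<Union>k\<in>{1..<m}. {w 0, w (Suc k), w k})"
      proof cases
        case 1
        then show ?thesis using k that by (intro UN_I[of 1]) (auto simp: le_Suc_eq)
      next
        case 2
        then show ?thesis using k by (intro UN_I[of "k - 1"]) auto
      qed
    qed (use that in auto)
    have "(\<Union>T\<in>set_mset Mu. corners T) = (\<Union>k\<in>{1..<q}. {u 0, u (Suc k), u k})"
      by (auto simp: Mu_def set_mset_sum)
    moreover have "(\<Union>T\<in>set_mset Ml. corners T) = (\<Union>k\<in>{1..<r}. {v 0, v (Suc k), v k})"
      by (auto simp: Ml_def set_mset_sum)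
    ultimately show ?thesis using fan[OF q(2), of u] fan[OF r(2), of v] by simp
  qed
  moreover have "u ` {..q} \<union> v ` {..r} = {Z. Z \<subseteq> {1..n} \<and> pt \<xi> Z extreme_point_of P}"
  proof (intro equalityI subsetI)
    fix Z assume Z: "Z \<in> {Z. Z \<subseteq> {1..n} \<and> pt \<xi> Z extreme_point_of P}"
    then have "pt \<xi> Z \<in> ?S" unfolding PS using extreme_point_of_convex_hull by blast
    then show "Z \<in> u ` {..q} \<union> v ` {..r}" using Z pt_inject u_sub v_sub by auto
  next
    fix Z assume "Z \<in> u ` {..q} \<union> v ` {..r}"
    then consider k where "k \<le> q" "Z = u k" | k where "k \<le> r" "Z = v k" by auto
    then show "Z \<in> {Z. Z \<subseteq> {1..n} \<and> pt \<xi> Z extreme_point_of P}"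
      using ext_u ext_v u_sub v_sub by cases blast+
  qed
  moreover have "frontier P \<subseteq> (\<Union>(A, B)\<in>Lu \<union> Ll. closed_segment (pt \<xi> A) (pt \<xi> B))"
    unfolding fr upper_poly lower_poly Lu_def Ll_def by (auto simp: closed_segment_commute)
  moreover have "Lu \<union> Ll \<subseteq> sides P" "finite (Lu \<union> Ll)"
    using upper_side lower_side by (auto simp: Lu_def Ll_def)
  ultimately have "triangulates P (Lu \<union> Ll) (Mu + Ml)"
    unfolding triangulates_def using convP compP intP by simp
  then show ?thesis by blast
qed

end

context zonogon_frame
begin

lemma sides_subset: "(A, B) \<in> sides P \<Longrightarrow> A \<subseteq> {1..n} \<and> B \<subseteq> {1..n}"
  unfolding sides_def by blast

lemma sides_edge: "(A, B) \<in> sides P \<Longrightarrow> closed_segment (pt \<xi> A) (pt \<xi> B) edge_of P"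
  unfolding sides_def by blast

lemma sides_witness:
  "(A, B) \<in> sides P \<Longrightarrow> \<exists>z\<in>P. cross (pt \<xi> B - pt \<xi> A) (z - pt \<xi> A) > 0"
  unfolding sides_def by blast

lemma sides_ends: "(A, B) \<in> sides P \<Longrightarrow> pt \<xi> A \<in> P \<and> pt \<xi> B \<in> P"
  using edge_of_imp_subset[OF sides_edge] by fastforce

lemma sides_left:
  assumes "convex P" "(A, B) \<in> sides P" "y \<in> P"
  shows "cross (pt \<xi> B - pt \<xi> A) (y - pt \<xi> A) \<ge> 0"
proof -
  obtain z where "z \<in> P" "cross (pt \<xi> B - pt \<xi> A) (z - pt \<xi> A) > 0"
    using sides_witness[OF assms(2)] by blast
  then show ?thesis
    using face_segment_one_side[OF assms(1) _ _ _ assms(3)] sides_edge[OF assms(2)]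
    unfolding edge_of_def by blast
qed

lemma sides_asym:
  assumes "convex P" "(A, B) \<in> sides P"
  shows "(B, A) \<notin> sides P"
proof
  assume "(B, A) \<in> sides P"
  obtain z where z: "z \<in> P" "cross (pt \<xi> B - pt \<xi> A) (z - pt \<xi> A) > 0"
    using sides_witness[OF assms(2)] by blast
  then show False using sides_left[OF assms(1) \<open>(B, A) \<in> sides P\<close> z(1)] cross_flip[of "pt \<xi> A" "pt \<xi> B" z] by simp
qed

text \<open>The midpoint of any side is on the frontier, hence on a listed side. Two edges that
  share a midpoint of one of them coincide, and the position of the tile fixes the
  orientation.\<close>

lemma sides_eq:
  assumes t: "triangulates P L M"
  shows "sides P = L"
proof
  show "L \<subseteq> sides P" using t unfolding triangulates_def by simp
  show "sides P \<subseteq> L"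
  proof
    fix e assume e: "e \<in> sides P"
    obtain A B where AB: "e = (A, B)" by (cases e)
    note s = e[unfolded AB]
    have P: "convex P" "compact P" and LP: "L \<subseteq> sides P"
      and fr: "frontier P \<subseteq> (\<Union>(A, B)\<in>L. closed_segment (pt \<xi> A) (pt \<xi> B))"
      using t unfolding triangulates_def by auto
    let ?e = "closed_segment (pt \<xi> A) (pt \<xi> B)"
    let ?m = "midpoint (pt \<xi> A) (pt \<xi> B)"
    have edge: "?e edge_of P" using sides_edge[OF s] .
    obtain z where z: "z \<in> P" "cross (pt \<xi> B - pt \<xi> A) (z - pt \<xi> A) > 0"
      using sides_witness[OF s] by blast
    then have "?e \<noteq> P" using cross_closed_segment[of z "pt \<xi> A" "pt \<xi> B"] by auto
    then have "?e \<inter> interior P = {}" using face_of_disjoint_interior edge unfolding edge_of_def by blast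
    moreover have m: "?m \<in> ?e" by simp
    ultimately have "?m \<notin> interior P" by blast
    moreover have "?m \<in> P" using m edge_of_imp_subset[OF edge] by blast
    ultimately have "?m \<in> frontier P" using compact_imp_closed[OF P(2)] by (simp add: frontier_def)
    then obtain C D where CD: "(C, D) \<in> L" "?m \<in> closed_segment (pt \<xi> C) (pt \<xi> D)" using fr by auto
    have CDs: "(C, D) \<in> sides P" using CD LP by blast
    have "closed_segment (pt \<xi> C) (pt \<xi> D) = ?e"
      using face_of_in_rel_interior[OF P(1) edge sides_edge[OF CDs] CD(2)] .
    then have "{pt \<xi> C, pt \<xi> D} = {pt \<xi> A, pt \<xi> B}" by simp
    then have "(A, B) = (C, D) \<or> (A, B) = (D, C)"
      using sides_subset[OF s] sides_subset[OF CDs] by (auto simp: doubleton_eq_iff pt_inject)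
    then show "e \<in> L" using CD(1) sides_asym[OF P(1) CDs] s unfolding AB by auto
  qed
qed

subsection \<open>The boundary of the zonogon\<close>

definition boundary_sides :: "(nat set \<times> nat set) set" where
  "boundary_sides = (\<lambda>k. ({Suc k..n}, {k..n})) ` {1..n} \<union> (\<lambda>k. ({1..k}, {1..<k})) ` {1..n}"

lemma convex_zonogon: "convex (zonogon n \<xi>)"
proof (rule convexI)
  fix x y and s t :: real assume "x \<in> zonogon n \<xi>" "y \<in> zonogon n \<xi>" and st: "0 \<le> s" "0 \<le> t" "s + t = 1"
  then obtain l m where l: "x = (\<Sum>i\<in>{1..n}. l i *\<^sub>R \<xi> i)" "\<forall>i\<in>{1..n}. 0 \<le> l i \<and> l i \<le> 1"
    and m: "y = (\<Sum>i\<in>{1..n}. m i *\<^sub>R \<xi> i)" "\<forall>i\<in>{1..n}. 0 \<le> m i \<and> m i \<le> 1"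
    unfolding zonogon_def by auto
  have "s *\<^sub>R x + t *\<^sub>R y = (\<Sum>i\<in>{1..n}. (s * l i + t * m i) *\<^sub>R \<xi> i)"
    unfolding l m by (simp add: scaleR_sum_right sum.distrib scaleR_add_left)
  moreover have "\<forall>i\<in>{1..n}. 0 \<le> s * l i + t * m i \<and> s * l i + t * m i \<le> 1"
  proof
    fix i assume i: "i \<in> {1..n}"
    have "s * l i + t * m i \<le> s * 1 + t * 1" using l m i st by (intro add_mono mult_left_mono) auto
    then show "0 \<le> s * l i + t * m i \<and> s * l i + t * m i \<le> 1" using l m i st by auto
  qed
  ultimately show "s *\<^sub>R x + t *\<^sub>R y \<in> zonogon n \<xi>" unfolding zonogon_def
    by (intro CollectI exI[of _ "\<lambda>i. s * l i + t * m i"]) simp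
qed

lemma pt_as_combination: "X \<subseteq> {1..n} \<Longrightarrow> pt \<xi> X = (\<Sum>i\<in>{1..n}. of_bool (i \<in> X) *\<^sub>R \<xi> i)"
proof -
  assume X: "X \<subseteq> {1..n}"
  have "(\<Sum>i\<in>{1..n}. of_bool (i \<in> X) *\<^sub>R \<xi> i) = (\<Sum>i\<in>{1..n}. if i \<in> X then \<xi> i else 0)"
    by (intro sum.cong) auto
  also have "\<dots> = pt \<xi> X" unfolding pt_def using X by (simp add: sum.inter_restrict[symmetric] Int_absorb1)
  finally show ?thesis by simp
qed

lemma pt_in_zonogon: "X \<subseteq> {1..n} \<Longrightarrow> pt \<xi> X \<in> zonogon n \<xi>"
  unfolding zonogon_def
  by (intro CollectI exI[of _ "\<lambda>i. of_bool (i \<in> X)"]) (auto simp: pt_as_combination)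

text \<open>The sign \<open>s\<close> is \<open>1\<close> on the right and \<open>-1\<close> on the
  left. Apart from \<open>k\<close>, whose generator is parallel to the side, \<open>A\<close>
  collects the generators on which the functional \<open>cross (s *\<^sub>R \<xi> k)\<close> is
  negative; so the side minimises this functional over the zonogon.\<close>

lemma boundary_side_direction:
  assumes "(A, B) \<in> boundary_sides"
  obtains k s where "k \<in> {1..n}" "A \<subseteq> {1..n}" "B \<subseteq> {1..n}" "s = 1 \<or> s = -1"
    "pt \<xi> B - pt \<xi> A = s *\<^sub>R \<xi> k" "\<And>i. i \<in> {1..n} \<Longrightarrow> i \<noteq> k \<Longrightarrow> i \<in> A \<longleftrightarrow> s * cross (\<xi> k) (\<xi> i) < 0"
    "k \<in> A \<longleftrightarrow> s = -1"
proof -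
  consider k where "k \<in> {1..n}" "A = {Suc k..n}" "B = {k..n}" | k where "k \<in> {1..n}" "A = {1..k}" "B = {1..<k}"
    using assms unfolding boundary_sides_def by auto
  then show thesis
  proof cases
    case (1 k)
    have "B = insert k A" using 1 by auto
    moreover have "i \<in> A \<longleftrightarrow> cross (\<xi> k) (\<xi> i) < 0" if "i \<in> {1..n}" "i \<noteq> k" for i
      using that 1 cross_generators[of i k] cross_generators[of k i] cross_skew[of "\<xi> k" "\<xi> i"]
      by (cases "i < k") auto
    ultimately show thesis using 1 by (intro that[of k 1]) (auto simp: pt_insert)
  next
    case (2 k)
    have "A = insert k B" using 2 by auto
    moreover have "i \<in> A \<longleftrightarrow> - cross (\<xi> k) (\<xi> i) < 0" if "i \<in> {1..n}" "i \<noteq> k" for i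
      using that 2 cross_generators[of i k] cross_generators[of k i] cross_skew[of "\<xi> k" "\<xi> i"]
      by (cases "i < k") auto
    moreover have "B \<subseteq> {1..n}" "k \<notin> B" using 2 by auto
    ultimately show thesis using 2 by (intro that[of k "-1"]) (auto simp: pt_insert)
  qed
qed

lemma boundary_side_left:
  assumes AB: "(A, B) \<in> boundary_sides" and z: "z \<in> zonogon n \<xi>"
  shows "cross (pt \<xi> B - pt \<xi> A) (z - pt \<xi> A) \<ge> 0"
    and "cross (pt \<xi> B - pt \<xi> A) (z - pt \<xi> A) = 0 \<Longrightarrow> z \<in> closed_segment (pt \<xi> A) (pt \<xi> B)"
proof -
  obtain k s where k: "k \<in> {1..n}" "A \<subseteq> {1..n}" "B \<subseteq> {1..n}" and s: "s = 1 \<or> s = -1"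
    and d: "pt \<xi> B - pt \<xi> A = s *\<^sub>R \<xi> k"
    and iA: "\<And>i. i \<in> {1..n} \<Longrightarrow> i \<noteq> k \<Longrightarrow> i \<in> A \<longleftrightarrow> s * cross (\<xi> k) (\<xi> i) < 0"
    and kA: "k \<in> A \<longleftrightarrow> s = -1"
    using boundary_side_direction[OF AB] by metis
  obtain l where l: "z = (\<Sum>i\<in>{1..n}. l i *\<^sub>R \<xi> i)" "\<And>i. i \<in> {1..n} \<Longrightarrow> 0 \<le> l i \<and> l i \<le> 1"
    using z unfolding zonogon_def by auto
  define c where "c i = l i - of_bool (i \<in> A)" for i
  have zA: "z - pt \<xi> A = (\<Sum>i\<in>{1..n}. c i *\<^sub>R \<xi> i)"
    unfolding l(1) pt_as_combination[OF k(2)] c_def by (simp add: sum_subtractf scaleR_diff_left)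
  have eq: "cross (pt \<xi> B - pt \<xi> A) (z - pt \<xi> A) = (\<Sum>i\<in>{1..n}. c i * (s * cross (\<xi> k) (\<xi> i)))"
    unfolding zA d cross_sum_right by (intro sum.cong) (auto simp: cross_def algebra_simps)
  have nn: "c i * (s * cross (\<xi> k) (\<xi> i)) \<ge> 0" if i: "i \<in> {1..n}" for i
  proof (cases "i = k")
    case True
    then show ?thesis by (simp add: cross_self)
  next
    case False
    then show ?thesis using iA[OF i False] l(2)[OF i] unfolding c_def
      by (cases "i \<in> A") (auto intro: mult_nonpos_nonpos)
  qed
  show "cross (pt \<xi> B - pt \<xi> A) (z - pt \<xi> A) \<ge> 0"
    unfolding eq using nn by (intro sum_nonneg) auto
  assume "cross (pt \<xi> B - pt \<xi> A) (z - pt \<xi> A) = 0"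
  then have zero: "\<forall>i\<in>{1..n}. c i * (s * cross (\<xi> k) (\<xi> i)) = 0"
    unfolding eq using nn by (subst (asm) sum_nonneg_eq_0_iff) auto
  have "c i = 0" if i: "i \<in> {1..n}" "i \<noteq> k" for i
  proof -
    have "cross (\<xi> k) (\<xi> i) \<noteq> 0"
      using cross_generators[of i k] cross_generators[of k i] cross_skew[of "\<xi> k" "\<xi> i"] i k(1)
      by (cases "i < k") auto
    then show ?thesis using zero i s by auto
  qed
  then have "z - pt \<xi> A = (\<Sum>i\<in>{1..n}. if i = k then c k *\<^sub>R \<xi> k else 0)"
    unfolding zA by (intro sum.cong) auto
  then have zk: "z - pt \<xi> A = c k *\<^sub>R \<xi> k" using k(1) by simp
  define t where "t = s * c k"
  have t: "0 \<le> t" "t \<le> 1" using s kA l(2)[OF k(1)] by (auto simp: t_def c_def)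
  have "z - pt \<xi> A = t *\<^sub>R (pt \<xi> B - pt \<xi> A)" unfolding zk d t_def using s by auto
  then have "z = (1 - t) *\<^sub>R pt \<xi> A + t *\<^sub>R pt \<xi> B" by (simp add: algebra_simps)
  then show "z \<in> closed_segment (pt \<xi> A) (pt \<xi> B)" using t unfolding closed_segment_def by blast
qed

lemma boundary_side_edge:
  assumes AB: "(A, B) \<in> boundary_sides"
  shows "closed_segment (pt \<xi> A) (pt \<xi> B) edge_of zonogon n \<xi>"
proof -
  let ?Z = "zonogon n \<xi>" and ?w = "pt \<xi> B - pt \<xi> A"
  obtain k s where k: "k \<in> {1..n}" "A \<subseteq> {1..n}" "B \<subseteq> {1..n}" and s: "s = 1 \<or> s = -1"
    and d: "pt \<xi> B - pt \<xi> A = s *\<^sub>R \<xi> k"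
    using boundary_side_direction[OF AB] by metis
  have ne: "pt \<xi> A \<noteq> pt \<xi> B" using d s norm_generator[OF k(1)] by auto
  have w: "(\<i> * ?w) \<bullet> y = cross ?w (y - pt \<xi> A) + (\<i> * ?w) \<bullet> pt \<xi> A" for y
    unfolding inner_ii_mult cross_diff_right by simp
  have "?Z \<inter> {y. (\<i> * ?w) \<bullet> y = (\<i> * ?w) \<bullet> pt \<xi> A} face_of ?Z"
  proof (rule face_of_Int_supporting_hyperplane_ge[OF convex_zonogon])
    fix y assume "y \<in> ?Z"
    then show "(\<i> * ?w) \<bullet> y \<ge> (\<i> * ?w) \<bullet> pt \<xi> A" using boundary_side_left(1)[OF AB] w[of y] by simp
  qed
  moreover have "?Z \<inter> {y. (\<i> * ?w) \<bullet> y = (\<i> * ?w) \<bullet> pt \<xi> A} = closed_segment (pt \<xi> A) (pt \<xi> B)"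
  proof (intro equalityI subsetI)
    fix y assume "y \<in> ?Z \<inter> {y. (\<i> * ?w) \<bullet> y = (\<i> * ?w) \<bullet> pt \<xi> A}"
    then have "y \<in> ?Z" "cross ?w (y - pt \<xi> A) = 0" using w[of y] by auto
    then show "y \<in> closed_segment (pt \<xi> A) (pt \<xi> B)" using boundary_side_left(2)[OF AB] by blast
  next
    fix y assume y: "y \<in> closed_segment (pt \<xi> A) (pt \<xi> B)"
    then have "y \<in> ?Z"
      using closed_segment_subset[OF pt_in_zonogon[OF k(2)] pt_in_zonogon[OF k(3)] convex_zonogon] by blast
    then show "y \<in> ?Z \<inter> {y. (\<i> * ?w) \<bullet> y = (\<i> * ?w) \<bullet> pt \<xi> A}"
      using cross_closed_segment[OF y] w[of y] by simp
  qed
  ultimately show ?thesis unfolding edge_of_def using ne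
    by (simp add: segment_convex_hull aff_dim_convex_hull)
qed

text \<open>Toggling one element shows that a minimiser contains all generators with negative value
  and none with positive value. Two distinct minimisers differ at some \<open>k\<close> of value
  zero; no other generator is parallel to \<open>\<xi> k\<close>, so everything else is
  determined.\<close>

lemma supported_pair_boundary:
  assumes A: "A \<subseteq> {1..n}" and B: "B \<subseteq> {1..n}" and "A \<noteq> B" and w: "w \<noteq> 0"
    and sA: "\<And>y. y \<in> zonogon n \<xi> \<Longrightarrow> w \<bullet> pt \<xi> A \<le> w \<bullet> y"
    and sB: "\<And>y. y \<in> zonogon n \<xi> \<Longrightarrow> w \<bullet> pt \<xi> B \<le> w \<bullet> y"
  shows "(A, B) \<in> boundary_sides \<or> (B, A) \<in> boundary_sides"
proof -
  have mem: "w \<bullet> \<xi> i > 0 \<Longrightarrow> i \<notin> X" "w \<bullet> \<xi> i < 0 \<Longrightarrow> i \<in> X"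
    if X: "X \<subseteq> {1..n}" and s: "\<And>y. y \<in> zonogon n \<xi> \<Longrightarrow> w \<bullet> pt \<xi> X \<le> w \<bullet> y" and i: "i \<in> {1..n}" for X i
  proof -
    have "w \<bullet> \<xi> i \<le> 0" if "i \<in> X"
    proof -
      have "pt \<xi> (X - {i}) \<in> zonogon n \<xi>" using X by (intro pt_in_zonogon) auto
      from s[OF this] show ?thesis using pt_remove[OF X that] by (simp add: inner_diff_right)
    qed
    moreover have "w \<bullet> \<xi> i \<ge> 0" if "i \<notin> X"
    proof -
      have "pt \<xi> (insert i X) \<in> zonogon n \<xi>" using X i by (intro pt_in_zonogon) auto
      from s[OF this] show ?thesis using pt_insert[OF X that] by (simp add: inner_add_right)
    qed
    ultimately show "w \<bullet> \<xi> i > 0 \<Longrightarrow> i \<notin> X" "w \<bullet> \<xi> i < 0 \<Longrightarrow> i \<in> X" by force+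
  qed
  note memA = mem[OF A sA] and memB = mem[OF B sB]
  obtain k where k: "k \<in> {1..n}" "k \<in> A \<longleftrightarrow> k \<notin> B" using \<open>A \<noteq> B\<close> A B by blast
  then have wk: "w \<bullet> \<xi> k = 0" using memA[of k] memB[of k] by (metis linorder_neqE_linordered_idom)
  \<comment> \<open>As \<open>w\<close> is orthogonal to \<open>\<xi> k\<close>, it is
    \<open>t\<close> times the normal of \<open>\<xi> k\<close>. The sign of \<open>t\<close>
    distinguishes the right boundary from the left.\<close>
  define t where "t = - cross w (\<xi> k)"
  have nk: "Re (\<xi> k) ^ 2 + Im (\<xi> k) ^ 2 = 1" using norm_generator[OF k(1)] by (metis cmod_power2 power_one)
  have "w = t *\<^sub>R (\<i> * \<xi> k)"
  proof -
    have "(Re (\<xi> k) ^ 2 + Im (\<xi> k) ^ 2) *\<^sub>R w = (w \<bullet> \<xi> k) *\<^sub>R \<xi> k + t *\<^sub>R (\<i> * \<xi> k)"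
      unfolding t_def by (simp add: complex_eq_iff cross_def inner_complex_def power2_eq_square algebra_simps)
    then show ?thesis using nk wk by simp
  qed
  then have wi: "w \<bullet> \<xi> i = t * cross (\<xi> k) (\<xi> i)" for i by (simp add: inner_ii_mult)
  have t0: "t \<noteq> 0" using \<open>w = t *\<^sub>R (\<i> * \<xi> k)\<close> w by auto
  have sign: "i < k \<Longrightarrow> cross (\<xi> k) (\<xi> i) > 0" "k < i \<Longrightarrow> cross (\<xi> k) (\<xi> i) < 0" if "i \<in> {1..n}" for i
    using cross_generators[of i k] cross_generators[of k i] cross_skew[of "\<xi> k" "\<xi> i"] that k(1) by auto
  show ?thesis
  proof (cases "t > 0")
    case True
    have rng: "X - {k} = {Suc k..n}" if "X \<subseteq> {1..n}" "\<And>i. i \<in> {1..n} \<Longrightarrow> 0 < w \<bullet> \<xi> i \<Longrightarrow> i \<notin> X"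
      "\<And>i. i \<in> {1..n} \<Longrightarrow> w \<bullet> \<xi> i < 0 \<Longrightarrow> i \<in> X" for X
    proof -
      have h: "i \<in> X \<longleftrightarrow> k < i" if i: "i \<in> {1..n}" "i \<noteq> k" for i
      proof (cases "i < k")
        case c: True
        then have "0 < w \<bullet> \<xi> i" using sign(1)[OF i(1)] True unfolding wi by simp
        then show ?thesis using \<open>\<And>i. i \<in> {1..n} \<Longrightarrow> 0 < w \<bullet> \<xi> i \<Longrightarrow> i \<notin> X\<close>[OF i(1)] c by simp
      next
        case c: False
        then have "w \<bullet> \<xi> i < 0" using sign(2)[OF i(1)] True i(2) unfolding wi by (simp add: mult_pos_neg)
        then show ?thesis using \<open>\<And>i. i \<in> {1..n} \<Longrightarrow> w \<bullet> \<xi> i < 0 \<Longrightarrow> i \<in> X\<close>[OF i(1)] c i(2) by simp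
      qed
      show ?thesis
      proof (rule set_eqI)
        fix x
        show "x \<in> X - {k} \<longleftrightarrow> x \<in> {Suc k..n}"
          using h[of x] \<open>X \<subseteq> {1..n}\<close> k(1) by (cases "x \<in> {1..n}") auto
      qed
    qed
    have X: "A - {k} = {Suc k..n}" "B - {k} = {Suc k..n}"
      by (rule rng[OF A memA], assumption+) (rule rng[OF B memB], assumption+)
    have "{k..n} = insert k {Suc k..n}" using k(1) by auto
    then have "A = {k..n} \<and> B = {Suc k..n} \<or> B = {k..n} \<and> A = {Suc k..n}"
      using X k(2) by (metis Diff_empty Diff_insert0 insert_Diff)
    then show ?thesis using k(1) unfolding boundary_sides_def by blast
  next
    case False
    then have t: "t < 0" using t0 by simp
    have rng: "X - {k} = {1..<k}" if "X \<subseteq> {1..n}" "\<And>i. i \<in> {1..n} \<Longrightarrow> 0 < w \<bullet> \<xi> i \<Longrightarrow> i \<notin> X"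
      "\<And>i. i \<in> {1..n} \<Longrightarrow> w \<bullet> \<xi> i < 0 \<Longrightarrow> i \<in> X" for X
    proof -
      have h: "i \<in> X \<longleftrightarrow> i < k" if i: "i \<in> {1..n}" "i \<noteq> k" for i
      proof (cases "i < k")
        case c: False
        then have "0 < w \<bullet> \<xi> i" using sign(2)[OF i(1)] t i(2) unfolding wi by (simp add: mult_neg_neg)
        then show ?thesis using \<open>\<And>i. i \<in> {1..n} \<Longrightarrow> 0 < w \<bullet> \<xi> i \<Longrightarrow> i \<notin> X\<close>[OF i(1)] c by simp
      next
        case c: True
        then have "w \<bullet> \<xi> i < 0" using sign(1)[OF i(1)] t unfolding wi by (simp add: mult_neg_pos)
        then show ?thesis using \<open>\<And>i. i \<in> {1..n} \<Longrightarrow> w \<bullet> \<xi> i < 0 \<Longrightarrow> i \<in> X\<close>[OF i(1)] c by simp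
      qed
      show ?thesis
      proof (rule set_eqI)
        fix x
        show "x \<in> X - {k} \<longleftrightarrow> x \<in> {1..<k}"
          using h[of x] \<open>X \<subseteq> {1..n}\<close> k(1) by (cases "x \<in> {1..n}") auto
      qed
    qed
    have X: "A - {k} = {1..<k}" "B - {k} = {1..<k}"
      by (rule rng[OF A memA], assumption+) (rule rng[OF B memB], assumption+)
    have "{1..k} = insert k {1..<k}" using k(1) by auto
    then have "A = {1..k} \<and> B = {1..<k} \<or> B = {1..k} \<and> A = {1..<k}"
      using X k(2) by (metis Diff_empty Diff_insert0 insert_Diff)
    then show ?thesis using k(1) unfolding boundary_sides_def by blast
  qed
qed

end

section \<open>The chain of a combi\<close>

lemma sum_antisymmetric_symmetric:
  assumes f: "antisymmetric f" and sw: "\<And>A B. (A, B) \<in> I \<Longrightarrow> (B, A) \<in> I"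
  shows "(\<Sum>(A, B)\<in>I. f A B) = 0"
proof -
  have "(\<Sum>(A, B)\<in>I. f A B) = (\<Sum>(A, B)\<in>I. f B A)"
    by (intro sum.reindex_bij_witness[of _ prod.swap prod.swap]) (auto intro: sw)
  also have "\<dots> = - (\<Sum>(A, B)\<in>I. f A B)"
    unfolding sum_negf[symmetric] by (intro sum.cong refl) (clarsimp, rule antisymmetricD[OF f])
  finally show ?thesis by simp
qed

context zonogon_frame
begin

context
  fixes K :: "complex set set"
  assumes combi: "combi n \<xi> K"
begin

lemma combi_finite: "finite K"
  using combi unfolding combi_def by (elim conjE)

lemma combi_Union: "\<Union>K = zonogon n \<xi>"
  using combi unfolding combi_def by (elim conjE)

lemma combi_triangulates:
  assumes "P \<in> K"
  shows "\<exists>L M. triangulates P L M"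
proof -
  have tile: "Delta_tile n \<xi> P \<or> Nabla_tile n \<xi> P \<or> lens n \<xi> P"
    using combi assms unfolding combi_def by (elim conjE) simp
  have edges: "(\<exists>i. V_edge n \<xi> i e) \<or> (\<exists>i j. H_edge n \<xi> i j e)" if "e edge_of P" for e
    using combi assms that unfolding combi_def by (elim conjE) simp
  from tile consider "Delta_tile n \<xi> P" | "Nabla_tile n \<xi> P" | "lens n \<xi> P" by blast
  then show ?thesis
  proof cases
    case 1
    then obtain X i j where *: "X \<subseteq> {1..n}" "i \<in> {1..n} - X" "j \<in> {1..n} - X" "i < j"
      and P: "P = convex hull {pt \<xi> (insert i X), pt \<xi> (insert j X), pt \<xi> (insert i (insert j X))}"
      unfolding Delta_tile_def by (elim exE conjE)
    show ?thesis unfolding P using triangle_triangulates[OF tri.delta[OF *]] by (intro exI)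
  next
    case 2
    then obtain X i j where *: "X \<subseteq> {1..n}" "i \<in> {1..n} - X" "j \<in> {1..n} - X" "i < j"
      and P: "P = convex hull {pt \<xi> X, pt \<xi> (insert i X), pt \<xi> (insert j X)}"
      unfolding Nabla_tile_def by (elim exE conjE)
    have "{pt \<xi> X, pt \<xi> (insert i X), pt \<xi> (insert j X)} = {pt \<xi> X, pt \<xi> (insert j X), pt \<xi> (insert i X)}"
      by auto
    then show ?thesis unfolding P using triangle_triangulates[OF tri.nabla[OF *]] by (intro exI) simp
  next
    case 3
    have "\<exists>a b. e = closed_segment a b" if "e edge_of P" for e
      using edges[OF that] unfolding V_edge_def H_edge_def by blast
    then show ?thesis by (rule lens_triangulates[OF 3])
  qed
qed

lemma tile_convex: "P \<in> K \<Longrightarrow> convex P" and tile_closed: "P \<in> K \<Longrightarrow> closed P"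
  and tile_interior: "P \<in> K \<Longrightarrow> interior P \<noteq> {}"
  using combi_triangulates[of P] compact_imp_closed unfolding triangulates_def by auto

lemma tile_subset: "P \<in> K \<Longrightarrow> P \<subseteq> zonogon n \<xi>"
  using combi_Union by blast

lemma tiles_meet:
  assumes "P \<in> K" "Q \<in> K" "P \<noteq> Q"
  shows "P \<inter> Q = {} \<or> (\<exists>v. P \<inter> Q = {v} \<and> v extreme_point_of P) \<or>
    (P \<inter> Q edge_of P \<and> P \<inter> Q edge_of Q)"
proof -
  have "P \<inter> Q = {} \<or> (\<exists>v. P \<inter> Q = {v} \<and> v extreme_point_of P \<and> v extreme_point_of Q) \<or>
    (P \<inter> Q edge_of P \<and> P \<inter> Q edge_of Q)"
    using combi assms unfolding combi_def by (elim conjE) simp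
  then show ?thesis by blast
qed

text \<open>The midpoint of a side is not a vertex of \<open>P\<close>, so the tiles cannot meet in
  just a vertex.\<close>

lemma tiles_common_side:
  assumes P: "P \<in> K" and Q: "Q \<in> K" and "P \<noteq> Q" and s: "(A, B) \<in> sides P"
    and m: "midpoint (pt \<xi> A) (pt \<xi> B) \<in> Q"
  shows "P \<inter> Q = closed_segment (pt \<xi> A) (pt \<xi> B) \<and> P \<inter> Q edge_of Q"
proof -
  let ?e = "closed_segment (pt \<xi> A) (pt \<xi> B)" and ?m = "midpoint (pt \<xi> A) (pt \<xi> B)"
  have edge: "?e edge_of P" using sides_edge[OF s] .
  have ends: "pt \<xi> A \<in> P" "pt \<xi> B \<in> P" using sides_ends[OF s] by auto
  have ne: "pt \<xi> A \<noteq> pt \<xi> B" using edge unfolding edge_of_def by auto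
  have mP: "?m \<in> P" using edge_of_imp_subset[OF edge] by (meson midpoint_in_closed_segment subsetD)
  have "\<not> ?m extreme_point_of P"
    using ends ne unfolding extreme_point_of_def by (metis midpoint_in_open_segment)
  then have "P \<inter> Q edge_of P \<and> P \<inter> Q edge_of Q"
    using tiles_meet[OF P Q \<open>P \<noteq> Q\<close>] mP m by (metis IntI empty_iff singletonD)
  then show ?thesis using face_of_in_rel_interior[OF tile_convex[OF P] edge] mP m by blast
qed

text \<open>Two tiles to the left of the same side overlap off its line, whereas distinct tiles
  containing its midpoint meet only in the side.\<close>

lemma side_unique:
  assumes P: "P \<in> K" and Q: "Q \<in> K" and s: "(A, B) \<in> sides P" "(A, B) \<in> sides Q"
  shows "P = Q"
proof (rule ccontr)
  assume "P \<noteq> Q"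
  obtain z where z: "z \<in> P" "cross (pt \<xi> B - pt \<xi> A) (z - pt \<xi> A) > 0" using sides_witness[OF s(1)] by blast
  obtain z' where z': "z' \<in> Q" "cross (pt \<xi> B - pt \<xi> A) (z' - pt \<xi> A) > 0" using sides_witness[OF s(2)] by blast
  have "\<exists>y\<in>P \<inter> Q. cross (pt \<xi> B - pt \<xi> A) (y - pt \<xi> A) > 0"
    using overlap_on_same_side[OF tile_convex[OF P] _ _ z tile_convex[OF Q] _ _ z'] sides_ends[OF s(1)] sides_ends[OF s(2)]
    by blast
  then obtain y where y: "y \<in> P \<inter> Q" "cross (pt \<xi> B - pt \<xi> A) (y - pt \<xi> A) > 0" by blast
  have "midpoint (pt \<xi> A) (pt \<xi> B) \<in> Q"
    using edge_of_imp_subset[OF sides_edge[OF s(2)]] by (meson midpoint_in_closed_segment subsetD)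
  then have "P \<inter> Q = closed_segment (pt \<xi> A) (pt \<xi> B)" using tiles_common_side[OF P Q \<open>P \<noteq> Q\<close> s(1)] by blast
  then show False using y cross_closed_segment[of y "pt \<xi> A" "pt \<xi> B"] by auto
qed

lemma boundary_side_not_reversed:
  assumes "(A, B) \<in> boundary_sides" "P \<in> K"
  shows "(B, A) \<notin> sides P"
proof
  assume "(B, A) \<in> sides P"
  then obtain z where "z \<in> P" "cross (pt \<xi> A - pt \<xi> B) (z - pt \<xi> B) > 0" using sides_witness by blast
  then show False
    using boundary_side_left(1)[OF assms(1), of z] tile_subset[OF assms(2)] cross_flip[of "pt \<xi> A" "pt \<xi> B" z]
    by auto
qed

text \<open>A face of the zonogon inside a tile is a face of that tile. Without a point strictly to
  the left, the tile would lie on the supporting line and have empty interior.\<close>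

lemma boundary_side_in_tile:
  assumes AB: "(A, B) \<in> boundary_sides"
  shows "\<exists>P\<in>K. (A, B) \<in> sides P"
proof -
  let ?e = "closed_segment (pt \<xi> A) (pt \<xi> B)" and ?w = "pt \<xi> B - pt \<xi> A"
  have edge: "?e edge_of zonogon n \<xi>" using boundary_side_edge[OF AB] .
  moreover have "\<forall>e. e edge_of zonogon n \<xi> \<longrightarrow> (\<exists>!P. P \<in> K \<and> e \<subseteq> P)"
    using combi unfolding combi_def by (elim conjE)
  ultimately obtain P where P: "P \<in> K" "?e \<subseteq> P" by blast
  have "?e edge_of P"
    using edge face_of_subset[of ?e "zonogon n \<xi>" P] P tile_subset unfolding edge_of_def by blast
  moreover have "A \<subseteq> {1..n}" "B \<subseteq> {1..n}" using AB unfolding boundary_sides_def by auto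
  moreover have "\<exists>z\<in>P. cross ?w (z - pt \<xi> A) > 0"
  proof (rule ccontr)
    assume n: "\<not> ?thesis"
    have "(\<i> * ?w) \<bullet> y = (\<i> * ?w) \<bullet> pt \<xi> A" if "y \<in> P" for y
    proof -
      have "cross ?w (y - pt \<xi> A) \<ge> 0" using boundary_side_left(1)[OF AB] that tile_subset[OF P(1)] by blast
      then have "cross ?w (y - pt \<xi> A) = 0" using n that by force
      then show ?thesis unfolding inner_ii_mult cross_diff_right by simp
    qed
    then have "P \<subseteq> {y. (\<i> * ?w) \<bullet> y = (\<i> * ?w) \<bullet> pt \<xi> A}" by blast
    then have "interior P \<subseteq> interior {y. (\<i> * ?w) \<bullet> y = (\<i> * ?w) \<bullet> pt \<xi> A}" by (rule interior_mono)
    moreover have "pt \<xi> A \<noteq> pt \<xi> B" using edge unfolding edge_of_def by auto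
    then have "\<i> * ?w \<noteq> 0" by simp
    ultimately show False using interior_hyperplane tile_interior[OF P(1)] by blast
  qed
  ultimately show ?thesis using P(1) unfolding sides_def by blast
qed

text \<open>The midpoint is interior to the zonogon, since a supporting line there would contain
  both ends and make the side a boundary side. A tile reached just across the side then has to share
  it.\<close>

lemma inner_side_reversed:
  assumes P: "P \<in> K" and s: "(A, B) \<in> sides P" and nb: "(A, B) \<notin> boundary_sides"
  shows "\<exists>Q\<in>K. (B, A) \<in> sides Q"
proof -
  let ?Z = "zonogon n \<xi>" and ?w = "pt \<xi> B - pt \<xi> A"
  let ?m = "midpoint (pt \<xi> A) (pt \<xi> B)"
  have sub: "A \<subseteq> {1..n}" "B \<subseteq> {1..n}" using sides_subset[OF s] by auto
  obtain z where z: "z \<in> P" "cross ?w (z - pt \<xi> A) > 0" using sides_witness[OF s] by blast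
  have ne: "pt \<xi> A \<noteq> pt \<xi> B" using cross_pos_neq[OF z(2)] .
  have mP: "?m \<in> P"
    using edge_of_imp_subset[OF sides_edge[OF s]] by (meson midpoint_in_closed_segment subsetD)
  then have mZ: "?m \<in> ?Z" using tile_subset[OF P] by blast
  have "?m \<in> interior ?Z"
  proof (rule ccontr)
    assume "?m \<notin> interior ?Z"
    moreover have "interior ?Z \<noteq> {}" using interior_mono[OF tile_subset[OF P]] tile_interior[OF P] by blast
    ultimately have "?m \<notin> rel_interior ?Z" using rel_interior_nonempty_interior by blast
    then obtain a where a: "a \<noteq> 0" "\<And>y. y \<in> ?Z \<Longrightarrow> a \<bullet> ?m \<le> a \<bullet> y"
      using supporting_hyperplane_rel_boundary[OF convex_zonogon mZ] by metis
    have "2 * (a \<bullet> ?m) = a \<bullet> pt \<xi> A + a \<bullet> pt \<xi> B"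
      by (simp add: midpoint_def inner_add_right field_simps)
    then have "a \<bullet> pt \<xi> A = a \<bullet> ?m" "a \<bullet> pt \<xi> B = a \<bullet> ?m"
      using a(2)[OF pt_in_zonogon[OF sub(1)]] a(2)[OF pt_in_zonogon[OF sub(2)]] by linarith+
    then have "(A, B) \<in> boundary_sides \<or> (B, A) \<in> boundary_sides"
      using a ne by (intro supported_pair_boundary[OF sub _ a(1)]) auto
    then show False using nb boundary_side_not_reversed[of B A P] P s by blast
  qed
  \<comment> \<open>There are finitely many closed tiles, so a small ball about the midpoint meets
    only tiles that contain the midpoint. The point \<open>y\<close> is taken in this ball, to the
    right of the side.\<close>
  moreover have "closed (\<Union>{Q \<in> K. ?m \<notin> Q})" using combi_finite tile_closed by (intro closed_Union) auto
  ultimately have "open (interior ?Z - \<Union>{Q \<in> K. ?m \<notin> Q})" "?m \<in> interior ?Z - \<Union>{Q \<in> K. ?m \<notin> Q}"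
    by auto
  then obtain \<epsilon> where e: "\<epsilon> > 0" "ball ?m \<epsilon> \<subseteq> interior ?Z - \<Union>{Q \<in> K. ?m \<notin> Q}"
    using open_contains_ball by blast
  define t where "t = \<epsilon> / (2 * norm ?w)"
  have t: "t > 0" "t * norm ?w < \<epsilon>" using e ne by (auto simp: t_def)
  define y where "y = ?m + (- t) *\<^sub>R (\<i> * ?w)"
  have "dist ?m y = t * norm ?w" using t(1) by (simp add: y_def dist_norm norm_mult)
  then have y: "y \<in> ball ?m \<epsilon>" using t by simp
  then have "y \<in> ?Z" using e(2) interior_subset by blast
  then obtain Q where Q: "Q \<in> K" "y \<in> Q" using combi_Union by blast
  then have mQ: "?m \<in> Q" using y e(2) by blast
  have cy: "cross ?w (y - pt \<xi> A) < 0"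
    unfolding y_def cross_midpoint_normal using t ne by (simp add: mult_neg_pos)
  then have "P \<noteq> Q" using sides_left[OF tile_convex[OF P] s] Q by force
  then have "closed_segment (pt \<xi> A) (pt \<xi> B) edge_of Q" using tiles_common_side[OF P Q(1) _ s mQ] by metis
  moreover have "cross (pt \<xi> A - pt \<xi> B) (y - pt \<xi> B) > 0" using cy by (simp add: cross_flip[of "pt \<xi> A" "pt \<xi> B"])
  ultimately have "(B, A) \<in> sides Q" using sub Q(2) unfolding sides_def by (auto simp: closed_segment_commute)
  then show ?thesis using Q(1) by blast
qed

section \<open>Cancellation of the inner sides\<close>

lemma sum_boundary_sides:
  assumes f: "antisymmetric f"
  shows "(\<Sum>(A, B)\<in>boundary_sides. f A B) = bdry 1 (Suc n) f"
proof -
  let ?R = "\<lambda>k. ({Suc k..n}, {k..n})" and ?L = "\<lambda>k::nat. ({1..k}, {1..<k})"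
  have "inj_on ?R {1..n}" by (auto simp: inj_on_def Icc_eq_Icc)
  moreover have "inj_on ?L {1..n}" by (auto simp: inj_on_def Icc_eq_Icc)
  moreover have "?R ` {1..n} \<inter> ?L ` {1..n} = {}"
  proof -
    have "?R k \<noteq> ?L l" if "k \<in> {1..n}" "l \<in> {1..n}" for k l
    proof
      assume "?R k = ?L l"
      then have e: "{Suc k..n} = {1..l}" "{k..n} = {1..<l}" by auto
      have "k \<in> {k..n}" "k \<notin> {Suc k..n}" using that by auto
      then show False unfolding e by auto
    qed
    then show ?thesis by blast
  qed
  ultimately have "(\<Sum>(A, B)\<in>boundary_sides. f A B) =
      (\<Sum>k\<in>{1..n}. f {Suc k..n} {k..n}) + (\<Sum>k\<in>{1..n}. f {1..k} {1..<k})"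
    unfolding boundary_sides_def by (subst sum.union_disjoint) (simp_all add: sum.reindex)
  also have "\<dots> = (\<Sum>k\<in>{1..n}. f {Suc k..n} {k..n} - f {1..<k} {1..k})"
    unfolding sum.distrib[symmetric]
  proof (intro sum.cong refl)
    fix k
    show "f {Suc k..n} {k..n} + f {1..k} {1..<k} = f {Suc k..n} {k..n} - f {1..<k} {1..k}"
      using antisymmetricD[OF f, of "{1..k}" "{1..<k}"] by simp
  qed
  finally show ?thesis unfolding bdry_def by (simp add: atLeastLessThanSuc_atLeastAtMost)
qed

lemma sum_sides:
  assumes f: "antisymmetric f" and fin: "\<And>P. P \<in> K \<Longrightarrow> finite (sides P)"
  shows "(\<Sum>P\<in>K. \<Sum>(A, B)\<in>sides P. f A B) = bdry 1 (Suc n) f"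
proof -
  let ?E = "\<Union>P\<in>K. sides P"
  have finE: "finite ?E" using combi_finite fin by auto
  have "\<forall>P\<in>K. \<forall>Q\<in>K. P \<noteq> Q \<longrightarrow> sides P \<inter> sides Q = {}" using side_unique by auto
  then have "(\<Sum>(A, B)\<in>?E. f A B) = (\<Sum>P\<in>K. \<Sum>(A, B)\<in>sides P. f A B)"
    using combi_finite fin by (intro sum.UNION_disjoint) auto
  moreover have "boundary_sides \<subseteq> ?E" using boundary_side_in_tile by auto
  then have "(\<Sum>(A, B)\<in>?E. f A B) = (\<Sum>(A, B)\<in>?E - boundary_sides. f A B) + (\<Sum>(A, B)\<in>boundary_sides. f A B)"
    by (intro sum.subset_diff finE)
  moreover have "(\<Sum>(A, B)\<in>?E - boundary_sides. f A B) = 0"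
  proof -
    let ?I = "?E - boundary_sides"
    have sw: "(B, A) \<in> ?I" if AB: "(A, B) \<in> ?I" for A B
    proof -
      obtain P where P: "P \<in> K" "(A, B) \<in> sides P" "(A, B) \<notin> boundary_sides" using AB by blast
      then obtain Q where "Q \<in> K" "(B, A) \<in> sides Q" using inner_side_reversed[OF P] by blast
      moreover have "(B, A) \<notin> boundary_sides" using boundary_side_not_reversed[of B A P] P by blast
      ultimately show ?thesis by blast
    qed
    then show ?thesis by (rule sum_antisymmetric_symmetric[OF f])
  qed
  ultimately show ?thesis using sum_boundary_sides[OF f] by simp
qed

lemma boundary_sets_in_spectrum: "boundary_sets 1 (Suc n) \<subseteq> spectrum n \<xi> K"
proof
  fix X assume X: "X \<in> boundary_sets 1 (Suc n)"
  have "pt \<xi> {} \<in> zonogon n \<xi>" by (intro pt_in_zonogon) simp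
  then obtain P where P: "P \<in> K" using combi_Union by blast
  \<comment> \<open>For \<open>n = 0\<close> the zonogon is a point, but \<open>P\<close> has
    interior points. This gives the sets \<open>{}\<close> and \<open>{1..n}\<close> a boundary side
    to lie on.\<close>
  have "n \<noteq> 0"
  proof
    assume "n = 0"
    then have "zonogon n \<xi> = {0}" unfolding zonogon_def by auto
    then have "interior P \<subseteq> interior {0}" using tile_subset[OF P] interior_mono by metis
    then show False using tile_interior[OF P] by simp
  qed
  have "\<exists>A B. (A, B) \<in> boundary_sides \<and> (X = A \<or> X = B)"
  proof -
    consider k where "k \<in> {1..n}" "X = {1..<k}" | "X = {1..n}" | k where "k \<in> {1..n}" "X = {k..n}" | "X = {}"
      using X unfolding boundary_sets_def by (auto simp: le_Suc_eq atLeastLessThanSuc_atLeastAtMost)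
    then show ?thesis
    proof cases
      case (1 k)
      then show ?thesis unfolding boundary_sides_def by blast
    next
      case 2
      then have "({1..n}, {1..<n}) \<in> boundary_sides"
        unfolding boundary_sides_def using \<open>n \<noteq> 0\<close> by (intro UnI2 image_eqI[of _ _ n]) auto
      then show ?thesis using 2 by blast
    next
      case (3 k)
      then show ?thesis unfolding boundary_sides_def by blast
    next
      case 4
      then have "({Suc n..n}, {n..n}) \<in> boundary_sides"
        unfolding boundary_sides_def using \<open>n \<noteq> 0\<close> by (intro UnI1 image_eqI[of _ _ n]) auto
      then show ?thesis using 4 by (metis atLeastatMost_empty lessI)
    qed
  qed
  then obtain A B where AB: "(A, B) \<in> boundary_sides" "X = A \<or> X = B" by blast
  then obtain Q where Q: "Q \<in> K" "(A, B) \<in> sides Q" using boundary_side_in_tile by blast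
  then have "closed_segment (pt \<xi> A) (pt \<xi> B) face_of Q" using sides_edge unfolding edge_of_def by blast
  then have "pt \<xi> X extreme_point_of Q" using segment_face_of AB(2) by blast
  then show "X \<in> spectrum n \<xi> K"
    unfolding spectrum_def using Q AB(2) sides_subset by blast
qed

lemma combi_chain: "\<exists>c. chain 1 (Suc n) c \<and> chain_sets 1 (Suc n) c = spectrum n \<xi> K"
proof -
  have "\<forall>P\<in>K. \<exists>M. triangulates P (sides P) M" using combi_triangulates sides_eq by metis
  then obtain M where M: "\<And>P. P \<in> K \<Longrightarrow> triangulates P (sides P) (M P)" by metis
  define c where "c = (\<Sum>P\<in>K. M P)"
  have set_c: "set_mset c = (\<Union>P\<in>K. set_mset (M P))" unfolding c_def by (rule set_mset_sum[OF combi_finite])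
  have "tri {1..<Suc n} T" if "T \<in># c" for T
    using that M unfolding set_c triangulates_def by (auto simp: atLeastLessThanSuc_atLeastAtMost)
  moreover have "(\<Sum>T\<in>#c. coboundary f T) = bdry 1 (Suc n) f" if f: "antisymmetric f" for f
  proof -
    have "(\<Sum>T\<in>#c. coboundary f T) = (\<Sum>P\<in>K. \<Sum>T\<in>#M P. coboundary f T)"
      unfolding c_def by (rule sum_mset_sum[OF combi_finite])
    also have "\<dots> = (\<Sum>P\<in>K. \<Sum>(A, B)\<in>sides P. f A B)"
      using M f unfolding triangulates_def by (intro sum.cong) auto
    also have "\<dots> = bdry 1 (Suc n) f"
      using M unfolding triangulates_def by (intro sum_sides[OF f]) auto
    finally show ?thesis .
  qed
  ultimately have "chain 1 (Suc n) c" unfolding chain_def by blast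
  moreover have "(\<Union>T\<in>set_mset c. corners T) = (\<Union>P\<in>K. \<Union>T\<in>set_mset (M P). corners T)"
    unfolding set_c by blast
  then have "(\<Union>T\<in>set_mset c. corners T) = spectrum n \<xi> K"
    using M unfolding triangulates_def spectrum_def by auto
  then have "chain_sets 1 (Suc n) c = spectrum n \<xi> K"
    unfolding chain_sets_def using boundary_sets_in_spectrum by blast
  ultimately show ?thesis by blast
qed

end

end

theorem theorem3p4:
  fixes n :: nat and \<xi> :: "nat \<Rightarrow> complex" and K :: "complex set set"
  assumes "zonogon_generators n \<xi>"
    and "combi n \<xi> K"
  shows "maximal_w_collection n (spectrum n \<xi> K)"
proof -
  interpret zonogon_frame n \<xi> by unfold_locales (rule assms(1))
  obtain c where "chain 1 (Suc n) c" "chain_sets 1 (Suc n) c = spectrum n \<xi> K"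
    using combi_chain[OF assms(2)] by blast
  then show ?thesis using chain_sets_maximal by metis
qed

end
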